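(* Let $q$ be an odd prime power, $\mathbb{A}=\mathbb{F}_q[X]$, and let $f\in\mathbb{A}$ with $\deg f\ge1$ have prime factorization $f=aP_1^{e_1}\cdots P_t^{e_t}$ ($a\in\mathbb{F}_q^*$, $P_j$ distinct monic irreducible, $e_j\ge1$). Let $S\subseteq\mathbb{F}_q^*$ be any set with $|S|=(q-1)/2$ such that $\alpha\in S$ implies $-\alpha\notin S$. Then: (1) $\mathrm{ord}_f G(f,S)=4$ when $t=1$ and either $q\equiv1\pmod 4$ or $\deg P_1$ is even. (2) $\mathrm{ord}_f G(f,S)=2$ when (a) $t=1$, $q\equiv 3\pmod 4$, $\deg P_1$ odd, $\delta(S)=1$, and $e_1+\frac12(h(-P_1)-3)\equiv 1\pmod 2$; or (b) $t=1$, $q\equiv 3\pmod 4$, $\deg P_1$ odd, $\delta(S)=-1$, and $e_1+\frac12(h(-P_1)-3)\equiv 0\pmod 2$; or (c) $t=2$, $q\equiv1\pmod4$, and $P_1$ is not a quadratic residue modulo $P_2$; or (d) $t=2$, $q\equiv3\pmod4$, both $\deg P_1$ and $\deg P_2$ are even, and $P_1$ is not a quadratic residue modulo $P_2$; or (e) $t=2$, $q\equiv 3\pmod4$, and either $\deg P_1$ or $\deg P_2$ is odd. (3) $\mathrm{ord}_f G(f,S)=1$ in all other cases.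
   Context: For non-zero $g\in\mathbb{A}$, $\mathrm{sgn}(g)$ denotes the leading coefficient of $g$. Define $\delta(S)=\prod_{a\in S}a$ and $G(f,S)=\prod g$, the product over all non-zero $g\in\mathbb{A}$ with $\mathrm{sgn}(g)\in S$, $0\le\deg g<\deg f$, and $\gcd(g,f)=1$. $\mathrm{ord}_f(\cdot)$ denotes the multiplicative order modulo $f$ (of an element coprime to $f$). For a monic irreducible $P$ of odd degree, $h(-P)$ denotes the class number of the quadratic function field $\mathbb{F}_q(X,\sqrt{-P})$; by a result of Artin it satisfies $h(-P)=\sum_{g \text{ monic},\,0\le\deg g<\deg P}\left(\frac{g}{P}\right)$, where $\left(\frac{g}{P}\right)=\pm1$ is the Legendre symbol, $\left(\frac{g}{P}\right)\equiv g^{(q^{\deg P}-1)/2}\pmod P$ for $\gcd(g,P)=1$ (and $0$-free sum since all such $g$ are coprime to $P$). *)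

theory Defs
  imports
    "HOL-Algebra.Algebraic_Closure_Type"
    "HOL-Algebra.Generated_Fields"
    "HOL-Number_Theory.Number_Theory"
    "HOL-Library.Cardinality"
begin

text \<open>
  The finite field is a type \<open>'a :: {finite, field}\<close> and \<open>\<A>\<close> is the type \<open>'a poly\<close>.
  The multiplicative order modulo \<open>f\<close> is the library's \<open>ord f\<close>, which is available in any
  Euclidean ring and takes the value 0 on elements that are not coprime to \<open>f\<close>.
\<close>

definition delta :: "'a :: field set \<Rightarrow> 'a"
  where "delta S = (\<Prod>a\<in>S. a)"

definition G :: "'a :: field poly \<Rightarrow> 'a set \<Rightarrow> 'a poly"
  where "G f S =
    (\<Prod>g \<in> {g. g \<noteq> 0 \<and> Polynomial.lead_coeff g \<in> S \<and>
               Polynomial.degree g < Polynomial.degree f \<and> coprime g f}. g)"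

text \<open>The analogue of \<^const>\<open>QuadRes\<close>, which is restricted to the integers.\<close>

definition poly_QuadRes :: "'a :: field poly \<Rightarrow> 'a poly \<Rightarrow> bool"
  where "poly_QuadRes p a \<longleftrightarrow> (\<exists>y. [y ^ 2 = a] (mod p))"

text \<open>
  The quadratic function field \<open>\<F>\<^sub>q(X, \<surd>D)\<close> is taken inside a fixed algebraic closure of
  \<open>\<F>\<^sub>q(X)\<close>. Adjoining both square roots of \<open>D\<close> avoids choosing one.
\<close>

definition poly_to_ac :: "'a :: field poly \<Rightarrow> 'a poly fract alg_closure"
  where "poly_to_ac p = to_ac (to_fract p)"

definition quad_function_field :: "'a :: field poly \<Rightarrow> 'a poly fract alg_closure set"
  where "quad_function_field D =
    generate_field ring_of_type_algebra (range to_ac \<union> {y. y ^ 2 = poly_to_ac D})"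

definition quad_integers :: "'a :: field poly \<Rightarrow> 'a poly fract alg_closure set"
  where "quad_integers D =
    {z \<in> quad_function_field D.
       \<exists>p :: 'a poly poly. Polynomial.lead_coeff p = 1 \<and> poly (map_poly poly_to_ac p) z = 0}"

definition quad_integer_ring :: "'a :: field poly \<Rightarrow> 'a poly fract alg_closure ring"
  where "quad_integer_ring D = ring_of_type_algebra \<lparr>carrier := quad_integers D\<rparr>"

definition nonzero_ideals :: "'a :: field poly \<Rightarrow> 'a poly fract alg_closure set set"
  where "nonzero_ideals D = {I. ideal I (quad_integer_ring D) \<and> I \<noteq> {0}}"

definition ideal_class_rel ::
    "'a :: field poly \<Rightarrow> ('a poly fract alg_closure set \<times> 'a poly fract alg_closure set) set"
  where "ideal_class_rel D =
    {(I, J). I \<in> nonzero_ideals D \<and> J \<in> nonzero_ideals D \<and>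
       (\<exists>a \<in> quad_integers D - {0}. \<exists>b \<in> quad_integers D - {0}. (*) a ` I = (*) b ` J)}"

text \<open>
  The class number of \<open>\<F>\<^sub>q(X, \<surd>D)\<close> in Artin's sense: the number of ideal classes of the
  integral closure of \<open>\<F>\<^sub>q[X]\<close>. For \<open>q\<close> odd and \<open>P\<close> monic irreducible of odd degree,
  \<open>h(-P)\<close> is odd, so \<open>(h(-P) - 3) div 2\<close> is an exact division; it is taken in the integers
  because \<open>h(-P) = 1\<close> is possible.
\<close>

definition class_number :: "'a :: field poly \<Rightarrow> nat"
  where "class_number D = card (nonzero_ideals D // ideal_class_rel D)"

end

(*
  G(f,S) is a product over representatives of the group of units modulo f by its subgroup {1,-1}.
  Modulo a prime power P^k, splitting residues as r + P^k s and removing the multiples of the other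
  primes one at a time reduces the product to Wilson's theorem and Euler's criterion: with one
  further prime Q it is (Q/P) (-1)^((q^deg Q - 1)/2), with more it is 1, and with none its square
  is 1 or -1. Comparing two half systems modulo P Q (Rousseau's argument) gives quadratic reciprocity,
  which makes the two signs for t = 2 compatible.

  For t = 1, q = 3 mod 4 and odd degree the remaining sign is the product of the Legendre symbols of
  the monic polynomials below P, hence is read off modulo 4 from their sum. That this sum is the
  ideal class number h is proved by counting ideals of A[sqrt(-P)] by norm degree. On one side the
  ideals c (a, b + sqrt(-P)) with a | b^2 + P are counted by a Dirichlet convolution with the
  character (g/P). On the other side the ideals equivalent to I correspond to the elements of the
  conjugate of I modulo constants, and the F_q-linear map a + b sqrt(-P) -> a(X^2) + X^(deg P) b(X^2)
  turns the norm degree into a degree. In a space of polynomials that contains an element of degree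
  M, the number of elements of degree M is q - 1 times the number of elements of smaller degree; so
  if Z_n is the number of ideals of norm degree n, every class contributes exactly 1 to
  Z_M - (q - 1) (Z_0 + ... + Z_(M-1)) for large M, and this is also the character sum.
*)
theory Submission
  imports Defs
begin

section \<open>Polynomials of bounded degree\<close>

definition polys_below :: "nat \<Rightarrow> 'a::zero poly set" where
  "polys_below n = {g. \<forall>i\<ge>n. coeff g i = 0}"

lemma mem_polys_below: "g \<in> polys_below n \<longleftrightarrow> g = 0 \<or> degree g < n"
proof
  assume "g \<in> polys_below n"
  then show "g = 0 \<or> degree g < n"
    unfolding polys_below_def by (metis (mono_tags) leading_coeff_0_iff mem_Collect_eq not_le)
qed (auto simp: polys_below_def coeff_eq_0)

lemma polys_below_Suc: "polys_below (Suc n) = (\<lambda>(c, g). pCons c g) ` (UNIV \<times> polys_below n)"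
proof (intro equalityI subsetI)
  fix g :: "'a poly" assume g: "g \<in> polys_below (Suc n)"
  obtain c h where gh: "g = pCons c h" by (cases g)
  have "coeff h i = 0" if "i \<ge> n" for i
    using g that gh by (auto simp: polys_below_def dest: spec[of _ "Suc i"])
  then have "h \<in> polys_below n" by (simp add: polys_below_def)
  then show "g \<in> (\<lambda>(c, g). pCons c g) ` (UNIV \<times> polys_below n)" using gh by auto
qed (auto simp: polys_below_def coeff_pCons split: nat.splits)

lemma finite_polys_below [simp]: "finite (polys_below n :: 'a::{finite,zero} poly set)"
proof (induction n)
  case 0
  have "polys_below 0 = {0::'a poly}" by (auto simp: mem_polys_below)
  then show ?case by simp
next
  case (Suc n)
  then show ?case by (simp add: polys_below_Suc)
qed

lemma card_polys_below: "card (polys_below n :: 'a::{finite,zero} poly set) = CARD('a) ^ n"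
proof (induction n)
  case 0
  have "polys_below 0 = {0::'a poly}" by (auto simp: mem_polys_below)
  then show ?case by simp
next
  case (Suc n)
  have "inj_on (\<lambda>(c, g). pCons c g) (UNIV \<times> (polys_below n :: 'a poly set))"
    by (auto simp: inj_on_def)
  then show ?case by (simp add: polys_below_Suc card_image card_cartesian_product Suc)
qed

lemma field_poly_bezout:
  fixes f g :: "'a::field poly"
  obtains u v where "(u * g + v * f) dvd g" "(u * g + v * f) dvd f"
proof -
  have "\<exists>u v. (u * g + v * f) dvd g \<and> (u * g + v * f) dvd f"
  proof (induction "if f = 0 then 0 else Suc (degree f)" arbitrary: f g rule: less_induct)
    case less
    show ?case
    proof (cases "f = 0")
      case True
      then show ?thesis by (intro exI[of _ 1]) auto
    next
      case False
      then have "(if g mod f = 0 then 0 else Suc (degree (g mod f))) < (if f = 0 then 0 else Suc (degree f))"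
        using degree_mod_less'[of f g] by auto
      from less[OF this] obtain u v where uv: "(u * f + v * (g mod f)) dvd f" "(u * f + v * (g mod f)) dvd g mod f"
        by blast
      have "u * f + v * (g mod f) = v * g + (u - v * (g div f)) * f"
        by (simp add: algebra_simps flip: minus_div_mult_eq_mod)
      moreover have "(u * f + v * (g mod f)) dvd g"
        using uv by (metis dvd_mod_imp_dvd)
      ultimately show ?thesis using uv(1) by metis
    qed
  qed
  then show thesis using that by blast
qed

lemma coprime_bezout:
  fixes f g :: "'a::field poly"
  assumes "coprime g f"
  obtains u v where "u * g + v * f = 1"
proof -
  obtain u v where uv: "(u * g + v * f) dvd g" "(u * g + v * f) dvd f" by (rule field_poly_bezout)
  then have "is_unit (u * g + v * f)" using assms coprime_common_divisor by blast
  then obtain c where "(u * g + v * f) * c = 1" by (metis dvdE)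
  then have "(c * u) * g + (c * v) * f = 1" by (simp add: algebra_simps)
  then show thesis by (rule that)
qed

lemma coprime_dvd_mult_poly:
  fixes f g h :: "'a::field poly"
  assumes "coprime g f" "f dvd g * h"
  shows "f dvd h"
proof -
  obtain u v where "u * g + v * f = 1" using assms(1) by (rule coprime_bezout)
  then have "(u * g + v * f) * h = h" by simp
  then have "h = u * (g * h) + v * h * f" by (simp add: algebra_simps)
  moreover have "f dvd u * (g * h) + v * h * f" using assms(2) by (intro dvd_add) auto
  ultimately show ?thesis by simp
qed

lemma coprime_irreducible_iff:
  fixes Q g :: "'a::field poly"
  assumes "irreducible Q"
  shows "coprime g Q \<longleftrightarrow> \<not> Q dvd g"
proof
  assume "coprime g Q" then show "\<not> Q dvd g"
    using assms coprime_common_divisor[of g Q Q] irreducible_not_unit[of Q] by auto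
next
  assume nd: "\<not> Q dvd g"
  show "coprime g Q"
  proof (rule coprimeI)
    fix c assume "c dvd g" "c dvd Q"
    then show "is_unit c" using nd irreducibleD'[OF assms] dvd_trans[of Q c g] by auto
  qed
qed

lemma coprime_poly_mult_right:
  fixes g :: "'a::field poly"
  assumes "coprime g a" "coprime g b"
  shows "coprime g (a * b)"
proof (rule coprimeI)
  fix c assume c: "c dvd g" "c dvd a * b"
  obtain u v where "u * g + v * a = 1" using assms(1) by (rule coprime_bezout)
  moreover obtain u' v' where "u' * g + v' * b = 1" using assms(2) by (rule coprime_bezout)
  ultimately have "1 = (u * g + v * a) * (u' * g + v' * b)" by simp
  also have "\<dots> = g * (u * (u' * g + v' * b) + v * a * u') + a * b * (v * v')"
    by (simp add: algebra_simps)
  also have "c dvd \<dots>" using c by (intro dvd_add) auto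
  finally show "is_unit c" .
qed

lemma coprime_poly_power_right:
  fixes g :: "'a::field poly"
  assumes "coprime g a"
  shows "coprime g (a ^ k)"
  by (induction k) (use assms coprime_poly_mult_right in auto)

lemma coprime_poly_prod_right:
  fixes g :: "'a::field poly"
  assumes "\<And>i. i \<in> I \<Longrightarrow> coprime g (a i)"
  shows "coprime g (prod a I)"
  using assms by (induction I rule: infinite_finite_induct) (auto intro: coprime_poly_mult_right)

lemma coprime_pow_iff:
  fixes Q g :: "'a::field poly"
  assumes "irreducible Q" "k > 0"
  shows "coprime g (Q ^ k) \<longleftrightarrow> \<not> Q dvd g"
proof
  assume "coprime g (Q ^ k)"
  moreover have "Q dvd Q ^ k" using assms(2) by (simp add: dvd_power)
  ultimately show "\<not> Q dvd g"
    using coprime_common_divisor[of g "Q ^ k" Q] irreducible_not_unit[OF assms(1)] by blast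
qed (use assms coprime_irreducible_iff coprime_poly_power_right in blast)

lemma irreducible_degree_pos:
  fixes Q :: "'a::field poly"
  assumes "irreducible Q" shows "degree Q > 0"
proof (rule ccontr)
  assume "\<not> degree Q > 0"
  then have "degree Q = 0" "Q \<noteq> 0" using assms by auto
  then have "is_unit Q" by (simp add: is_unit_iff_degree)
  then show False using assms by (simp add: irreducible_not_unit)
qed

lemma prime_dvd_mult_poly:
  fixes Q g :: "'a::field poly"
  assumes "irreducible Q"
  shows "Q dvd g * h \<longleftrightarrow> Q dvd g \<or> Q dvd h"
  using field_poly_irreducible_imp_prime[OF assms] prime_elem_dvd_mult_iff by blast

lemma monic_dvd_antisym:
  fixes p q :: "'a::field poly"
  assumes "p dvd q" "q dvd p" "lead_coeff p = 1" "lead_coeff q = 1"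
  shows "p = q"
proof -
  obtain c where c: "q = p * c" using assms(1) by (rule dvdE)
  have nz: "p \<noteq> 0" "q \<noteq> 0" using assms by auto
  then have "c \<noteq> 0" using c by auto
  moreover have "degree p = degree q" using assms dvd_imp_degree_le nz by (metis le_antisym)
  ultimately have "degree c = 0" using c nz by (simp add: degree_mult_eq)
  moreover have "lead_coeff c = 1" using c assms by (simp add: lead_coeff_mult)
  ultimately have "c = 1" by (auto elim!: degree_eq_zeroE simp: one_pCons)
  then show ?thesis using c by simp
qed

lemma monic_irreducible_dvd_eq:
  fixes P Q :: "'a::field poly"
  assumes "irreducible P" "irreducible Q" "lead_coeff P = 1" "lead_coeff Q = 1" "P dvd Q"
  shows "P = Q"
proof (rule monic_dvd_antisym)
  show "Q dvd P" using assms irreducibleD' irreducible_not_unit by blast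
qed (use assms in auto)

lemma add_mult_mem_polys_below:
  fixes M :: "'a::field poly"
  assumes "r \<in> polys_below (degree M)" "s \<in> polys_below m"
  shows "r + M * s \<in> polys_below (degree M + m)"
proof (cases "M = 0 \<or> s = 0")
  case True
  then show ?thesis using assms by (auto simp: mem_polys_below)
next
  case False
  then have "degree (M * s) < degree M + m" using assms by (simp add: mem_polys_below degree_mult_eq)
  moreover have "degree r < degree M + m \<or> r = 0" using assms by (auto simp: mem_polys_below)
  ultimately show ?thesis unfolding mem_polys_below by (metis add_0 degree_add_less)
qed

lemma mod_poly_add_mult_eq:
  fixes M :: "'a::field poly"
  assumes "r \<in> polys_below (degree M)"
  shows "(r + M * s) mod M = r" "M \<noteq> 0 \<Longrightarrow> (r + M * s) div M = s"
  using assms by (auto simp: mem_polys_below mod_poly_less div_poly_less)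

lemma mod_mem_polys_below:
  fixes M :: "'a::field poly"
  assumes "M \<noteq> 0"
  shows "g mod M \<in> polys_below (degree M)"
  using degree_mod_less[OF assms, of g] by (auto simp: mem_polys_below)

lemma div_mem_polys_below:
  fixes M :: "'a::field poly"
  assumes "g \<in> polys_below (degree M + m)"
  shows "g div M \<in> polys_below m"
proof (cases "g div M = 0")
  case False
  then have M: "M \<noteq> 0" "degree M \<le> degree g" "g \<noteq> 0" by (auto simp: div_poly_eq_0_iff)
  have "M * (g div M) = g - g mod M" by (simp add: minus_mod_eq_mult_div)
  moreover have "g - g mod M \<in> polys_below (degree M + m)"
    using assms mod_mem_polys_below[OF M(1), of g] by (auto simp: polys_below_def)
  moreover have "degree (M * (g div M)) = degree M + degree (g div M)" using M False by (simp add: degree_mult_eq)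
  ultimately show ?thesis using False M by (auto simp: mem_polys_below)
qed (simp add: mem_polys_below)

lemma bij_betw_polys_below_add:
  fixes M :: "'a::field poly"
  assumes "M \<noteq> 0"
  shows "bij_betw (\<lambda>(r, s). r + M * s) (polys_below (degree M) \<times> polys_below m) (polys_below (degree M + m))"
proof (rule bij_betwI[where g = "\<lambda>g. (g mod M, g div M)"])
  show "(\<lambda>g. (g mod M, g div M)) (case x of (r, s) \<Rightarrow> r + M * s) = x"
    if "x \<in> polys_below (degree M) \<times> polys_below m" for x
    using that mod_poly_add_mult_eq[of "fst x" M "snd x"] assms by (auto split: prod.splits simp del: mod_mult_self2 div_mult_self2)
qed (use assms in \<open>auto simp: add_mult_mem_polys_below mod_mem_polys_below div_mem_polys_below\<close>)

section \<open>Wilson's theorem and Euler's criterion modulo prime powers\<close>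

lemma prod_pairing:
  fixes f :: "'b \<Rightarrow> 'c::{unique_euclidean_semiring}"
  assumes "finite A"
    and "\<And>x. x \<in> A \<Longrightarrow> i x \<in> A \<and> i (i x) = x \<and> i x \<noteq> x \<and> [f x * f (i x) = c] (mod M)"
  shows "even (card A) \<and> [(\<Prod>x\<in>A. f x) = c ^ (card A div 2)] (mod M)"
  using assms
proof (induction "card A" arbitrary: A rule: less_induct)
  case less
  show ?case
  proof (cases "A = {}")
    case True
    then show ?thesis by simp
  next
    case False
    then obtain x where x: "x \<in> A" by blast
    define B where "B = A - {x, i x}"
    have ix: "i x \<in> A" "i (i x) = x" "i x \<noteq> x" "[f x * f (i x) = c] (mod M)"
      using less(3)[OF x] by auto
    have A: "A = insert x (insert (i x) B)" "x \<notin> insert (i x) B" "i x \<notin> B"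
      using x ix by (auto simp: B_def)
    have fB: "finite B" using less(2) by (simp add: B_def)
    have cA: "card A = card B + 2" using A fB by simp
    have "even (card B) \<and> [(\<Prod>x\<in>B. f x) = c ^ (card B div 2)] (mod M)"
    proof (rule less(1))
      show "i y \<in> B \<and> i (i y) = y \<and> i y \<noteq> y \<and> [f y * f (i y) = c] (mod M)" if "y \<in> B" for y
      proof -
        have y: "y \<in> A" "y \<noteq> x" "y \<noteq> i x" using that by (auto simp: B_def)
        have "i y \<noteq> x" "i y \<noteq> i x" using less(3)[OF y(1)] y ix by metis+
        then show ?thesis using less(3)[OF y(1)] by (simp add: B_def)
      qed
    qed (use cA fB in auto)
    then have ev: "even (card B)" and pr: "[(\<Prod>x\<in>B. f x) = c ^ (card B div 2)] (mod M)" by auto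
    have "(\<Prod>x\<in>A. f x) = (f x * f (i x)) * (\<Prod>x\<in>B. f x)"
      using A fB by (simp add: mult.assoc)
    moreover have "[(f x * f (i x)) * (\<Prod>x\<in>B. f x) = c * c ^ (card B div 2)] (mod M)"
      using ix(4) pr by (rule cong_mult)
    moreover have "c * c ^ (card B div 2) = c ^ (card A div 2)" using ev cA by simp
    ultimately have "[(\<Prod>x\<in>A. f x) = c ^ (card A div 2)] (mod M)" by metis
    then show ?thesis using ev cA by simp
  qed
qed

lemma odd_card_two_neq_0:
  assumes "odd CARD('a::{finite,field})"
  shows "(2::'a) \<noteq> 0"
proof
  assume 2: "(2::'a) = 0"
  have "even CARD('a) \<and> [(\<Prod>x::'a\<in>UNIV. (1::nat)) = 1 ^ (CARD('a) div 2)] (mod 1)"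
  proof (rule prod_pairing[where i = "\<lambda>x. x + 1"])
    fix x :: 'a
    have "x + 1 + 1 = x + 2" by simp
    then show "x + 1 \<in> UNIV \<and> x + 1 + 1 = x \<and> x + 1 \<noteq> x \<and> [(1::nat) * 1 = 1] (mod 1)" using 2 by simp
  qed simp
  with assms show False by simp
qed

lemma cong_dvd_modulus_poly:
  fixes M :: "'a::field poly"
  assumes "[a = b] (mod M)" "N dvd M" shows "[a = b] (mod N)"
  using assms dvd_trans[of N M "a - b"] by (simp add: cong_iff_dvd_diff)

definition unit_residues :: "'a::field poly \<Rightarrow> 'a poly set" where
  "unit_residues M = {g \<in> polys_below (degree M). coprime g M}"

lemma finite_unit_residues [simp]: "finite (unit_residues (M :: 'a::{finite,field} poly))"
  by (simp add: unit_residues_def)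

lemma coprime_cong_poly:
  fixes M :: "'a::field poly"
  assumes "[a = b] (mod M)" shows "coprime a M \<longleftrightarrow> coprime b M"
  using coprime_cong_transfer_left[OF _ assms] coprime_cong_transfer_left[OF _ cong_sym[OF assms]] by auto

lemma mod_mem_unit_residues:
  fixes M :: "'a::field poly"
  assumes "M \<noteq> 0" "coprime g M"
  shows "g mod M \<in> unit_residues M"
proof -
  have "[g mod M = g] (mod M)" by simp
  then show ?thesis using assms mod_mem_polys_below coprime_cong_poly unfolding unit_residues_def by blast
qed

lemma unit_residues_eqI:
  fixes M :: "'a::field poly"
  assumes "x \<in> unit_residues M" "y \<in> unit_residues M" "[x = y] (mod M)"
  shows "x = y"
  using assms mod_poly_add_mult_eq(1)[of x M 0] mod_poly_add_mult_eq(1)[of y M 0]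
  by (simp add: unit_residues_def cong_def)

lemma coprime_mult_left_poly:
  fixes M :: "'a::field poly"
  assumes "coprime a M" "coprime b M"
  shows "coprime (a * b) M"
  using assms coprime_poly_mult_right[of M a b] by (simp add: coprime_commute)

lemma cong_coprime_cancel_left:
  fixes M :: "'a::field poly"
  assumes "coprime a M" "[a * x = a * y] (mod M)"
  shows "[x = y] (mod M)"
proof -
  have "M dvd a * (x - y)" using assms(2) by (simp add: cong_iff_dvd_diff algebra_simps)
  with assms(1) have "M dvd x - y" by (rule coprime_dvd_mult_poly)
  then show ?thesis by (simp add: cong_iff_dvd_diff)
qed

lemma ex_inverse_mod:
  fixes M :: "'a::field poly"
  assumes "coprime a M"
  obtains b where "[a * b = 1] (mod M)" "coprime b M"
proof -
  obtain u v where uv: "u * a + v * M = 1" using assms by (rule coprime_bezout)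
  have "[a * u = a * u + v * M] (mod M)" by (simp add: cong_def)
  then have 1: "[a * u = 1] (mod M)" using uv by (simp add: mult.commute)
  have "coprime u M"
  proof (rule coprimeI)
    fix c assume "c dvd u" "c dvd M"
    then have "c dvd u * a + v * M" by simp
    then show "is_unit c" using uv by simp
  qed
  with 1 show thesis by (rule that)
qed

lemma prod_unit_residues_cong:
  fixes M :: "'a::{finite,field} poly"
  defines "F \<equiv> \<lambda>c. {x \<in> unit_residues M. [x ^ 2 = c] (mod M)}"
  assumes M: "degree M > 0" and c: "coprime c M"
  shows "even (card (unit_residues M - F c))"
    and "[\<Prod>(unit_residues M) = c ^ (card (unit_residues M - F c) div 2) * \<Prod>(F c)] (mod M)"
proof -
  let ?H = "unit_residues M"
  have M0: "M \<noteq> 0" using M by auto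
  define iv where "iv = (\<lambda>x. SOME y. [x * y = 1] (mod M) \<and> coprime y M)"
  have iv: "[x * iv x = 1] (mod M) \<and> coprime (iv x) M" if "coprime x M" for x
    unfolding iv_def by (rule someI_ex) (use ex_inverse_mod[OF that] in blast)
  define i where "i x = (c * iv x) mod M" for x
  have i: "i x \<in> ?H" "[x * i x = c] (mod M)" if "x \<in> ?H" for x
  proof -
    have x: "coprime x M" using that by (simp add: unit_residues_def)
    show "i x \<in> ?H" unfolding i_def using M0 c iv[OF x] by (intro mod_mem_unit_residues coprime_mult_left_poly) auto
    have "[x * i x = x * (c * iv x)] (mod M)" unfolding i_def by (intro cong_mult) simp_all
    also have "x * (c * iv x) = c * (x * iv x)" by simp
    also have "[\<dots> = c * 1] (mod M)" using iv[OF x] by (intro cong_mult) auto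
    finally show "[x * i x = c] (mod M)" by simp
  qed
  have ii: "i (i x) = x" if x: "x \<in> ?H" for x
  proof (rule unit_residues_eqI)
    have "[i x * i (i x) = i x * x] (mod M)"
      using i(2)[OF i(1)[OF x]] i(2)[OF x] by (metis cong_sym cong_trans mult.commute)
    moreover have "coprime (i x) M" using i(1)[OF x] by (simp add: unit_residues_def)
    ultimately show "[i (i x) = x] (mod M)" using cong_coprime_cancel_left by blast
  qed (use i x in auto)
  have fix_iff: "i x = x \<longleftrightarrow> x \<in> F c" if x: "x \<in> ?H" for x
  proof
    assume "i x = x" then show "x \<in> F c" using i(2)[OF x] x by (simp add: F_def power2_eq_square)
  next
    assume "x \<in> F c"
    then have "[x * i x = x * x] (mod M)"
      using i(2)[OF x] by (auto simp: F_def power2_eq_square intro: cong_trans cong_sym)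
    moreover have "coprime x M" using x by (simp add: unit_residues_def)
    ultimately have "[i x = x] (mod M)" using cong_coprime_cancel_left by blast
    then show "i x = x" using i x by (intro unit_residues_eqI) auto
  qed
  have *: "even (card (?H - F c)) \<and> [(\<Prod>x\<in>?H - F c. x) = c ^ (card (?H - F c) div 2)] (mod M)"
  proof (rule prod_pairing[where i = i])
    fix x assume x: "x \<in> ?H - F c"
    have "i x \<notin> F c" using fix_iff[of "i x"] fix_iff[of x] ii[of x] i(1)[of x] x by auto
    then show "i x \<in> ?H - F c \<and> i (i x) = x \<and> i x \<noteq> x \<and> [x * i x = c] (mod M)"
      using x i[of x] ii[of x] fix_iff[of x] by auto
  qed simp
  show "even (card (?H - F c))" using * by simp
  have "\<Prod>?H = \<Prod>(?H - F c) * \<Prod>(F c)"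
    by (rule prod.subset_diff) (auto simp: F_def)
  then show "[\<Prod>?H = c ^ (card (?H - F c) div 2) * \<Prod>(F c)] (mod M)"
    using * by (auto intro: cong_mult)
qed

definition leg :: "'a::field poly \<Rightarrow> 'a poly \<Rightarrow> int" where
  "leg P c = (if P dvd c then 0 else if poly_QuadRes P c then 1 else -1)"

lemma leg_eq_0_iff: "leg P c = 0 \<longleftrightarrow> P dvd c"
  by (auto simp: leg_def)

locale irreducible_poly =
  fixes P :: "'a::{finite,field} poly"
  assumes irr: "irreducible P" and monic: "lead_coeff P = 1" and odd_card: "odd CARD('a)"
begin

definition half_order :: nat where "half_order = (CARD('a) ^ degree P - 1) div 2"

lemma deg_pos: "degree P > 0" using irr by (rule irreducible_degree_pos)

lemma P_nonzero [simp]: "P \<noteq> 0" using deg_pos by auto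

lemma two_neq_0: "(2::'a) \<noteq> 0" using odd_card by (rule odd_card_two_neq_0)

lemma is_unit_two: "is_unit (2 :: 'a poly)"
  using two_neq_0 by (metis degree_numeral is_unit_iff_degree numeral_poly pCons_eq_0_iff)

lemma P_not_dvd_unit: "is_unit c \<Longrightarrow> \<not> P dvd c"
  using irreducible_not_unit[OF irr] dvd_trans by blast

lemma P_dvd_mult: "P dvd a * b \<longleftrightarrow> P dvd a \<or> P dvd b"
  using irr by (rule prime_dvd_mult_poly)

lemma P_dvd_power: "k > 0 \<Longrightarrow> P dvd a ^ k \<longleftrightarrow> P dvd a"
  by (induction k) (auto simp: P_dvd_mult, metis P_dvd_mult neq0_conv power_0 dvd_refl P_not_dvd_unit one_dvd)

lemma sign_cong_iff:
  fixes s t :: int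
  assumes "s \<in> {1, -1}" "t \<in> {1, -1}" "[of_int s = of_int t] (mod P)"
  shows "s = t"
proof (rule ccontr)
  assume "s \<noteq> t"
  then have "of_int s - of_int t = (2 :: 'a poly) \<or> of_int s - of_int t = (- 2 :: 'a poly)" using assms by auto
  moreover have "P dvd of_int s - of_int t" using assms(3) by (simp add: cong_iff_dvd_diff)
  ultimately show False using P_not_dvd_unit[OF is_unit_two] by auto
qed

lemma coprime_P_pow: "k > 0 \<Longrightarrow> coprime g (P ^ k) \<longleftrightarrow> \<not> P dvd g"
  using irr by (rule coprime_pow_iff)

lemma degree_P_pow: "degree (P ^ k) = k * degree P"
  by (simp add: degree_power_eq)

lemma square_roots:
  assumes k: "k > 0" and s: "\<not> P dvd s"
  shows "{x \<in> unit_residues (P ^ k). [x ^ 2 = s ^ 2] (mod P ^ k)} = {s mod P ^ k, - (s mod P ^ k)}"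
    and "s mod P ^ k \<noteq> - (s mod P ^ k)"
proof -
  let ?M = "P ^ k"
  have nd: "\<not> P dvd 2 * s" using s P_dvd_mult P_not_dvd_unit[OF is_unit_two] by blast
  have PM: "P dvd ?M" using k by (simp add: dvd_power)
  have ms: "(- s) mod ?M = - (s mod ?M)" by simp
  show "s mod ?M \<noteq> - (s mod ?M)"
  proof
    assume "s mod ?M = - (s mod ?M)"
    then have "s mod ?M = (- s) mod ?M" by simp
    then have "?M dvd s - (- s)" by (simp only: mod_eq_dvd_iff)
    then have "P dvd s - (- s)" using PM dvd_trans by blast
    moreover have "s - (- s) = 2 * s" by simp
    ultimately show False using nd by simp
  qed
  have sub: "x = s mod ?M \<or> x = - (s mod ?M)" if x: "x \<in> unit_residues ?M" and xs: "[x ^ 2 = s ^ 2] (mod ?M)" for x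
  proof -
    have xm: "x mod ?M = x" using x mod_poly_add_mult_eq(1)[of x ?M 0] by (simp add: unit_residues_def)
    have d: "?M dvd (x - s) * (x + s)" using xs by (simp add: cong_iff_dvd_diff algebra_simps power2_eq_square)
    show ?thesis
    proof (cases "P dvd x - s")
      case False
      then have "?M dvd x + s" using d coprime_P_pow[OF k] coprime_dvd_mult_poly by blast
      then have "x mod ?M = (- s) mod ?M" by (simp only: mod_eq_dvd_iff diff_minus_eq_add)
      then show ?thesis using xm by simp
    next
      case True
      have "\<not> P dvd x + s"
      proof
        assume "P dvd x + s"
        then have "P dvd (x + s) - (x - s)" using True by (rule dvd_diff)
        then show False using nd by (simp add: algebra_simps)
      qed
      then have "?M dvd x - s" using d coprime_P_pow[OF k] coprime_dvd_mult_poly by (metis mult.commute)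
      then have "x mod ?M = s mod ?M" by (simp add: mod_eq_dvd_iff)
      then show ?thesis using xm by simp
    qed
  qed
  have cs: "coprime s ?M" "coprime (- s) ?M" using s coprime_P_pow[OF k] by auto
  have "s mod ?M \<in> unit_residues ?M" using cs by (intro mod_mem_unit_residues) auto
  moreover have "- (s mod ?M) \<in> unit_residues ?M"
    using mod_mem_unit_residues[OF _ cs(2)] ms by simp
  moreover have "[(s mod ?M) ^ 2 = s ^ 2] (mod ?M)" by (intro cong_pow) simp
  then have "[(s mod ?M) ^ 2 = s ^ 2] (mod ?M)" "[(- (s mod ?M)) ^ 2 = s ^ 2] (mod ?M)" by simp_all
  ultimately show "{x \<in> unit_residues ?M. [x ^ 2 = s ^ 2] (mod ?M)} = {s mod ?M, - (s mod ?M)}"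
    using sub by auto
qed

lemma prod_square_case:
  assumes k: "k > 0" and s: "\<not> P dvd s"
  shows "even (card (unit_residues (P ^ k)))"
    and "[\<Prod>(unit_residues (P ^ k)) = - ((s ^ 2) ^ (card (unit_residues (P ^ k)) div 2))] (mod P ^ k)"
proof -
  let ?M = "P ^ k" let ?H = "unit_residues (P ^ k)"
  let ?F = "{x \<in> ?H. [x ^ 2 = s ^ 2] (mod ?M)}"
  have dM: "degree ?M > 0" using k deg_pos by (simp add: degree_P_pow)
  have cop: "coprime (s ^ 2) ?M" using coprime_P_pow[OF k] s P_dvd_power[of 2 s] by simp
  note F = square_roots[OF assms]
  have "card ?F = 2" using F by simp
  moreover have "card (?H - ?F) = card ?H - card ?F" by (intro card_Diff_subset) auto
  moreover have "card ?F \<le> card ?H" by (intro card_mono) auto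
  ultimately have cH: "card ?H = card (?H - ?F) + 2" by simp
  show "even (card ?H)" using cH prod_unit_residues_cong(1)[OF dM cop] by simp
  have "\<Prod>?F = s mod ?M * ((- s) mod ?M)" using F by simp
  also have "[\<dots> = s * (- s)] (mod ?M)" by (intro cong_mult cong_mod_leftI cong_refl)
  finally have "[\<Prod>?F = - (s ^ 2)] (mod ?M)" by (simp add: power2_eq_square)
  then have "[(s ^ 2) ^ (card (?H - ?F) div 2) * \<Prod>?F = (s ^ 2) ^ (card (?H - ?F) div 2) * (- (s ^ 2))] (mod ?M)"
    by (rule cong_scalar_left)
  moreover have "(s ^ 2) ^ (card (?H - ?F) div 2) * (- (s ^ 2)) = - ((s ^ 2) ^ (card ?H div 2))"
    using cH by simp
  ultimately have "[(s ^ 2) ^ (card (?H - ?F) div 2) * \<Prod>?F = - ((s ^ 2) ^ (card ?H div 2))] (mod ?M)"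
    by simp
  with prod_unit_residues_cong(2)[OF dM cop] show "[\<Prod>?H = - ((s ^ 2) ^ (card ?H div 2))] (mod ?M)"
    by (rule cong_trans)
qed

lemma wilson: "k > 0 \<Longrightarrow> [\<Prod>(unit_residues (P ^ k)) = - 1] (mod P ^ k)"
  using prod_square_case(2)[of k 1] P_not_dvd_unit[of 1] by simp

lemma card_unit_residues:
  assumes k: "k > 0"
  shows "card (unit_residues (P ^ k)) = CARD('a) ^ (degree P * (k - 1)) * (CARD('a) ^ degree P - 1)"
proof -
  let ?m = "degree P * (k - 1)"
  have dk: "degree (P ^ k) = degree P + ?m" using k by (cases k) (simp_all only: degree_P_pow, simp_all)
  have "polys_below (degree P + ?m) = unit_residues (P ^ k) \<union> (\<lambda>s. P * s) ` polys_below ?m"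
  proof (intro equalityI subsetI)
    fix g :: "'a poly" assume g: "g \<in> polys_below (degree P + ?m)"
    show "g \<in> unit_residues (P ^ k) \<union> (\<lambda>s. P * s) ` polys_below ?m"
    proof (cases "P dvd g")
      case True
      then have "g = P * (g div P)" by simp
      then show ?thesis using div_mem_polys_below[OF g] by blast
    next
      case False
      then show ?thesis using g coprime_P_pow[OF k] by (simp add: unit_residues_def dk)
    qed
  next
    fix g :: "'a poly" assume "g \<in> unit_residues (P ^ k) \<union> (\<lambda>s. P * s) ` polys_below ?m"
    moreover have "P * s \<in> polys_below (degree P + ?m)" if "s \<in> polys_below ?m" for s
      using add_mult_mem_polys_below[of 0 P s ?m] that by (simp add: mem_polys_below[of 0])
    ultimately show "g \<in> polys_below (degree P + ?m)"
      by (auto simp: unit_residues_def dk)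
  qed
  moreover have "unit_residues (P ^ k) \<inter> (\<lambda>s. P * s) ` polys_below ?m = {}"
    unfolding unit_residues_def coprime_P_pow[OF k] by auto
  moreover have "card ((\<lambda>s. P * s) ` polys_below ?m) = CARD('a) ^ ?m"
    by (subst card_image) (auto simp: inj_on_def card_polys_below)
  ultimately have "CARD('a) ^ (degree P + ?m) = card (unit_residues (P ^ k)) + CARD('a) ^ ?m"
    by (metis card_Un_disjoint card_polys_below finite_imageI finite_polys_below finite_unit_residues)
  then show ?thesis by (simp add: power_add algebra_simps diff_mult_distrib2)
qed

lemma even_card_minus_1: "even (CARD('a) ^ n - 1)"
  using odd_card by simp

lemma half_order_double: "2 * half_order = CARD('a) ^ degree P - 1"
  using even_card_minus_1 by (simp add: half_order_def)

lemma half_card_unit_residues: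
  assumes "k > 0"
  shows "card (unit_residues (P ^ k)) div 2 = half_order * CARD('a) ^ (degree P * (k - 1))"
proof -
  have "card (unit_residues (P ^ k)) = 2 * (half_order * CARD('a) ^ (degree P * (k - 1)))"
    using card_unit_residues[OF assms] half_order_double by (simp add: ac_simps)
  then show ?thesis by simp
qed

lemma euler_QuadRes:
  assumes k: "k > 0" and c: "\<not> P dvd c"
  shows "[c ^ (card (unit_residues (P ^ k)) div 2) = of_int (if poly_QuadRes (P ^ k) c then 1 else - 1)] (mod P ^ k)"
proof (cases "poly_QuadRes (P ^ k) c")
  case True
  let ?H = "unit_residues (P ^ k)"
  obtain s where s: "[s ^ 2 = c] (mod P ^ k)" using True by (auto simp: poly_QuadRes_def)
  have "P dvd P ^ k" using k by (simp add: dvd_power)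
  then have "[s ^ 2 = c] (mod P)" using cong_dvd_modulus_poly[OF s] by blast
  then have Ps: "\<not> P dvd s" using c cong_dvd_iff P_dvd_power[of 2 s] by auto
  have "[- 1 = - ((s ^ 2) ^ (card ?H div 2))] (mod P ^ k)"
    using cong_trans[OF cong_sym[OF wilson[OF k]] prod_square_case(2)[OF k Ps]] .
  then have "[(s ^ 2) ^ (card ?H div 2) = 1] (mod P ^ k)" unfolding cong_minus_minus_iff by (rule cong_sym)
  moreover have "[(s ^ 2) ^ (card ?H div 2) = c ^ (card ?H div 2)] (mod P ^ k)" using s by (rule cong_pow)
  ultimately have "[c ^ (card ?H div 2) = 1] (mod P ^ k)" using cong_trans[OF cong_sym] by blast
  then show ?thesis using True by simp
next
  case False
  let ?H = "unit_residues (P ^ k)"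
  have dM: "degree (P ^ k) > 0" using k deg_pos by (simp add: degree_P_pow)
  have cop: "coprime c (P ^ k)" using coprime_P_pow[OF k] c by simp
  have F: "{x \<in> ?H. [x ^ 2 = c] (mod P ^ k)} = {}" using False by (auto simp: poly_QuadRes_def)
  have "[\<Prod>?H = c ^ (card ?H div 2)] (mod P ^ k)"
    using prod_unit_residues_cong(2)[OF dM cop] unfolding F by simp
  then have "[c ^ (card ?H div 2) = - 1] (mod P ^ k)" using cong_trans[OF cong_sym wilson[OF k]] by blast
  then show ?thesis unfolding if_not_P[OF False] by simp
qed

lemma euler: "[c ^ half_order = of_int (leg P c)] (mod P)"
proof (cases "P dvd c")
  case True
  have "CARD('a) \<noteq> 1" using two_neq_0 card_1_singletonE[of "UNIV :: 'a set"] by (metis UNIV_I singletonD)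
  then have "CARD('a) > 1" using odd_card by (cases "CARD('a)") auto
  then have "CARD('a) ^ degree P > 1" using deg_pos by (rule one_less_power)
  then have "half_order > 0" using half_order_double by linarith
  then have "P dvd c ^ half_order" using True P_dvd_power by blast
  then show ?thesis using True by (simp add: leg_def cong_0_iff)
next
  case False
  then show ?thesis using euler_QuadRes[of 1 c] half_card_unit_residues[of 1] by (simp add: leg_def split: if_splits)
qed

lemma sign_power_odd:
  assumes "s \<in> {1, -1 :: int}" "odd m" shows "s ^ m = s"
  using assms by auto

lemma euler_pow:
  assumes k: "k > 0" and c: "\<not> P dvd c"
  shows "[c ^ (half_order * CARD('a) ^ (degree P * (k - 1))) = of_int (leg P c)] (mod P ^ k)"
proof -
  define s :: int where "s = (if poly_QuadRes (P ^ k) c then 1 else - 1)"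
  have s: "[c ^ (half_order * CARD('a) ^ (degree P * (k - 1))) = of_int s] (mod P ^ k)"
    using euler_QuadRes[OF assms] unfolding half_card_unit_residues[OF k] s_def .
  have l: "leg P c \<in> {1, -1}" using c by (auto simp: leg_def)
  have "[(c ^ half_order) ^ (CARD('a) ^ (degree P * (k - 1))) = of_int (leg P c) ^ (CARD('a) ^ (degree P * (k - 1)))] (mod P)"
    using euler by (rule cong_pow)
  moreover have "leg P c ^ (CARD('a) ^ (degree P * (k - 1))) = leg P c"
    using l odd_card by (intro sign_power_odd) auto
  ultimately have "[c ^ (half_order * CARD('a) ^ (degree P * (k - 1))) = of_int (leg P c)] (mod P)"
    by (metis of_int_power power_mult)
  moreover have "P dvd P ^ k" using k by (simp add: dvd_power)
  then have "[c ^ (half_order * CARD('a) ^ (degree P * (k - 1))) = of_int s] (mod P)" using cong_dvd_modulus_poly[OF s] by blast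
  ultimately have "[of_int s = of_int (leg P c)] (mod P)" using cong_trans[OF cong_sym] by blast
  then have "s = leg P c" using l by (intro sign_cong_iff) (auto simp: s_def)
  with s show ?thesis by simp
qed

lemma leg_eqI:
  assumes "s \<in> {1, -1}" "\<not> P dvd c" "[c ^ half_order = of_int s] (mod P)"
  shows "leg P c = s"
proof (rule sign_cong_iff)
  show "[of_int (leg P c) = of_int s] (mod P)" using cong_trans[OF cong_sym[OF euler] assms(3)] .
qed (use assms in \<open>auto simp: leg_def\<close>)

lemma leg_mult: "leg P (a * b) = leg P a * leg P b"
proof (cases "P dvd a \<or> P dvd b")
  case True
  then show ?thesis using P_dvd_mult by (auto simp: leg_def)
next
  case False
  then have l: "leg P a \<in> {1, -1}" "leg P b \<in> {1, -1}" by (auto simp: leg_def)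
  show ?thesis
  proof (rule leg_eqI)
    have "[a ^ half_order * b ^ half_order = of_int (leg P a) * of_int (leg P b)] (mod P)"
      using euler euler by (rule cong_mult)
    then show "[(a * b) ^ half_order = of_int (leg P a * leg P b)] (mod P)"
      by (simp add: power_mult_distrib)
  qed (use l False P_dvd_mult in auto)
qed

lemma leg_cong: "[a = b] (mod P) \<Longrightarrow> leg P a = leg P b"
  using cong_dvd_iff[of a b P] by (simp add: leg_def poly_QuadRes_def cong_def)

lemma leg_minus_1: "leg P (- 1) = (- 1) ^ half_order"
  by (rule leg_eqI) (use P_not_dvd_unit[of 1] in \<open>auto simp: minus_one_power_iff\<close>)

lemma leg_1: "leg P 1 = 1"
  by (rule leg_eqI) (use P_not_dvd_unit[of 1] in auto)

lemma leg_minus: "leg P (- c) = (- 1) ^ half_order * leg P c"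
  using leg_mult[of "- 1" c] leg_minus_1 by simp

lemma leg_power: "leg P (c ^ n) = leg P c ^ n"
  by (induction n) (simp_all add: leg_1 leg_mult)

end

section \<open>Products over half systems\<close>

definition half_system :: "'a::field set \<Rightarrow> bool" where
  "half_system S \<longleftrightarrow> S \<subseteq> UNIV - {0} \<and> (\<forall>a. a \<noteq> 0 \<longrightarrow> (a \<in> S) \<noteq> (- a \<in> S))"

lemma half_systemI:
  fixes S :: "'a::{finite,field} set"
  assumes odd: "odd CARD('a)" and S: "S \<subseteq> UNIV - {0}" "card S = (CARD('a) - 1) div 2"
    and neg: "\<And>a. a \<in> S \<Longrightarrow> - a \<notin> S"
  shows "half_system S"
proof -
  have "S \<inter> uminus ` S = {}" using neg by force
  then have "card (S \<union> uminus ` S) = card S + card (uminus ` S)" by (intro card_Un_disjoint) auto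
  also have "card (uminus ` S) = card S" by (rule card_image) (auto simp: inj_on_def)
  also have "card S + card S = card (UNIV - {0::'a})"
    using S(2) odd by (simp add: card_Diff_singleton) presburger
  finally have "S \<union> uminus ` S = UNIV - {0}" using S(1) by (intro card_subset_eq) auto
  then have "a \<in> S \<or> - a \<in> S" if "a \<noteq> 0" for a using that by force
  then show ?thesis using S(1) neg unfolding half_system_def by blast
qed

lemma card_half_system:
  fixes S :: "'a::{finite,field} set"
  assumes "half_system S" shows "2 * card S = CARD('a) - 1"
proof -
  have S: "S \<subseteq> UNIV - {0}" "\<And>a. a \<noteq> 0 \<Longrightarrow> (a \<in> S) \<noteq> (- a \<in> S)"
    using assms unfolding half_system_def by blast+
  have 1: "S \<inter> uminus ` S = {}" using S by force
  have "a \<in> uminus ` S" if "a \<noteq> 0" "a \<notin> S" for a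
    using S(2)[OF that(1)] that(2) by (intro image_eqI[of _ _ "- a"]) auto
  then have 2: "S \<union> uminus ` S = UNIV - {0}" using S(1) by auto
  have "card (UNIV - {0::'a}) = card S + card (uminus ` S)"
    unfolding 2[symmetric] using 1 by (intro card_Un_disjoint) auto
  also have "card (uminus ` S) = card S" by (rule card_image) (auto simp: inj_on_def)
  finally show ?thesis by (simp add: card_Diff_singleton)
qed

definition signed_below :: "'a::field set \<Rightarrow> nat \<Rightarrow> 'a poly set \<Rightarrow> 'a poly set" where
  "signed_below S m R = {g \<in> polys_below m. lead_coeff g \<in> S \<and> (\<forall>Q\<in>R. \<not> Q dvd g)}"

lemma finite_signed_below [simp]: "finite (signed_below S m R :: 'a::{finite,field} poly set)"
  by (simp add: signed_below_def)

lemma signed_below_split: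
  fixes Q :: "'a::field poly"
  assumes Q: "irreducible Q" "lead_coeff Q = 1" and R: "\<And>P. P \<in> R \<Longrightarrow> irreducible P \<and> \<not> P dvd Q"
    and m: "m \<ge> degree Q"
  shows "signed_below S m R = signed_below S m (insert Q R) \<union> (\<lambda>s. Q * s) ` signed_below S (m - degree Q) R"
    and "signed_below S m (insert Q R) \<inter> (\<lambda>s. Q * s) ` signed_below S (m - degree Q) R = {}"
proof -
  have Q0: "Q \<noteq> 0" using Q(2) by auto
  have mul: "Q * s \<in> signed_below S m R \<longleftrightarrow> s \<in> signed_below S (m - degree Q) R" for s
  proof -
    have "Q * s \<in> polys_below m \<longleftrightarrow> s \<in> polys_below (m - degree Q)"
      using m Q0 by (cases "s = 0") (auto simp: mem_polys_below degree_mult_eq)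
    moreover have "lead_coeff (Q * s) = lead_coeff s" using Q(2) by (simp add: lead_coeff_mult)
    moreover have "P dvd Q * s \<longleftrightarrow> P dvd s" if "P \<in> R" for P
      using R[OF that] prime_dvd_mult_poly[of P Q s] by blast
    ultimately show ?thesis unfolding signed_below_def by auto
  qed
  show "signed_below S m R = signed_below S m (insert Q R) \<union> (\<lambda>s. Q * s) ` signed_below S (m - degree Q) R"
  proof (intro equalityI subsetI)
    fix g assume g: "g \<in> signed_below S m R"
    show "g \<in> signed_below S m (insert Q R) \<union> (\<lambda>s. Q * s) ` signed_below S (m - degree Q) R"
    proof (cases "Q dvd g")
      case True
      then obtain s where "g = Q * s" by (rule dvdE)
      then show ?thesis using g mul by blast
    next
      case False
      then show ?thesis using g by (simp add: signed_below_def)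
    qed
  next
    fix g assume "g \<in> signed_below S m (insert Q R) \<union> (\<lambda>s. Q * s) ` signed_below S (m - degree Q) R"
    then show "g \<in> signed_below S m R" using mul by (auto simp: signed_below_def)
  qed
  show "signed_below S m (insert Q R) \<inter> (\<lambda>s. Q * s) ` signed_below S (m - degree Q) R = {}"
    by (auto simp: signed_below_def)
qed

lemma
  fixes Q :: "'a::{finite,field} poly"
  assumes Q: "irreducible Q" "lead_coeff Q = 1" and R: "\<And>P. P \<in> R \<Longrightarrow> irreducible P \<and> \<not> P dvd Q"
    and m: "m \<ge> degree Q"
  shows prod_signed_below_split: "\<Prod>(signed_below S m R) = \<Prod>(signed_below S m (insert Q R)) *
           (Q ^ card (signed_below S (m - degree Q) R) * \<Prod>(signed_below S (m - degree Q) R))"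
    and card_signed_below_split: "card (signed_below S m R) =
           card (signed_below S m (insert Q R)) + card (signed_below S (m - degree Q) R)"
proof -
  have Q0: "Q \<noteq> 0" using Q(2) by auto
  then have inj: "inj_on (\<lambda>s. Q * s) A" for A by (auto simp: inj_on_def)
  have sp: "signed_below S m R = signed_below S m (insert Q R) \<union> (\<lambda>s. Q * s) ` signed_below S (m - degree Q) R"
    "signed_below S m (insert Q R) \<inter> (\<lambda>s. Q * s) ` signed_below S (m - degree Q) R = {}"
    by (rule signed_below_split; use assms in blast)+
  show "card (signed_below S m R) = card (signed_below S m (insert Q R)) + card (signed_below S (m - degree Q) R)"
    by (subst arg_cong[where f = card, OF sp(1)], subst card_Un_disjoint) (use sp(2) in \<open>auto simp: card_image[OF inj]\<close>)
  have "\<Prod>(signed_below S m R) = \<Prod>(signed_below S m (insert Q R)) * \<Prod>((\<lambda>s. Q * s) ` signed_below S (m - degree Q) R)"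
    by (subst arg_cong[where f = "\<lambda>A. \<Prod>A", OF sp(1)], subst prod.union_disjoint) (use sp(2) in auto)
  also have "\<Prod>((\<lambda>s. Q * s) ` signed_below S (m - degree Q) R) =
      (Q ^ card (signed_below S (m - degree Q) R) * \<Prod>(signed_below S (m - degree Q) R))"
    by (subst prod.reindex[OF inj]) (simp add: prod.distrib)
  finally show "\<Prod>(signed_below S m R) = \<Prod>(signed_below S m (insert Q R)) *
           (Q ^ card (signed_below S (m - degree Q) R) * \<Prod>(signed_below S (m - degree Q) R))" .
qed

lemma half_system_card_prod:
  fixes A :: "'a::{finite,field} poly set"
  assumes S: "half_system S" and A: "finite A" "0 \<notin> A" "\<And>g. g \<in> A \<Longrightarrow> - g \<in> A"
  defines "B \<equiv> {g \<in> A. lead_coeff g \<in> S}"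
  shows "card A = 2 * card B" "\<Prod>A = (- 1) ^ card B * (\<Prod>B) ^ 2"
proof -
  have A': "A = B \<union> uminus ` B"
  proof (intro equalityI subsetI)
    fix g assume g: "g \<in> A"
    then have "lead_coeff g \<noteq> 0" using A(2) by auto
    then have "lead_coeff g \<in> S \<or> - lead_coeff g \<in> S" using S unfolding half_system_def by blast
    then have "g \<in> B \<or> - g \<in> B" using g A(3) by (auto simp: B_def)
    then show "g \<in> B \<union> uminus ` B" by force
  next
    fix g assume "g \<in> B \<union> uminus ` B"
    then show "g \<in> A" using A(3) by (auto simp: B_def)
  qed
  have dis: "B \<inter> uminus ` B = {}"
  proof -
    have False if "g \<in> B" "- g \<in> B" for g
    proof -
      have "lead_coeff g \<in> S" "- lead_coeff g \<in> S" "lead_coeff g \<noteq> 0" using that A(2) by (auto simp: B_def)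
      then show False using S unfolding half_system_def by blast
    qed
    then show ?thesis by force
  qed
  have fB: "finite B" using A(1) by (simp add: B_def)
  have inj: "inj_on uminus B" by (auto simp: inj_on_def)
  show "card A = 2 * card B"
    unfolding A' by (subst card_Un_disjoint) (use fB dis in \<open>auto simp: card_image[OF inj]\<close>)
  have "\<Prod>A = \<Prod>B * \<Prod>(uminus ` B)"
    unfolding A' by (subst prod.union_disjoint) (use fB dis in auto)
  also have "\<Prod>(uminus ` B) = (\<Prod>g\<in>B. - g)" by (subst prod.reindex[OF inj]) simp
  also have "\<dots> = (- 1) ^ card B * \<Prod>B" by (rule prod_uminus)
  finally show "\<Prod>A = (- 1) ^ card B * (\<Prod>B) ^ 2" by (simp add: power2_eq_square ac_simps)
qed

context irreducible_poly begin

lemma signed_below_eq_residues: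
  assumes k: "k > 0"
  shows "signed_below S (k * degree P) {P} = {g \<in> unit_residues (P ^ k). lead_coeff g \<in> S}"
  using coprime_P_pow[OF k] by (auto simp: signed_below_def unit_residues_def degree_P_pow)

lemma unit_residues_closed:
  assumes k: "k > 0"
  shows "0 \<notin> unit_residues (P ^ k)" "g \<in> unit_residues (P ^ k) \<Longrightarrow> - g \<in> unit_residues (P ^ k)"
  using coprime_P_pow[OF k] by (auto simp: unit_residues_def polys_below_def)

lemma card_signed_residues:
  assumes k: "k > 0" and S: "half_system S"
  shows "card (signed_below S (k * degree P) {P}) = half_order * CARD('a) ^ (degree P * (k - 1))"
  using half_system_card_prod(1)[OF S _ unit_residues_closed[OF k]] half_card_unit_residues[OF k]
  by (simp add: signed_below_eq_residues[OF k])

lemma prod_signed_residues_square: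
  assumes k: "k > 0" and S: "half_system S"
  shows "[(\<Prod>(signed_below S (k * degree P) {P})) ^ 2 = - ((- 1) ^ half_order)] (mod P ^ k)"
proof -
  let ?B = "signed_below S (k * degree P) {P}"
  have "odd (CARD('a) ^ (degree P * (k - 1)))" using odd_card by simp
  then have c: "(- 1) ^ card ?B = ((- 1) ^ half_order :: 'a poly)"
    unfolding card_signed_residues[OF assms] by (simp only: minus_one_power_iff even_mult_iff simp_thms)
  have "(- 1) ^ card ?B * (\<Prod>?B) ^ 2 = \<Prod>(unit_residues (P ^ k))"
    using half_system_card_prod(2)[OF S _ unit_residues_closed[OF k]]
    by (simp add: signed_below_eq_residues[OF k])
  then have "[(- 1) ^ half_order * (\<Prod>?B) ^ 2 = - 1] (mod P ^ k)" using wilson[OF k] c by simp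
  then have "[(- 1) ^ half_order * ((- 1) ^ half_order * (\<Prod>?B) ^ 2) = (- 1) ^ half_order * - 1] (mod P ^ k)"
    by (rule cong_scalar_left)
  moreover have "(- 1) ^ half_order * ((- 1) ^ half_order * (\<Prod>?B) ^ 2) = (\<Prod>?B) ^ 2"
    by (simp add: minus_one_power_iff)
  ultimately show ?thesis by simp
qed

lemma prod_signed_below_base:
  assumes k: "k > 0" and S: "half_system S" and m: "m = k * degree P + l"
  shows "[\<Prod>(signed_below S m {P}) = (- 1) ^ ((CARD('a) ^ l - 1) div 2) * \<Prod>(signed_below S (k * degree P) {P})] (mod P ^ k)"
    and "card (signed_below S m {P}) = half_order * CARD('a) ^ (degree P * (k - 1) + l)"
proof -
  let ?M = "P ^ k" let ?d = "k * degree P"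
  define K where "K = {s \<in> polys_below l. lead_coeff s \<in> S}"
  define \<phi> where "\<phi> = (\<lambda>(r, s). r + ?M * s)"
  have dM: "degree ?M = ?d" by (rule degree_P_pow)
  have M0: "?M \<noteq> 0" by simp
  have S0: "0 \<notin> S" using S by (auto simp: half_system_def)
  have PM: "P dvd ?M" using k by (simp add: dvd_power)
  have bij: "bij_betw \<phi> (polys_below ?d \<times> polys_below l) (polys_below m)"
    using bij_betw_polys_below_add[OF M0, of l] by (simp add: \<phi>_def dM m)
  have lc: "lead_coeff (r + ?M * s) = lead_coeff s" if "r \<in> polys_below ?d" "s \<noteq> 0" for r s
  proof -
    have ds: "degree (?M * s) = ?d + degree s"
      by (subst degree_mult_eq) (use that M0 dM in auto)
    have "r = 0 \<or> degree r < degree (?M * s)" using that ds by (auto simp: mem_polys_below)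
    then have "lead_coeff (r + ?M * s) = lead_coeff (?M * s)"
      using lead_coeff_add_le[of r "?M * s"] by auto
    then show ?thesis by (simp add: lead_coeff_mult lead_coeff_power monic)
  qed
  let ?A = "signed_below S m {P}" and ?B = "signed_below S ?d {P}" and ?H = "unit_residues ?M"
  have H: "r \<in> ?H \<longleftrightarrow> r \<in> polys_below ?d \<and> \<not> P dvd r" for r
    unfolding unit_residues_def coprime_P_pow[OF k] dM by simp
  have K0: "s \<noteq> 0" if "s \<in> K" for s using that S0 by (auto simp: K_def)
  define Y where "Y = ?H \<times> K \<union> ?B \<times> {0}"
  have Y_sub: "Y \<subseteq> polys_below ?d \<times> polys_below l"
    by (auto simp: Y_def H K_def signed_below_def mem_polys_below[of 0])
  have mem: "\<phi> (r, s) \<in> ?A \<longleftrightarrow> (r, s) \<in> Y" if rs: "r \<in> polys_below ?d" "s \<in> polys_below l" for r s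
  proof -
    have 1: "\<phi> (r, s) \<in> polys_below m" using bij rs by (auto simp: bij_betw_def)
    have 2: "P dvd r + ?M * s \<longleftrightarrow> P dvd r" using PM by (simp add: dvd_add_left_iff)
    show ?thesis
    proof (cases "s = 0")
      case True
      then show ?thesis using rs 1 K0 by (auto simp: Y_def \<phi>_def signed_below_def)
    next
      case False
      then show ?thesis using rs 1 2 lc[OF rs(1) False] by (auto simp: Y_def \<phi>_def signed_below_def H K_def)
    qed
  qed
  have bijY: "bij_betw \<phi> Y ?A"
  proof (rule bij_betw_imageI)
    show "inj_on \<phi> Y" using bij Y_sub inj_on_subset by (auto simp: bij_betw_def)
    show "\<phi> ` Y = ?A"
    proof (intro equalityI subsetI)
      fix g assume g: "g \<in> ?A"
      then have "g \<in> \<phi> ` (polys_below ?d \<times> polys_below l)" using bij by (auto simp: bij_betw_def signed_below_def)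
      then obtain r s where "r \<in> polys_below ?d" "s \<in> polys_below l" "g = \<phi> (r, s)" by auto
      then show "g \<in> \<phi> ` Y" using mem g by blast
    qed (use mem Y_sub in auto)
  qed
  have fin: "finite ?H" "finite K" "finite ?B" by (simp_all add: K_def)
  have disj: "?H \<times> K \<inter> ?B \<times> {0} = {}" using K0 by auto
  have cK: "2 * card K + 1 = CARD('a) ^ l"
  proof -
    let ?N = "polys_below l - {0 :: 'a poly}"
    have "card ?N = 2 * card {g \<in> ?N. lead_coeff g \<in> S}"
      by (rule half_system_card_prod[OF S]) (auto simp: mem_polys_below)
    moreover have "{g \<in> ?N. lead_coeff g \<in> S} = K" using S0 by (auto simp: K_def)
    moreover have "card ?N = CARD('a) ^ l - 1"
      by (simp add: card_polys_below mem_polys_below card_Diff_singleton)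
    moreover have "CARD('a) ^ l > 0" by simp
    ultimately show ?thesis by (cases "CARD('a) ^ l") auto
  qed
  have "\<Prod>?A = (\<Prod>x\<in>Y. \<phi> x)" using prod.reindex_bij_betw[OF bijY, of "\<lambda>x. x"] by simp
  also have "\<dots> = (\<Prod>x\<in>?H \<times> K. \<phi> x) * (\<Prod>x\<in>?B \<times> {0}. \<phi> x)"
    unfolding Y_def using disj fin by (intro prod.union_disjoint) auto
  also have "(\<Prod>x\<in>?B \<times> {0}. \<phi> x) = \<Prod>?B"
    unfolding prod.cartesian_product[symmetric] \<phi>_def using fin by simp
  finally have 1: "\<Prod>?A = (\<Prod>x\<in>?H \<times> K. \<phi> x) * \<Prod>?B" .
  have "[(\<Prod>x\<in>?H \<times> K. \<phi> x) = (\<Prod>x\<in>?H \<times> K. fst x)] (mod ?M)"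
    by (rule cong_prod) (auto simp: \<phi>_def cong_def)
  also have "(\<Prod>x\<in>?H \<times> K. fst x) = (\<Prod>r\<in>?H. \<Prod>s\<in>K. r)"
    unfolding prod.cartesian_product by (rule prod.cong) auto
  also have "\<dots> = (\<Prod>?H) ^ card K" by (simp add: prod_power_distrib)
  also have "[\<dots> = (- 1) ^ card K] (mod ?M)" using wilson[OF k] by (rule cong_pow)
  finally have "[(\<Prod>x\<in>?H \<times> K. \<phi> x) = (- 1) ^ card K] (mod ?M)" .
  then have "[\<Prod>?A = (- 1) ^ card K * \<Prod>?B] (mod ?M)" unfolding 1 by (rule cong_scalar_right)
  moreover have "card K = (CARD('a) ^ l - 1) div 2" using cK by linarith
  ultimately show "[\<Prod>?A = (- 1) ^ ((CARD('a) ^ l - 1) div 2) * \<Prod>?B] (mod ?M)" by simp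
  have "card ?A = card Y" using bij_betw_same_card[OF bijY] by simp
  also have "\<dots> = card ?H * card K + card ?B"
    unfolding Y_def using disj fin by (subst card_Un_disjoint) (auto simp: card_cartesian_product)
  also have "card ?H = 2 * (half_order * CARD('a) ^ (degree P * (k - 1)))"
    using card_unit_residues[OF k] half_order_double by (simp add: ac_simps)
  also have "card ?B = half_order * CARD('a) ^ (degree P * (k - 1))" by (rule card_signed_residues[OF k S])
  finally have "card ?A = half_order * CARD('a) ^ (degree P * (k - 1)) * (2 * card K + 1)" by (simp add: algebra_simps)
  then show "card ?A = half_order * CARD('a) ^ (degree P * (k - 1) + l)" unfolding cK by (simp add: power_add)
qed

end

lemma sum_parity_minus_1_half:
  fixes q :: nat
  assumes "odd q"
  shows "even ((q ^ (e + l) - 1) div 2 + (q ^ l - 1) div 2 + (q ^ e - 1) div 2)"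
proof -
  obtain a where a: "q ^ e = 2 * a + 1" using assms by (metis even_power oddE)
  obtain b where b: "q ^ l = 2 * b + 1" using assms by (metis even_power oddE)
  have "q ^ (e + l) = 2 * (a + b + 2 * (a * b)) + 1" by (simp add: power_add a b algebra_simps)
  then show ?thesis by (simp add: a b)
qed

lemma even_half_iff:
  fixes q :: nat
  assumes "odd q" shows "even ((q ^ n - 1) div 2) \<longleftrightarrow> [q = 1] (mod 4) \<or> even n"
proof -
  have "q mod 4 = 1 \<or> q mod 4 = 3" using assms by presburger
  then consider "q mod 4 = 1" | "q mod 4 = 3" "even n" | "q mod 4 = 3" "odd n" by blast
  then show ?thesis
  proof cases
    case 1
    then have "[q ^ n = 1 ^ n] (mod 4)" by (intro cong_pow) (simp add: cong_def)
    then have "q ^ n mod 4 = 1" by (simp add: cong_def)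
    then have "even ((q ^ n - 1) div 2)" by presburger
    then show ?thesis using 1 by (simp add: cong_def)
  next
    case 2
    then obtain j where j: "n = 2 * j" by (auto elim: evenE)
    have "[q ^ n = 3 ^ n] (mod 4)" by (intro cong_pow) (use 2 in \<open>simp add: cong_def\<close>)
    also have "(3::nat) ^ n = 9 ^ j" by (simp add: j power_mult)
    also have "[(9::nat) ^ j = 1 ^ j] (mod 4)" by (intro cong_pow) (simp add: cong_def)
    finally have "q ^ n mod 4 = 1" by (simp add: cong_def)
    then have "even ((q ^ n - 1) div 2)" by presburger
    then show ?thesis using 2 by simp
  next
    case 3
    then obtain j where j: "n = 2 * j + 1" by (auto elim: oddE)
    have "[q ^ n = 3 ^ n] (mod 4)" by (intro cong_pow) (use 3 in \<open>simp add: cong_def\<close>)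
    also have "(3::nat) ^ n = 9 ^ j * 3" by (simp add: j power_mult)
    also have "[(9::nat) ^ j * 3 = 1 ^ j * 3] (mod 4)" by (intro cong_mult cong_pow) (simp_all add: cong_def)
    finally have "q ^ n mod 4 = 3" by (simp add: cong_def)
    then have "odd ((q ^ n - 1) div 2)" by presburger
    then show ?thesis using 3 by (simp add: cong_def)
  qed
qed

context irreducible_poly begin

lemma coprime_prod_signed_below:
  assumes k: "k > 0" and "P \<in> R"
  shows "coprime (\<Prod>(signed_below S m R)) (P ^ k)"
proof -
  have "\<not> P dvd \<Prod>A" if "finite A" "\<And>g. g \<in> A \<Longrightarrow> \<not> P dvd g" for A
    using that by (induction A rule: finite_induct) (auto simp: P_dvd_mult P_not_dvd_unit)
  moreover have "\<not> P dvd g" if "g \<in> signed_below S m R" for g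
    using that assms(2) by (simp add: signed_below_def)
  ultimately show ?thesis unfolding coprime_P_pow[OF k] by simp
qed

lemma not_dvd_monic:
  assumes "irreducible Q" "lead_coeff Q = 1" "Q \<noteq> P"
  shows "\<not> P dvd Q"
  using monic_irreducible_dvd_eq[OF irr assms(1) monic assms(2)] assms(3) by auto

lemma leg_power_cong:
  assumes k: "k > 0" and c: "\<not> P dvd c"
  shows "[c ^ (half_order * CARD('a) ^ (degree P * (k - 1)) * j) = of_int (leg P c ^ j)] (mod P ^ k)"
  using cong_pow[OF euler_pow[OF assms], of j] by (simp add: power_mult)

lemma leg_sign: "\<not> P dvd c \<Longrightarrow> leg P c \<in> {1, -1}"
  by (auto simp: leg_def)

lemma signed_below_two_primes:
  assumes k: "k > 0" and S: "half_system S"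
    and Q: "irreducible Q" "lead_coeff Q = 1" "Q \<noteq> P"
    and m: "m \<ge> k * degree P + degree Q"
  shows "[\<Prod>(signed_below S m {Q, P}) = of_int (leg P Q * (- 1) ^ ((CARD('a) ^ degree Q - 1) div 2))] (mod P ^ k)"
    and "2 * (half_order * CARD('a) ^ (degree P * (k - 1))) dvd card (signed_below S m {Q, P})"
proof -
  let ?q = "CARD('a)" and ?e = "degree Q" and ?d = "k * degree P" and ?M = "P ^ k"
  define l where "l = m - ?d - ?e"
  have m1: "m = ?d + (?e + l)" and m2: "m - ?e = ?d + l" using m by (simp_all add: l_def)
  have R: "P' \<in> {P} \<Longrightarrow> irreducible P' \<and> \<not> P' dvd Q" for P' using irr not_dvd_monic[OF Q] by auto
  have me: "?e \<le> m" using m by simp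
  note spl = prod_signed_below_split[where R = "{P}" and S = S, OF Q(1,2) R me]
    and cspl = card_signed_below_split[where R = "{P}" and S = S, OF Q(1,2) R me]
  define A where "A = \<Prod>(signed_below S m {Q, P})"
  define G0 where "G0 = \<Prod>(signed_below S ?d {P})"
  define c where "c = card (signed_below S (m - ?e) {P})"
  define A0 where "A0 = \<Prod>(signed_below S m {P})"
  define A2 where "A2 = \<Prod>(signed_below S (m - ?e) {P})"
  have A0: "A0 = A * (Q ^ c * A2)" using spl by (simp add: A0_def A_def A2_def c_def)
  define x0 where "x0 = (?q ^ (?e + l) - 1) div 2"
  define x2 where "x2 = (?q ^ l - 1) div 2"
  define x where "x = (?q ^ ?e - 1) div 2"
  have ev: "even (x0 + x2 + x)" unfolding x0_def x2_def x_def using odd_card by (rule sum_parity_minus_1_half)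
  have 0: "[A0 = (- 1) ^ x0 * G0] (mod ?M)" unfolding A0_def G0_def x0_def by (rule prod_signed_below_base(1)[OF k S m1])
  have 2: "[A2 = (- 1) ^ x2 * G0] (mod ?M)" unfolding A2_def G0_def x2_def by (rule prod_signed_below_base(1)[OF k S m2])
  have c: "c = half_order * ?q ^ (degree P * (k - 1)) * ?q ^ l"
    unfolding c_def using prod_signed_below_base(2)[OF k S m2] by (simp add: power_add)
  have lodd: "leg P Q ^ (?q ^ l) = leg P Q"
    using leg_sign[OF not_dvd_monic[OF Q]] odd_card by (intro sign_power_odd) auto
  have Qc: "[Q ^ c = of_int (leg P Q)] (mod ?M)"
    using leg_power_cong[OF k not_dvd_monic[OF Q], of "?q ^ l"] unfolding c lodd .
  have "[(- 1) ^ x0 * G0 = A * (Q ^ c * A2)] (mod ?M)" using cong_sym[OF 0] by (simp add: A0)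
  also have "[A * (Q ^ c * A2) = A * (of_int (leg P Q) * ((- 1) ^ x2 * G0))] (mod ?M)"
    by (intro cong_mult cong_refl Qc 2)
  finally have "[(of_int (leg P Q) * (- 1) ^ x2) * ((- 1) ^ x0 * G0) =
      (of_int (leg P Q) * (- 1) ^ x2) * (A * (of_int (leg P Q) * ((- 1) ^ x2 * G0)))] (mod ?M)"
    by (rule cong_scalar_left)
  moreover have "of_int (leg P Q) * of_int (leg P Q) = (1 :: 'a poly)"
    using leg_sign[OF not_dvd_monic[OF Q]] by auto
  then have "(of_int (leg P Q) * (- 1) ^ x2) * (A * (of_int (leg P Q) * ((- 1) ^ x2 * G0))) = G0 * A"
    by (simp add: minus_one_power_iff algebra_simps)
  moreover have "(- 1) ^ x2 * ((- 1) ^ x0) = ((- 1) ^ x :: 'a poly)"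
    using ev by (auto simp: minus_one_power_iff)
  then have "(of_int (leg P Q) * (- 1) ^ x2) * ((- 1) ^ x0 * G0) = G0 * of_int (leg P Q * (- 1) ^ x)"
    by (simp add: ac_simps)
  ultimately have "[G0 * of_int (leg P Q * (- 1) ^ x) = G0 * A] (mod ?M)" by simp
  moreover have "coprime G0 ?M" unfolding G0_def by (rule coprime_prod_signed_below[OF k]) simp
  ultimately have "[of_int (leg P Q * (- 1) ^ x) = A] (mod ?M)" using cong_coprime_cancel_left by blast
  then show "[\<Prod>(signed_below S m {Q, P}) = of_int (leg P Q * (- 1) ^ ((?q ^ ?e - 1) div 2))] (mod ?M)"
    unfolding A_def x_def by (rule cong_sym)
  let ?h = "half_order * ?q ^ (degree P * (k - 1))"
  have "?q ^ ?e = 2 * x + 1" using odd_card unfolding x_def by (simp add: odd_two_times_div_two_succ)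
  moreover have "card (signed_below S m {P}) = ?h * ?q ^ (?e + l)"
    using prod_signed_below_base(2)[OF k S m1] by (simp add: power_add)
  ultimately have "card (signed_below S m {Q, P}) + ?h * ?q ^ l = 2 * ?h * (x * ?q ^ l) + ?h * ?q ^ l"
    using cspl c unfolding c_def by (simp add: power_add algebra_simps)
  then have "card (signed_below S m {Q, P}) = 2 * ?h * (x * ?q ^ l)" by simp
  then show "2 * ?h dvd card (signed_below S m {Q, P})" by simp
qed

lemma signed_below_many_primes:
  assumes k: "k > 0" and S: "half_system S"
    and "finite R" "R \<noteq> {}" and R: "\<And>Q. Q \<in> R \<Longrightarrow> irreducible Q \<and> lead_coeff Q = 1 \<and> Q \<noteq> P"
  shows "\<exists>s\<in>{1, -1 :: int}. (card R \<ge> 2 \<longrightarrow> s = 1) \<and> (\<forall>m \<ge> k * degree P + (\<Sum>Q\<in>R. degree Q).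
    2 * (half_order * CARD('a) ^ (degree P * (k - 1))) dvd card (signed_below S m (insert P R)) \<and>
    [\<Prod>(signed_below S m (insert P R)) = of_int s] (mod P ^ k))"
  using assms(3,4) R
proof (induction R rule: finite_ne_induct)
  case (singleton Q)
  then have Q: "irreducible Q" "lead_coeff Q = 1" "Q \<noteq> P" by auto
  note two = signed_below_two_primes[OF k S Q]
  have "leg P Q * (- 1) ^ ((CARD('a) ^ degree Q - 1) div 2) \<in> {1, -1}"
    using leg_sign[OF not_dvd_monic[OF Q]] by (auto simp: minus_one_power_iff)
  then show ?case using two by (intro bexI[of _ "leg P Q * (- 1) ^ ((CARD('a) ^ degree Q - 1) div 2)"])
      (auto simp: insert_commute)
next
  case (insert Q R)
  let ?h = "2 * (half_order * CARD('a) ^ (degree P * (k - 1)))"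
  have Q: "irreducible Q" "lead_coeff Q = 1" "Q \<noteq> P" using insert.prems by auto
  obtain s :: int where s: "s \<in> {1, -1}"
    and IH: "\<And>m. m \<ge> k * degree P + (\<Sum>Q\<in>R. degree Q) \<Longrightarrow> ?h dvd card (signed_below S m (insert P R)) \<and>
      [\<Prod>(signed_below S m (insert P R)) = of_int s] (mod P ^ k)"
    using insert.IH insert.prems by (metis insertCI)
  have nd: "P' \<in> insert P R \<Longrightarrow> irreducible P' \<and> \<not> P' dvd Q" for P'
    using insert.prems insert.hyps irr not_dvd_monic[OF Q] monic_irreducible_dvd_eq[of P' Q] Q by auto
  have "?h dvd card (signed_below S m (insert P (insert Q R))) \<and>
      [\<Prod>(signed_below S m (insert P (insert Q R))) = of_int 1] (mod P ^ k)"
    if m: "m \<ge> k * degree P + (\<Sum>Q\<in>insert Q R. degree Q)" for m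
  proof -
    have mQ: "degree Q \<le> m" and mR: "m \<ge> k * degree P + (\<Sum>Q\<in>R. degree Q)"
      and mR': "m - degree Q \<ge> k * degree P + (\<Sum>Q\<in>R. degree Q)" using m insert.hyps by auto
    note spl = prod_signed_below_split[where R = "insert P R" and S = S, OF Q(1,2) nd mQ]
      and cspl = card_signed_below_split[where R = "insert P R" and S = S, OF Q(1,2) nd mQ]
    have "?h dvd card (signed_below S m (insert Q (insert P R)))"
      using cspl IH[OF mR] IH[OF mR'] by (metis dvd_add_left_iff)
    then have D: "?h dvd card (signed_below S m (insert P (insert Q R)))" by (simp add: insert_commute)
    obtain j where j: "card (signed_below S (m - degree Q) (insert P R)) = ?h * j"
      using IH[OF mR'] by (auto elim: dvdE)
    let ?A = "\<Prod>(signed_below S m (insert Q (insert P R)))"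
    have "[Q ^ (?h * j) = of_int (leg P Q ^ (2 * j))] (mod P ^ k)"
      using leg_power_cong[OF k not_dvd_monic[OF Q], of "2 * j"] by (simp add: ac_simps)
    moreover have "leg P Q ^ (2 * j) = 1" using leg_sign[OF not_dvd_monic[OF Q]] by (auto simp: power_mult)
    ultimately have Qh: "[Q ^ (?h * j) = 1] (mod P ^ k)" by simp
    have "[of_int s = \<Prod>(signed_below S m (insert P R))] (mod P ^ k)" using IH[OF mR] cong_sym by blast
    also have "\<Prod>(signed_below S m (insert P R)) = ?A * (Q ^ (?h * j) * \<Prod>(signed_below S (m - degree Q) (insert P R)))"
      using spl j by simp
    also have "[\<dots> = ?A * (1 * of_int s)] (mod P ^ k)"
      using IH[OF mR'] Qh by (intro cong_mult cong_refl) auto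
    finally have "[of_int s * of_int s = ?A * (1 * of_int s) * of_int s] (mod P ^ k)" by (rule cong_scalar_right)
    then have "[1 = ?A] (mod P ^ k)" using s by auto
    then have "[?A = 1] (mod P ^ k)" by (rule cong_sym)
    then show ?thesis using D by (simp add: insert_commute)
  qed
  then show ?case by (intro bexI[of _ 1]) auto
qed

end

section \<open>Quadratic reciprocity\<close>

lemma bij_betw_crt:
  fixes P Q :: "'a::{finite,field} poly"
  assumes "coprime P Q" "P \<noteq> 0" "Q \<noteq> 0"
  shows "bij_betw (\<lambda>x. (x mod P, x mod Q)) (polys_below (degree P + degree Q)) (polys_below (degree P) \<times> polys_below (degree Q))"
proof -
  let ?f = "\<lambda>x. (x mod P, x mod Q)" and ?A = "polys_below (degree P + degree Q) :: 'a poly set"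
    and ?B = "polys_below (degree P) \<times> polys_below (degree Q) :: ('a poly \<times> 'a poly) set"
  have inj: "inj_on ?f ?A"
  proof (rule inj_onI)
    fix x y assume xy: "x \<in> ?A" "y \<in> ?A" "?f x = ?f y"
    then have "P dvd x - y" "Q dvd x - y" by (simp_all flip: mod_eq_dvd_iff)
    then obtain z where z: "x - y = P * z" by (auto elim: dvdE)
    have "Q dvd P * z" using \<open>Q dvd x - y\<close> unfolding z .
    then have "Q dvd z" by (rule coprime_dvd_mult_poly[OF assms(1)])
    show "x = y"
    proof (rule ccontr)
      assume "x \<noteq> y"
      then have "z \<noteq> 0" using z by auto
      then have "degree (x - y) \<ge> degree P + degree Q"
        unfolding z using \<open>Q dvd z\<close> assms by (simp add: degree_mult_eq dvd_imp_degree_le)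
      moreover have "x - y \<in> ?A" using xy by (simp add: polys_below_def)
      ultimately show False using \<open>x \<noteq> y\<close> by (simp add: mem_polys_below)
    qed
  qed
  moreover have "?f ` ?A = ?B"
  proof (rule card_subset_eq)
    show "?f ` ?A \<subseteq> ?B" using mod_mem_polys_below[OF assms(2)] mod_mem_polys_below[OF assms(3)] by auto
    show "card (?f ` ?A) = card ?B" unfolding card_image[OF inj] by (simp add: card_polys_below card_cartesian_product power_add)
  qed simp
  ultimately show ?thesis by (simp add: bij_betw_def)
qed

lemma prod_signed_selection:
  fixes A :: "'a::{finite,field} poly set"
  assumes S: "half_system S" and A: "finite A" "0 \<notin> A" "\<And>g. g \<in> A \<Longrightarrow> - g \<in> A"
    and B: "B \<subseteq> A" "\<And>g. g \<in> A \<Longrightarrow> (g \<in> B) \<noteq> (- g \<in> B)"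
  shows "\<exists>s\<in>{1, -1 :: int}. \<Prod>{g \<in> A. lead_coeff g \<in> S} = of_int s * \<Prod>B"
proof -
  let ?C = "{g \<in> A. lead_coeff g \<in> S}"
  have C: "(g \<in> ?C) \<noteq> (- g \<in> ?C)" if "g \<in> A" for g
  proof -
    have "lead_coeff g \<noteq> 0" using that A by auto
    then have "(lead_coeff g \<in> S) \<noteq> (- lead_coeff g \<in> S)" using S unfolding half_system_def by blast
    then show ?thesis using that A(3)[OF that] by simp
  qed
  define f where "f g = (if lead_coeff g \<in> S then g else - g)" for g :: "'a poly"
  have "bij_betw f B ?C"
  proof (rule bij_betwI[where g = "\<lambda>g. if g \<in> B then g else - g"])
    show "f \<in> B \<rightarrow> ?C"
    proof
      fix g assume "g \<in> B"
      then have "g \<in> A" using B(1) by blast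
      then show "f g \<in> ?C" using C[of g] A(3)[of g] unfolding f_def by (cases "lead_coeff g \<in> S") auto
    qed
    show "(\<lambda>g. if g \<in> B then g else - g) \<in> ?C \<rightarrow> B" using B(2) by auto
    show "(if f g \<in> B then f g else - f g) = g" if "g \<in> B" for g
      using B that by (auto simp: f_def)
    show "f (if g \<in> B then g else - g) = g" if "g \<in> ?C" for g
      using C[of g] that A(3) by (auto simp: f_def)
  qed
  then have "\<Prod>?C = (\<Prod>g\<in>B. f g)" by (subst prod.reindex_bij_betw[symmetric, where g = "\<lambda>x. x"]) auto
  also have "\<dots> = (\<Prod>g\<in>B. (if lead_coeff g \<in> S then 1 else - 1) * g)" by (rule prod.cong) (auto simp: f_def)
  also have "\<dots> = (\<Prod>g\<in>B. if lead_coeff g \<in> S then 1 else - 1) * \<Prod>B" by (simp add: prod.distrib)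
  finally have "\<Prod>?C = (\<Prod>g\<in>B. if lead_coeff g \<in> S then 1 else - 1) * \<Prod>B" .
  moreover have "\<exists>s\<in>{1, -1 :: int}. (\<Prod>g\<in>B'. if lead_coeff g \<in> S then 1 else - 1) = (of_int s :: 'a poly)" for B' :: "'a poly set"
  proof (induction B' rule: infinite_finite_induct)
    case (insert x F)
    then obtain s :: int where "s \<in> {1, -1}" "(\<Prod>g\<in>F. if lead_coeff g \<in> S then 1 else - 1) = (of_int s :: 'a poly)" by blast
    then show ?case using insert by (intro bexI[of _ "if lead_coeff x \<in> S then s else - s"]) auto
  qed auto
  ultimately show ?thesis by metis
qed

lemma quadratic_reciprocity:
  fixes P Q :: "'a::{finite,field} poly" and S :: "'a set"
  assumes S: "half_system S" and P: "irreducible_poly P" and Q: "irreducible_poly Q" and "P \<noteq> Q"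
  shows "leg P Q * leg Q P = (- 1) ^ (irreducible_poly.half_order P * irreducible_poly.half_order Q)"
proof -
  interpret P: irreducible_poly P by fact
  interpret Q: irreducible_poly Q by fact
  let ?hP = "irreducible_poly.half_order P" and ?hQ = "irreducible_poly.half_order Q"
  define m where "m = degree P + degree Q"
  define A where "A = {g \<in> polys_below m. \<not> P dvd g \<and> \<not> Q dvd g}"
  define C where "C = {g \<in> A. lead_coeff g \<in> S}"
  define B where "B = {g \<in> A. lead_coeff (g mod Q) \<in> S}"
  define T where "T = signed_below S (degree Q) {Q}"
  have C: "C = signed_below S m {Q, P}" by (auto simp: C_def A_def signed_below_def)
  have CP: "[\<Prod>C = of_int (leg P Q * (- 1) ^ ?hQ)] (mod P)"
    using P.signed_below_two_primes(1)[of 1 S Q m] Q.irr Q.monic S \<open>P \<noteq> Q\<close>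
    by (simp add: C Q.half_order_def m_def)
  have CQ: "[\<Prod>C = of_int (leg Q P * (- 1) ^ ?hP)] (mod Q)"
    using Q.signed_below_two_primes(1)[of 1 S P m] P.irr P.monic S \<open>P \<noteq> Q\<close>
    by (simp add: C P.half_order_def m_def insert_commute)
  have "\<exists>s\<in>{1, -1 :: int}. \<Prod>{g \<in> A. lead_coeff g \<in> S} = of_int s * \<Prod>B"
  proof (rule prod_signed_selection[OF S])
    show "finite A" "0 \<notin> A" by (simp_all add: A_def)
    show "- g \<in> A" if "g \<in> A" for g using that by (auto simp: A_def polys_below_def)
    show "B \<subseteq> A" by (auto simp: B_def)
    show "(g \<in> B) \<noteq> (- g \<in> B)" if "g \<in> A" for g
    proof -
      have "g mod Q \<noteq> 0" using that by (auto simp: A_def mod_eq_0_iff_dvd)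
      then have "lead_coeff (g mod Q) \<noteq> 0" by simp
      then have "(lead_coeff (g mod Q) \<in> S) \<noteq> (- lead_coeff (g mod Q) \<in> S)"
        using S unfolding half_system_def by blast
      moreover have "- g \<in> A" using that by (auto simp: A_def polys_below_def)
      ultimately show ?thesis using that by (simp add: B_def)
    qed
  qed
  then obtain s :: int where s: "s \<in> {1, -1}" "\<Prod>C = of_int s * \<Prod>B" unfolding C_def by blast
  have cop: "coprime P Q" using P.not_dvd_monic Q.irr Q.monic P.irr \<open>P \<noteq> Q\<close> coprime_irreducible_iff[of P Q]
    by (simp add: coprime_commute)
  let ?f = "\<lambda>x. (x mod P, x mod Q)"
  have bij: "bij_betw ?f (polys_below m) (polys_below (degree P) \<times> polys_below (degree Q))"
    unfolding m_def by (rule bij_betw_crt[OF cop]) auto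
  have B': "x \<in> B \<longleftrightarrow> ?f x \<in> unit_residues P \<times> T" if "x \<in> polys_below m" for x
    using that mod_mem_polys_below[of P x] mod_mem_polys_below[of Q x] P.coprime_P_pow[of 1 "x mod P"]
    by (auto simp: B_def A_def T_def unit_residues_def signed_below_def dvd_mod_iff)
  have bijB: "bij_betw ?f B (unit_residues P \<times> T)"
  proof (rule bij_betw_imageI)
    show "inj_on ?f B" using bij by (auto simp: bij_betw_def B_def A_def intro: inj_on_subset)
    show "?f ` B = unit_residues P \<times> T"
    proof (intro equalityI subsetI)
      fix y assume y: "y \<in> unit_residues P \<times> T"
      then have "y \<in> polys_below (degree P) \<times> polys_below (degree Q)" by (auto simp: unit_residues_def T_def signed_below_def)
      then have "y \<in> ?f ` polys_below m" using bij by (simp add: bij_betw_def)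
      then obtain x where "x \<in> polys_below m" "y = ?f x" by blast
      then show "y \<in> ?f ` B" using B' y by blast
    qed (use B' in \<open>auto simp: B_def A_def\<close>)
  qed
  have fin: "finite T" "finite (unit_residues P)" by (simp_all add: T_def)
  have cT: "card T = ?hQ" using Q.card_signed_residues[of 1 S] S by (simp add: T_def)
  have cP: "card (unit_residues P) = 2 * ?hP" using P.card_unit_residues[of 1] P.half_order_double by simp
  have "[\<Prod>B = (\<Prod>x\<in>B. fst (?f x))] (mod P)" by (rule cong_prod) simp
  also have "(\<Prod>x\<in>B. fst (?f x)) = (\<Prod>y\<in>unit_residues P \<times> T. fst y)"
    by (rule prod.reindex_bij_betw[OF bijB])
  also have "\<dots> = (\<Prod>r\<in>unit_residues P. \<Prod>t\<in>T. r)" unfolding prod.cartesian_product by (rule prod.cong) auto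
  also have "\<dots> = (\<Prod>(unit_residues P)) ^ ?hQ" by (simp add: prod_power_distrib cT)
  also have "[\<dots> = (- 1) ^ ?hQ] (mod P)" using P.wilson[of 1] by (intro cong_pow) simp
  finally have "[of_int s * \<Prod>B = of_int s * (- 1) ^ ?hQ] (mod P)" by (rule cong_scalar_left)
  then have 0: "[of_int (leg P Q * (- 1) ^ ?hQ) = of_int (s * (- 1) ^ ?hQ)] (mod P)"
    using cong_trans[OF cong_sym[OF CP]] s(2) by simp
  have lP: "leg P Q \<in> {1, -1}" "leg Q P \<in> {1, -1}"
    using P.leg_sign[OF P.not_dvd_monic] Q.leg_sign[OF Q.not_dvd_monic] P.irr P.monic Q.irr Q.monic \<open>P \<noteq> Q\<close> by blast+
  have sgn: "x * (- 1) ^ n \<in> {1, -1}" if "x \<in> {1, -1}" for x :: int and n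
    using that by (auto simp: minus_one_power_iff)
  have 1: "leg P Q * (- 1) ^ ?hQ = s * (- 1) ^ ?hQ"
    by (rule P.sign_cong_iff[OF sgn[OF lP(1)] sgn[OF s(1)] 0])
  have "[\<Prod>B = (\<Prod>x\<in>B. snd (?f x))] (mod Q)" by (rule cong_prod) simp
  also have "(\<Prod>x\<in>B. snd (?f x)) = (\<Prod>y\<in>unit_residues P \<times> T. snd y)"
    by (rule prod.reindex_bij_betw[OF bijB])
  also have "\<dots> = (\<Prod>r\<in>unit_residues P. \<Prod>t\<in>T. t)" unfolding prod.cartesian_product by (rule prod.cong) auto
  also have "\<dots> = ((\<Prod>T) ^ 2) ^ ?hP" by (simp add: cP power_mult)
  also have "[\<dots> = (- ((- 1) ^ ?hQ)) ^ ?hP] (mod Q)"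
    using Q.prod_signed_residues_square[of 1 S] S by (intro cong_pow) (simp add: T_def)
  finally have "[of_int s * \<Prod>B = of_int s * (- ((- 1) ^ ?hQ)) ^ ?hP] (mod Q)" by (rule cong_scalar_left)
  then have 3: "[of_int (leg Q P * (- 1) ^ ?hP) = of_int (s * (- ((- 1) ^ ?hQ)) ^ ?hP)] (mod Q)"
    using cong_trans[OF cong_sym[OF CQ]] s(2) by simp
  have "s * (- ((- 1) ^ ?hQ)) ^ ?hP \<in> {1, -1}" using s(1) by (auto simp: minus_one_power_iff)
  then have 2: "leg Q P * (- 1) ^ ?hP = s * (- ((- 1) ^ ?hQ)) ^ ?hP"
    using Q.sign_cong_iff[OF _ _ 3] sgn[OF lP(2)] by blast
  have "leg P Q = s" using 1 by simp
  moreover have "leg Q P = s * (- 1) ^ (?hQ * ?hP)"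
    using 2 by (simp add: minus_one_power_iff split: if_splits)
  ultimately show ?thesis using s(1) by (auto simp: mult.commute)
qed

section \<open>The sign of the half-system product modulo a prime\<close>

definition monic_below :: "nat \<Rightarrow> 'a::field poly set" where
  "monic_below n = {g \<in> polys_below n. lead_coeff g = 1}"

lemma finite_monic_below [simp]: "finite (monic_below n :: 'a::{finite,field} poly set)"
  by (simp add: monic_below_def)

lemma prod_signs:
  fixes s :: "'b \<Rightarrow> int"
  assumes "finite A" "\<And>x. x \<in> A \<Longrightarrow> s x \<in> {1, -1}"
  shows "\<exists>n. sum s A = int (card A) - 2 * int n \<and> prod s A = (- 1) ^ n"
  using assms
proof (induction A rule: finite_induct)
  case (insert x F)
  then obtain n where n: "sum s F = int (card F) - 2 * int n" "prod s F = (- 1) ^ n" by auto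
  consider "s x = 1" | "s x = -1" using insert.prems[of x] by auto
  then show ?case
  proof cases
    case 1 then show ?thesis using n insert.hyps by (intro exI[of _ n]) simp
  next
    case 2 then show ?thesis using n insert.hyps by (intro exI[of _ "Suc n"]) simp
  qed
qed simp

lemma half_system_delta:
  fixes S :: "'a::{finite,field} set"
  assumes S: "half_system S" and odd: "odd CARD('a)"
  shows "(delta S) ^ 2 = - ((- 1) ^ ((CARD('a) - 1) div 2))"
proof -
  have ir: "irreducible [:0, 1::'a:]" by (rule irreducible_linear_field_poly) simp
  interpret T: irreducible_poly "[:0, 1::'a:]" by unfold_locales (use ir odd in auto)
  have eq: "signed_below S 1 {[:0, 1:]} = (\<lambda>c. [:c:]) ` S"
  proof (intro equalityI subsetI)
    fix g assume g: "g \<in> signed_below S 1 {[:0, 1:]}"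
    then have "degree g = 0" by (auto simp: signed_below_def mem_polys_below)
    then obtain c where "g = [:c:]" by (auto elim: degree_eq_zeroE)
    then show "g \<in> (\<lambda>c. [:c:]) ` S" using g by (auto simp: signed_below_def)
  next
    fix g assume "g \<in> (\<lambda>c. [:c:]) ` S"
    then obtain c where c: "g = [:c:]" "c \<in> S" by auto
    then have "c \<noteq> 0" using S by (auto simp: half_system_def)
    then show "g \<in> signed_below S 1 {[:0, 1:]}" using c
      by (auto simp: signed_below_def mem_polys_below dest: dvd_imp_degree_le)
  qed
  have "\<Prod>(signed_below S 1 {[:0, 1:]}) = (\<Prod>c\<in>S. [:c:])" unfolding eq by (subst prod.reindex) (auto simp: inj_on_def)
  also have "\<dots> = [:delta S:]" unfolding delta_def
    by (induction S rule: infinite_finite_induct) (auto simp: one_pCons)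
  finally have "[[:delta S:] ^ 2 = - ((- 1) ^ T.half_order)] (mod [:0, 1:])"
    using T.prod_signed_residues_square[of 1 S] S by simp
  then obtain u where "[:delta S:] ^ 2 - - ((- 1) ^ T.half_order) = [:0, 1:] * u"
    unfolding cong_iff_dvd_diff by (rule dvdE)
  then have "poly ([:delta S:] ^ 2 - - ((- 1) ^ T.half_order)) 0 = poly ([:0, 1:] * u) 0" by (rule arg_cong)
  then have "poly ([:delta S:] ^ 2) 0 = poly (- ((- 1) ^ T.half_order)) 0"
    by (simp only: poly_diff poly_mult) (simp add: eq_neg_iff_add_eq_0)
  then show ?thesis by (simp add: T.half_order_def poly_power)
qed

context irreducible_poly begin

lemma smult_monic_bij:
  assumes S: "half_system S"
  shows "bij_betw (\<lambda>(c, g). smult c g) (S \<times> monic_below (degree P)) (signed_below S (degree P) {P})"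
proof (rule bij_betwI[where g = "\<lambda>g. (lead_coeff g, smult (inverse (lead_coeff g)) g)"])
  have S0: "c \<noteq> 0" if "c \<in> S" for c using S that by (auto simp: half_system_def)
  have nd: "\<not> P dvd g" if "g \<in> polys_below (degree P)" "lead_coeff g \<noteq> 0" for g
    using that by (auto simp: mem_polys_below dest: dvd_imp_degree_le)
  show "(\<lambda>(c, g). smult c g) \<in> S \<times> monic_below (degree P) \<rightarrow> signed_below S (degree P) {P}"
  proof (clarify)
    fix c and g :: "'a poly" assume cg: "c \<in> S" "g \<in> monic_below (degree P)"
    then have "smult c g \<in> polys_below (degree P)" "lead_coeff (smult c g) = c"
      by (auto simp: monic_below_def polys_below_def)
    then show "smult c g \<in> signed_below S (degree P) {P}" using nd[of "smult c g"] cg S0 by (simp add: signed_below_def)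
  qed
  show "(\<lambda>g. (lead_coeff g, smult (inverse (lead_coeff g)) g)) \<in> signed_below S (degree P) {P} \<rightarrow> S \<times> monic_below (degree P)"
    using S0 by (auto simp: signed_below_def monic_below_def polys_below_def)
  show "(\<lambda>(c, g). smult c g) (lead_coeff g, smult (inverse (lead_coeff g)) g) = g"
    if "g \<in> signed_below S (degree P) {P}" for g
    using S0[of "lead_coeff g"] that by (simp add: signed_below_def)
qed (use S in \<open>auto simp: monic_below_def half_system_def\<close>)

lemma leg_monic_below: "g \<in> monic_below (degree P) \<Longrightarrow> leg P g \<in> {1, -1}"
  by (rule leg_sign) (auto simp: monic_below_def mem_polys_below dest: dvd_imp_degree_le)

lemma sum_leg_parity:
  assumes S: "half_system S" and q: "[CARD('a) = 3] (mod 4)" and d: "odd (degree P)"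
    and h: "int h = (\<Sum>g\<in>monic_below (degree P). leg P g)"
  shows "odd h" and "odd half_order"
    and "\<exists>\<delta>\<in>{1, -1 :: int}. delta S = of_int \<delta> \<and>
      [\<Prod>(signed_below S (degree P) {P}) = of_int (\<delta> * (- 1) ^ ((h - 1) div 2))] (mod P)"
proof -
  let ?M = "monic_below (degree P) :: 'a poly set" and ?B = "signed_below S (degree P) {P}"
  let ?q = "CARD('a)"
  define N where "N = card ?M"
  have q3: "?q mod 4 = 3" using q by (simp add: cong_def)
  have bij: "bij_betw (\<lambda>(c, g). smult c g) (S \<times> ?M) ?B" using S by (rule smult_monic_bij)
  have "card ?B = card S * N" using bij_betw_same_card[OF bij] by (simp add: card_cartesian_product N_def)
  then have hoN: "half_order = card S * N" using card_signed_residues[of 1 S] S by simp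
  have cS: "card S = (?q - 1) div 2" using card_half_system[OF S] by simp
  have cSodd: "odd (card S)"
  proof -
    have "?q = 4 * (?q div 4) + 3" using q3 by (metis mult_div_mod_eq)
    then have "(?q - 1) div 2 = 2 * (?q div 4) + 1" by presburger
    then show ?thesis by (simp add: cS)
  qed
  have qd8: "?q ^ degree P mod 8 = ?q mod 8"
  proof -
    obtain j where j: "degree P = 2 * j + 1" using d by (auto elim: oddE)
    have q8: "?q mod 8 = 3 \<or> ?q mod 8 = 7" using q3 by presburger
    have "(?q mod 8) ^ 2 mod 8 = 1" using q8 by auto
    then have "?q ^ 2 mod 8 = 1" by (simp add: power_mod)
    then have "(?q ^ 2) ^ j mod 8 = 1" using power_mod[of "?q ^ 2" 8 j] by simp
    then have "(?q ^ 2) ^ j * ?q mod 8 = ?q mod 8" using mod_mult_left_eq[of "(?q ^ 2) ^ j" 8 ?q] by simp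
    moreover have "?q ^ degree P = (?q ^ 2) ^ j * ?q" unfolding j by (simp flip: power_mult)
    ultimately show ?thesis by simp
  qed
  have N4: "N mod 4 = 1"
  proof -
    have pos: "?q ^ degree P > 0" by simp
    have "(?q - 1) * N = ?q ^ degree P - 1" using half_order_double hoN card_half_system[OF S] by (simp add: mult.assoc flip: mult.assoc[of 2])
    then have e: "2 * card S * N + 1 = ?q ^ degree P" using pos card_half_system[OF S] by simp
    have e2: "2 * card S + 1 = ?q" using card_half_system[OF S] zero_less_card_finite[where 'a='a] by simp
    have "(2 * (card S * N) + 1) mod 8 = (2 * card S + 1) mod 8" using e e2 qd8 by (simp add: mult.assoc)
    moreover have "x mod 4 = y mod 4" if "(2 * x + 1) mod 8 = (2 * y + 1) mod 8" for x y :: nat using that by presburger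
    ultimately have "card S * N mod 4 = card S mod 4" by blast
    then have "[card S * N = card S * 1] (mod 4)" by (simp only: cong_def mult_1_right)
    moreover have "coprime (card S) 4" using cSodd coprime_power_right_iff[of "card S" 2 2] by simp
    ultimately have "[N = 1] (mod 4)" using cong_mult_lcancel_nat by blast
    then show ?thesis by (simp add: cong_def)
  qed
  then have Nodd: "odd N" by presburger
  show ho: "odd half_order" using hoN cSodd Nodd by simp
  obtain n where n: "(\<Sum>g\<in>?M. leg P g) = int N - 2 * int n" "(\<Prod>g\<in>?M. leg P g) = (- 1) ^ n"
    using prod_signs[of ?M "leg P"] leg_monic_below by (auto simp: N_def)
  have hn: "int h = int N - 2 * int n" using h n by simp
  show hodd: "odd h" using hn Nodd by presburger
  have par: "even n \<longleftrightarrow> even ((h - 1) div 2)"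
  proof -
    have "N = h + 2 * n" using hn by linarith
    then show ?thesis using N4 hodd by presburger
  qed
  have sqd: "delta S ^ 2 = 1"
    using half_system_delta[OF S odd_card] cSodd by (simp add: cS)
  then have "delta S = 1 \<or> delta S = -1" by (simp add: power2_eq_1_iff)
  then obtain \<delta> :: int where \<delta>: "\<delta> \<in> {1, -1}" "delta S = of_int \<delta>" by force
  have "\<Prod>?B = (\<Prod>x\<in>S \<times> ?M. case x of (c, g) \<Rightarrow> smult c g)"
    using prod.reindex_bij_betw[OF bij, of "\<lambda>x. x"] by simp
  also have "\<dots> = (\<Prod>c\<in>S. \<Prod>g\<in>?M. smult c g)" by (simp add: prod.cartesian_product)
  also have "\<dots> = (\<Prod>c\<in>S. smult (c ^ N) (\<Prod>?M))" by (simp add: prod_smult N_def)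
  also have "\<dots> = smult ((delta S) ^ N) ((\<Prod>?M) ^ card S)"
    by (simp add: prod_smult delta_def prod_power_distrib)
  also have "(delta S) ^ N = delta S" using \<delta> Nodd by auto
  finally have B: "\<Prod>?B = smult (delta S) ((\<Prod>?M) ^ card S)" .
  have "[(\<Prod>?B) ^ 2 = 1] (mod P)"
    using prod_signed_residues_square[of 1 S] S ho by simp
  then have "P dvd (\<Prod>?B - 1) * (\<Prod>?B + 1)" by (simp add: cong_iff_dvd_diff algebra_simps power2_eq_square)
  then have "P dvd \<Prod>?B - 1 \<or> P dvd \<Prod>?B + 1" by (simp add: P_dvd_mult)
  then obtain s :: int where s: "s \<in> {1, -1}" "[\<Prod>?B = of_int s] (mod P)"
    by (auto simp: cong_iff_dvd_diff intro: that[of 1] that[of "-1"])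
  have dsm: "smult (delta S) x = of_int \<delta> * x" for x :: "'a poly"
    using \<delta> by auto
  have dd: "of_int \<delta> * (of_int \<delta> * x) = x" for x :: "'a poly" using \<delta> by auto
  have "[of_int \<delta> * \<Prod>?B = of_int \<delta> * of_int s] (mod P)" using s(2) by (rule cong_scalar_left)
  then have MS: "[(\<Prod>?M) ^ card S = of_int (\<delta> * s)] (mod P)" by (simp add: B dsm dd)
  have ndM: "\<not> P dvd \<Prod>?M"
  proof
    assume "P dvd \<Prod>?M"
    moreover have "card S > 0" using cSodd by (cases "card S") auto
    ultimately have "P dvd (\<Prod>?M) ^ card S" using P_dvd_power by blast
    then have "P dvd of_int (\<delta> * s)" using MS cong_dvd_iff by blast
    moreover have "is_unit (of_int (\<delta> * s) :: 'a poly)" using \<delta> s by auto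
    ultimately show False using P_not_dvd_unit by blast
  qed
  have "leg P (\<Prod>?M) = \<delta> * s"
  proof (rule leg_eqI)
    show "\<delta> * s \<in> {1, -1}" using \<delta> s by auto
    have "[((\<Prod>?M) ^ card S) ^ N = of_int (\<delta> * s) ^ N] (mod P)" using MS by (rule cong_pow)
    moreover have "(\<delta> * s) ^ N = \<delta> * s" using \<delta> s Nodd by auto
    ultimately show "[(\<Prod>?M) ^ half_order = of_int (\<delta> * s)] (mod P)"
      unfolding hoN by (metis of_int_power power_mult)
  qed (rule ndM)
  moreover have "leg P (\<Prod>?M) = (\<Prod>g\<in>?M. leg P g)"
  proof -
    have "leg P (\<Prod>A) = (\<Prod>g\<in>A. leg P g)" if "finite A" for A
      using that by (induction A rule: finite_induct) (auto simp: leg_1 leg_mult)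
    then show ?thesis by simp
  qed
  ultimately have "\<delta> * s = (- 1) ^ n" using n by simp
  moreover have "(- 1 :: int) ^ n = (- 1) ^ ((h - 1) div 2)" using par by (simp add: minus_one_power_iff)
  ultimately have "s = \<delta> * (- 1) ^ ((h - 1) div 2)" using \<delta> by auto
  then show "\<exists>\<delta>\<in>{1, -1 :: int}. delta S = of_int \<delta> \<and>
      [\<Prod>?B = of_int (\<delta> * (- 1) ^ ((h - 1) div 2))] (mod P)"
    using \<delta> s by blast
qed

end

section \<open>Counting square roots of \<open>- P\<close>\<close>

definition root_count :: "'a::field poly \<Rightarrow> 'a poly \<Rightarrow> nat" where
  "root_count P a = card {b \<in> polys_below (degree a). a dvd b ^ 2 + P}"

lemma root_count_1: "root_count P (1 :: 'a::field poly) = 1"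
proof -
  have "{b \<in> polys_below (degree (1::'a poly)). 1 dvd b ^ 2 + P} = {0}" by (auto simp: mem_polys_below)
  then show ?thesis by (simp add: root_count_def)
qed

lemma root_count_mult:
  fixes a a' :: "'a::{finite,field} poly"
  assumes cop: "coprime a a'" and nz: "a \<noteq> 0" "a' \<noteq> 0"
  shows "root_count P (a * a') = root_count P a * root_count P a'"
proof -
  let ?f = "\<lambda>x. (x mod a, x mod a')"
  let ?R = "\<lambda>a. {b \<in> polys_below (degree a). a dvd b ^ 2 + P}"
  have bij: "bij_betw ?f (polys_below (degree a + degree a')) (polys_below (degree a) \<times> polys_below (degree a'))"
    by (rule bij_betw_crt[OF cop nz])
  have dv: "a * a' dvd x \<longleftrightarrow> a dvd x \<and> a' dvd x" for x
  proof
    assume "a dvd x \<and> a' dvd x"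
    then obtain y where "x = a * y" "a' dvd a * y" by (auto elim: dvdE)
    then show "a * a' dvd x" using coprime_dvd_mult_poly[OF cop] by (metis mult_dvd_mono dvd_refl)
  qed (auto dest: dvd_mult_left dvd_mult_right)
  have md: "c dvd (x mod c) ^ 2 + P \<longleftrightarrow> c dvd x ^ 2 + P" for c x :: "'a poly"
  proof (rule cong_dvd_iff)
    show "[(x mod c) ^ 2 + P = x ^ 2 + P] (mod c)" by (intro cong_add cong_pow) simp_all
  qed
  have mem: "x \<in> ?R (a * a') \<longleftrightarrow> ?f x \<in> ?R a \<times> ?R a'" if "x \<in> polys_below (degree a + degree a')" for x
    using that mod_mem_polys_below[OF nz(1), of x] mod_mem_polys_below[OF nz(2), of x] nz dv md
    by (simp add: degree_mult_eq)
  have "bij_betw ?f (?R (a * a')) (?R a \<times> ?R a')"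
  proof (rule bij_betw_imageI)
    show "inj_on ?f (?R (a * a'))" using bij nz by (auto simp: bij_betw_def degree_mult_eq intro: inj_on_subset)
    show "?f ` ?R (a * a') = ?R a \<times> ?R a'"
    proof (intro equalityI subsetI)
      fix y assume y: "y \<in> ?R a \<times> ?R a'"
      then have "y \<in> ?f ` polys_below (degree a + degree a')" using bij by (auto simp: bij_betw_def)
      then obtain x where "x \<in> polys_below (degree a + degree a')" "y = ?f x" by blast
      then show "y \<in> ?f ` ?R (a * a')" using mem[of x] y by blast
    next
      fix y assume "y \<in> ?f ` ?R (a * a')"
      then obtain x where x: "x \<in> ?R (a * a')" "y = ?f x" by blast
      then have "x \<in> polys_below (degree a + degree a')" using nz by (simp add: degree_mult_eq)
      then show "y \<in> ?R a \<times> ?R a'" using mem[of x] x by blast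
    qed
  qed
  then have "card (?R (a * a')) = card (?R a \<times> ?R a')" by (rule bij_betw_same_card)
  then show ?thesis by (simp add: root_count_def card_cartesian_product)
qed

context irreducible_poly begin

lemma QuadRes_pow_iff:
  assumes k: "k > 0" and c: "\<not> P dvd c"
  shows "poly_QuadRes (P ^ k) c \<longleftrightarrow> leg P c = 1"
proof -
  have "[c ^ (card (unit_residues (P ^ k)) div 2) = of_int (leg P c)] (mod P ^ k)"
    using euler_pow[OF assms] unfolding half_card_unit_residues[OF k] .
  then have "[of_int (if poly_QuadRes (P ^ k) c then 1 else - 1) = of_int (leg P c)] (mod P ^ k)"
    using cong_trans[OF cong_sym[OF euler_QuadRes[OF assms]]] by blast
  moreover have "P dvd P ^ k" using k by (simp add: dvd_power)
  ultimately have "[of_int (if poly_QuadRes (P ^ k) c then 1 else - 1) = of_int (leg P c)] (mod P)"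
    by (rule cong_dvd_modulus_poly)
  moreover have "leg P c \<in> {1, -1}" using c by (auto simp: leg_def)
  ultimately have "(if poly_QuadRes (P ^ k) c then 1 else - 1) = leg P c" by (intro sign_cong_iff) auto
  then show ?thesis by (auto split: if_splits)
qed

lemma root_count_other:
  assumes k: "k > 0" and D: "\<not> P dvd D"
  shows "int (root_count D (P ^ k)) = 1 + leg P (- D)"
proof -
  let ?R = "{b \<in> polys_below (degree (P ^ k)). P ^ k dvd b ^ 2 + D}"
  have PM: "P dvd P ^ k" using k by (simp add: dvd_power)
  have R: "?R = {x \<in> unit_residues (P ^ k). [x ^ 2 = - D] (mod P ^ k)}"
  proof -
    have "\<not> P dvd b" if "P ^ k dvd b ^ 2 + D" for b
    proof
      assume "P dvd b"
      then have "P dvd b ^ 2" using P_dvd_power by simp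
      moreover have "P dvd b ^ 2 + D" using PM that by (rule dvd_trans)
      ultimately show False using D dvd_add_right_iff by blast
    qed
    then show ?thesis unfolding unit_residues_def coprime_P_pow[OF k] cong_iff_dvd_diff by auto
  qed
  have D': "\<not> P dvd - D" using D by simp
  show ?thesis
  proof (cases "poly_QuadRes (P ^ k) (- D)")
    case True
    then obtain s where s: "[s ^ 2 = - D] (mod P ^ k)" by (auto simp: poly_QuadRes_def)
    then have "[s ^ 2 = - D] (mod P)" using PM by (rule cong_dvd_modulus_poly)
    from cong_dvd_iff[OF this] have Ps: "\<not> P dvd s" using D' P_dvd_power[of 2 s] by simp
    have "?R = {x \<in> unit_residues (P ^ k). [x ^ 2 = s ^ 2] (mod P ^ k)}"
      unfolding R using s cong_trans[OF _ cong_sym[OF s]] cong_trans[OF _ s] by blast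
    then have "card ?R = 2" using square_roots[OF k Ps] by simp
    then show ?thesis using True QuadRes_pow_iff[OF k D'] by (simp add: root_count_def)
  next
    case False
    then have "?R = {}" unfolding R by (auto simp: poly_QuadRes_def)
    moreover have "leg P (- D) = -1" using False QuadRes_pow_iff[OF k D'] leg_sign[OF D'] by auto
    ultimately show ?thesis by (simp only: root_count_def) simp
  qed
qed

lemma root_count_self: "root_count P P = 1" "k \<ge> 2 \<Longrightarrow> root_count P (P ^ k) = 0"
proof -
  have "{b \<in> polys_below (degree P). P dvd b ^ 2 + P} = {0}"
    using P_dvd_power[of 2] by (auto simp: mem_polys_below dvd_add_left_iff dest: dvd_imp_degree_le)
  then show "root_count P P = 1" by (simp add: root_count_def)
  assume k: "k \<ge> 2"
  have False if "P ^ k dvd b ^ 2 + P" for b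
  proof -
    have P2: "P ^ 2 dvd b ^ 2 + P" using that k le_imp_power_dvd dvd_trans by blast
    then have "P dvd b ^ 2 + P" by (metis dvd_mult_left power2_eq_square)
    then have "P dvd b" using P_dvd_power[of 2 b] by (simp add: dvd_add_left_iff)
    then have "P ^ 2 dvd b ^ 2" by (simp add: dvd_power_same)
    then have "P ^ 2 dvd P" using P2 dvd_add_right_iff by blast
    then have "degree (P ^ 2) \<le> degree P" by (rule dvd_imp_degree_le) simp
    then show False using deg_pos by (simp add: degree_P_pow)
  qed
  then have "{b \<in> polys_below (degree (P ^ k)). P ^ k dvd b ^ 2 + P} = {}" by blast
  then show "root_count P (P ^ k) = 0" by (simp only: root_count_def card.empty)
qed

lemma padic_decomp:
  assumes "g \<noteq> 0"
  obtains i g' where "g = P ^ i * g'" "\<not> P dvd g'"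
proof -
  have "\<exists>i g'. g = P ^ i * g' \<and> \<not> P dvd g'"
    using assms
  proof (induction "degree g" arbitrary: g rule: less_induct)
    case less
    show ?case
    proof (cases "P dvd g")
      case True
      then obtain h where h: "g = P * h" by (rule dvdE)
      then have "h \<noteq> 0" "degree h < degree g" using less.prems deg_pos by (auto simp: degree_mult_eq)
      then obtain i g' where "h = P ^ i * g'" "\<not> P dvd g'" using less.hyps by blast
      then show ?thesis using h by (intro exI[of _ "Suc i"] exI[of _ g']) simp
    next
      case False
      then show ?thesis by (intro exI[of _ 0] exI[of _ g]) simp
    qed
  qed
  then show thesis using that by blast
qed

lemma padic_unique:
  assumes "P ^ i * g = P ^ j * h" "\<not> P dvd g" "\<not> P dvd h"
  shows "i = j \<and> g = h"
proof -
  have le: "i \<le> j" if e: "P ^ i * g = P ^ j * h" "\<not> P dvd h" for i j g h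
  proof (rule ccontr)
    assume "\<not> i \<le> j"
    then obtain l where i: "i = j + Suc l" by (metis less_iff_Suc_add not_le add_Suc_right)
    then have "P ^ j * (P * (P ^ l * g)) = P ^ j * h" using e by (simp add: power_add ac_simps)
    then have "P * (P ^ l * g) = h" by simp
    then show False using e(2) by (metis dvd_triv_left)
  qed
  have "i = j" using le[OF assms(1,3)] le[OF assms(1)[symmetric] assms(2)] by simp
  then show ?thesis using assms(1) by simp
qed

end

definition square_factorizations :: "'a::field poly \<Rightarrow> ('a poly \<times> 'a poly) set" where
  "square_factorizations m = {(c, a). lead_coeff c = 1 \<and> lead_coeff a = 1 \<and> c ^ 2 * a = m}"

definition factorizations :: "'a::field poly \<Rightarrow> ('a poly \<times> 'a poly) set" where
  "factorizations m = {(g, h). lead_coeff g = 1 \<and> lead_coeff h = 1 \<and> g * h = m}"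

lemma mem_polys_below_factor:
  fixes g h :: "'a::field poly"
  assumes "lead_coeff g = 1" "lead_coeff h = 1"
  shows "g \<in> polys_below (Suc (degree (g * h)))" "h \<in> polys_below (Suc (degree (g * h)))"
proof -
  have "g \<noteq> 0" "h \<noteq> 0" using assms by auto
  then show "g \<in> polys_below (Suc (degree (g * h)))" "h \<in> polys_below (Suc (degree (g * h)))"
    by (simp_all add: mem_polys_below degree_mult_eq)
qed

lemma finite_factorizations [simp]: "finite (factorizations (m :: 'a::{finite,field} poly))"
proof (rule finite_subset)
  show "factorizations m \<subseteq> polys_below (Suc (degree m)) \<times> polys_below (Suc (degree m))"
    using mem_polys_below_factor by (auto simp: factorizations_def)
qed simp

lemma finite_square_factorizations [simp]: "finite (square_factorizations (m :: 'a::{finite,field} poly))"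
proof (rule finite_subset)
  have "c \<in> polys_below (Suc (degree (c ^ 2 * a))) \<and> a \<in> polys_below (Suc (degree (c ^ 2 * a)))"
    if "lead_coeff c = 1" "lead_coeff a = 1" for c a :: "'a poly"
    using mem_polys_below_factor[of c "c * a"] mem_polys_below_factor[of "c * c" a] that
    by (simp add: power2_eq_square lead_coeff_mult mult.assoc)
  then show "square_factorizations m \<subseteq> polys_below (Suc (degree m)) \<times> polys_below (Suc (degree m))"
    by (auto simp: square_factorizations_def)
qed simp

lemma ex_monic_irreducible_dvd:
  fixes m :: "'a::field poly"
  assumes "degree m > 0"
  obtains Q where "irreducible Q" "lead_coeff Q = 1" "Q dvd m"
proof -
  define n where "n = (LEAST n. \<exists>Q. degree Q = n \<and> n > 0 \<and> Q dvd m)"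
  have "\<exists>Q. degree Q = n \<and> n > 0 \<and> Q dvd m" unfolding n_def by (rule LeastI[of _ "degree m"]) (use assms in auto)
  then obtain Q where Q: "degree Q = n" "n > 0" "Q dvd m" by blast
  have least: "degree Q' \<ge> n" if "Q' dvd m" "degree Q' > 0" for Q'
    unfolding n_def by (rule Least_le) (use that in auto)
  have Q0: "Q \<noteq> 0" using Q by auto
  have irr: "irreducible Q"
  proof (rule irreducibleI)
    show "\<not> is_unit Q" using Q Q0 by (simp add: is_unit_iff_degree)
    fix a b assume ab: "Q = a * b"
    then have nz: "a \<noteq> 0" "b \<noteq> 0" using Q0 by auto
    have dab: "degree a + degree b = n" using ab nz Q by (simp add: degree_mult_eq)
    show "is_unit a \<or> is_unit b"
    proof (rule ccontr)
      assume "\<not> (is_unit a \<or> is_unit b)"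
      then have "degree a > 0" "degree b > 0" using nz by (auto simp: is_unit_iff_degree)
      moreover have "a dvd m" using ab Q(3) by (metis dvd_mult_left)
      ultimately show False using least[of a] dab by simp
    qed
  qed (rule Q0)
  let ?Q = "smult (inverse (lead_coeff Q)) Q"
  have lc: "lead_coeff Q \<noteq> 0" using Q0 by simp
  have "irreducible ?Q"
  proof -
    have "is_unit [:inverse (lead_coeff Q):]" using lc by (simp add: is_unit_iff_degree)
    then have "irreducible ([:inverse (lead_coeff Q):] * Q)" using irr by (subst irreducible_mult_unit_left)
    then show ?thesis by simp
  qed
  moreover have "lead_coeff ?Q = 1" using lc by simp
  moreover have "?Q dvd m" using Q(3) lc by (simp add: smult_dvd)
  ultimately show thesis by (rule that)
qed

lemma (in irreducible_poly) factorizations_extend: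
  assumes nd: "\<not> P dvd m" and m: "m \<noteq> 0"
  shows "bij_betw (\<lambda>(i, (g, h)). (P ^ i * g, P ^ (k - i) * h)) ({..k} \<times> factorizations m) (factorizations (P ^ k * m))"
    (is "bij_betw ?f ?A ?B")
proof (rule bij_betw_imageI)
  have ndf: "\<not> P dvd g \<and> \<not> P dvd h" if "(g, h) \<in> factorizations m" for g h
    using that nd by (auto simp: factorizations_def)
  show "inj_on ?f ?A"
  proof (rule inj_onI)
    fix x y assume xy: "x \<in> ?A" "y \<in> ?A" "?f x = ?f y"
    obtain i g h i' g' h' where [simp]: "x = (i, (g, h))" "y = (i', (g', h'))" by (cases x, cases y) auto
    have "\<not> P dvd g" "\<not> P dvd g'" "\<not> P dvd h" "\<not> P dvd h'" using xy ndf[of g h] ndf[of g' h'] by auto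
    moreover have "P ^ i * g = P ^ i' * g'" "P ^ (k - i) * h = P ^ (k - i') * h'" using xy by auto
    ultimately show "x = y" using padic_unique[of i g i' g'] padic_unique[of "k - i" h "k - i'" h'] by auto
  qed
  show "?f ` ?A = ?B"
  proof (intro equalityI subsetI)
    fix x assume "x \<in> ?f ` ?A"
    then obtain i g h where x: "x = (P ^ i * g, P ^ (k - i) * h)" "i \<le> k" "(g, h) \<in> factorizations m" by auto
    have "P ^ i * P ^ (k - i) = P ^ k" using x(2) by (simp flip: power_add)
    moreover have "P ^ i * g * (P ^ (k - i) * h) = (P ^ i * P ^ (k - i)) * (g * h)" by (simp only: ac_simps)
    ultimately have "P ^ i * g * (P ^ (k - i) * h) = P ^ k * m" using x(3) by (auto simp: factorizations_def)
    then show "x \<in> ?B" using x by (simp add: factorizations_def lead_coeff_mult lead_coeff_power monic)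
  next
    fix x assume x: "x \<in> ?B"
    obtain u v where [simp]: "x = (u, v)" by (cases x)
    have uv: "lead_coeff u = 1" "lead_coeff v = 1" "u * v = P ^ k * m" using x by (auto simp: factorizations_def)
    then have "u \<noteq> 0" "v \<noteq> 0" by auto
    then obtain i g j h where gh: "u = P ^ i * g" "\<not> P dvd g" "v = P ^ j * h" "\<not> P dvd h" by (metis padic_decomp)
    then have "P ^ (i + j) * (g * h) = P ^ k * m" using uv by (simp add: power_add ac_simps)
    then have 1: "i + j = k \<and> g * h = m" using padic_unique nd gh P_dvd_mult by blast
    have "(g, h) \<in> factorizations m" using uv 1 gh by (simp add: factorizations_def lead_coeff_mult lead_coeff_power monic)
    then show "x \<in> ?f ` ?A" using 1 gh by (intro image_eqI[of _ _ "(i, (g, h))"]) auto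
  qed
qed

lemma (in irreducible_poly) square_factorizations_extend:
  assumes nd: "\<not> P dvd m" and m: "m \<noteq> 0"
  shows "bij_betw (\<lambda>(j, (c, a)). (P ^ j * c, P ^ (k - 2 * j) * a)) ({..k div 2} \<times> square_factorizations m)
    (square_factorizations (P ^ k * m))" (is "bij_betw ?f ?A ?B")
proof (rule bij_betw_imageI)
  have ndf: "\<not> P dvd c \<and> \<not> P dvd a" if "(c, a) \<in> square_factorizations m" for c a
    using that nd P_dvd_power[of 2 c] by (auto simp: square_factorizations_def)
  show "inj_on ?f ?A"
  proof (rule inj_onI)
    fix x y assume xy: "x \<in> ?A" "y \<in> ?A" "?f x = ?f y"
    obtain i g h i' g' h' where [simp]: "x = (i, (g, h))" "y = (i', (g', h'))" by (cases x, cases y) auto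
    have "\<not> P dvd g" "\<not> P dvd g'" "\<not> P dvd h" "\<not> P dvd h'" using xy ndf[of g h] ndf[of g' h'] by auto
    moreover have "P ^ i * g = P ^ i' * g'" "P ^ (k - 2 * i) * h = P ^ (k - 2 * i') * h'" using xy by auto
    ultimately show "x = y" using padic_unique[of i g i' g'] padic_unique[of "k - 2 * i" h "k - 2 * i'" h'] by auto
  qed
  show "?f ` ?A = ?B"
  proof (intro equalityI subsetI)
    fix x assume "x \<in> ?f ` ?A"
    then obtain j c a where x: "x = (P ^ j * c, P ^ (k - 2 * j) * a)" "2 * j \<le> k" "(c, a) \<in> square_factorizations m" by auto
    have "P ^ j * P ^ j * P ^ (k - 2 * j) = P ^ k" using x(2) by (simp flip: power_add)
    moreover have "(P ^ j * c) ^ 2 * (P ^ (k - 2 * j) * a) = (P ^ j * P ^ j * P ^ (k - 2 * j)) * (c ^ 2 * a)"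
      by (simp only: power2_eq_square ac_simps)
    ultimately have "(P ^ j * c) ^ 2 * (P ^ (k - 2 * j) * a) = P ^ k * m" using x(3) by (auto simp: square_factorizations_def)
    then show "x \<in> ?B" using x by (simp add: square_factorizations_def lead_coeff_mult lead_coeff_power monic)
  next
    fix x assume x: "x \<in> ?B"
    obtain u v where [simp]: "x = (u, v)" by (cases x)
    have uv: "lead_coeff u = 1" "lead_coeff v = 1" "u ^ 2 * v = P ^ k * m" using x by (auto simp: square_factorizations_def)
    then have "u \<noteq> 0" "v \<noteq> 0" by auto
    then obtain i g j h where gh: "u = P ^ i * g" "\<not> P dvd g" "v = P ^ j * h" "\<not> P dvd h" by (metis padic_decomp)
    then have "P ^ (2 * i + j) * (g ^ 2 * h) = P ^ k * m" using uv
      by (simp add: power_add power_mult power_mult_distrib ac_simps flip: power_mult)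
    moreover have "\<not> P dvd g ^ 2 * h" using gh P_dvd_mult P_dvd_power[of 2 g] by simp
    ultimately have 1: "2 * i + j = k \<and> g ^ 2 * h = m" using padic_unique nd by blast
    have "(g, h) \<in> square_factorizations m" using uv 1 gh by (simp add: square_factorizations_def lead_coeff_mult lead_coeff_power monic)
    then show "x \<in> ?f ` ?A" using 1 gh by (intro image_eqI[of _ _ "(i, (g, h))"]) auto
  qed
qed

locale ramified_prime = irreducible_poly P for P :: "'a::{finite,field} poly" +
  fixes S :: "'a set"
  assumes half: "half_system S" and card_mod_4: "[CARD('a) = 3] (mod 4)" and odd_deg: "odd (degree P)"
begin

lemma odd_half_order: "odd half_order"
  using even_half_iff[OF odd_card, of "degree P"] odd_deg card_mod_4 unfolding half_order_def
  by (auto simp: cong_def)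

lemma leg_reciprocal:
  assumes "irreducible_poly Q" "Q \<noteq> P"
  shows "leg Q (- P) = leg P Q"
proof -
  interpret Q: irreducible_poly Q by fact
  have "leg P Q * leg Q P = (- 1) ^ (half_order * Q.half_order)"
    using quadratic_reciprocity[OF half irreducible_poly_axioms assms(1)] assms(2) by simp
  also have "\<dots> = (- 1) ^ Q.half_order" using odd_half_order by (simp add: minus_one_power_iff)
  finally have e: "leg P Q * leg Q P = (- 1) ^ Q.half_order" .
  have "leg Q (- P) = (- 1) ^ Q.half_order * leg Q P" by (rule Q.leg_minus)
  also have "\<dots> = leg P Q * (leg Q P * leg Q P)" by (simp flip: e)
  also have "leg Q P * leg Q P = 1"
    using Q.leg_sign[OF Q.not_dvd_monic[OF irr monic]] assms(2) by auto
  finally show ?thesis by simp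
qed

lemma root_count_prime_power:
  assumes Q: "irreducible_poly Q"
  shows "int (root_count P (Q ^ k)) = (if k = 0 then 1 else leg P Q ^ k + leg P Q ^ (k - 1))"
proof (cases "Q = P")
  case True
  consider "k = 0" | "k = 1" | "k \<ge> 2" by linarith
  then show ?thesis using True root_count_self(1) root_count_self(2)[of k] leg_eq_0_iff[of P P]
    by cases (auto simp: root_count_1 power_0_left)
next
  case False
  interpret Q: irreducible_poly Q by fact
  have nd: "\<not> Q dvd P" using Q.not_dvd_monic[OF irr monic] False by simp
  have sgn: "leg P Q \<in> {1, -1}" using leg_sign[OF not_dvd_monic[OF Q.irr Q.monic False]] .
  show ?thesis
  proof (cases k)
    case (Suc l)
    have "int (root_count P (Q ^ k)) = 1 + leg P Q"
      using Q.root_count_other[OF _ nd, of k] leg_reciprocal[OF Q False] Suc by simp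
    also have "\<dots> = leg P Q ^ k + leg P Q ^ (k - 1)" using sgn Suc by (auto simp: minus_one_power_iff)
    finally show ?thesis using Suc by simp
  qed (simp add: root_count_1)
qed

lemma sum_root_count_prime_power:
  assumes Q: "irreducible_poly Q"
  shows "(\<Sum>j\<le>k div 2. int (root_count P (Q ^ (k - 2 * j)))) = (\<Sum>i\<le>k. leg P Q ^ i)"
proof (induction k rule: less_induct)
  case (less k)
  consider "k = 0" | "k = 1" | l where "k = Suc (Suc l)" by (metis One_nat_def not0_implies_Suc)
  then show ?case
  proof cases
    case 3
    have "(\<Sum>j\<le>k div 2. int (root_count P (Q ^ (k - 2 * j)))) =
      int (root_count P (Q ^ k)) + (\<Sum>j\<le>l div 2. int (root_count P (Q ^ (l - 2 * j))))"
      unfolding 3 by (simp add: sum.atMost_Suc_shift del: sum.atMost_Suc)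
    also have "\<dots> = (\<Sum>i\<le>k. leg P Q ^ i)"
      using less[of l] 3 root_count_prime_power[OF Q, of k] by simp
    finally show ?thesis .
  qed (use root_count_prime_power[OF Q, of 1] in \<open>simp_all add: root_count_1\<close>)
qed

lemma sum_root_count_eq:
  assumes "lead_coeff m = 1"
  shows "(\<Sum>(c, a)\<in>square_factorizations m. int (root_count P a)) = (\<Sum>(g, h)\<in>factorizations m. leg P g)"
  using assms
proof (induction "degree m" arbitrary: m rule: less_induct)
  case (less m)
  have m0: "m \<noteq> 0" using less.prems by auto
  show ?case
  proof (cases "degree m = 0")
    case True
    then have m1: "m = 1" using less.prems by (auto elim!: degree_eq_zeroE simp: one_pCons)
    have u: "c = 1" if "lead_coeff c = 1" "is_unit c" for c :: "'a poly"
    proof -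
      have "c \<noteq> 0" using that(1) by auto
      then have "degree c = 0" using that is_unit_iff_degree[of c] by auto
      then show ?thesis using that(1) by (auto elim!: degree_eq_zeroE simp: one_pCons)
    qed
    have u2: "c = 1 \<and> d = 1" if "lead_coeff c = 1" "c * d = 1" for c d :: "'a poly"
    proof -
      have "c dvd c * d" by (rule dvd_triv_left)
      then have "is_unit c" using that(2) by simp
      then have "c = 1" using that(1) by (intro u)
      then show ?thesis using that(2) by simp
    qed
    have "factorizations m = {(1, 1)}"
    proof (intro equalityI subsetI)
      fix x assume "x \<in> factorizations m"
      then obtain g h where "x = (g, h)" "lead_coeff g = 1" "g * h = 1" unfolding m1 factorizations_def by blast
      then show "x \<in> {(1, 1)}" using u2[of g h] by simp
    qed (simp add: m1 factorizations_def)
    moreover have "square_factorizations m = {(1, 1)}"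
    proof (intro equalityI subsetI)
      fix x assume "x \<in> square_factorizations m"
      then obtain c b where x: "x = (c, b)" "lead_coeff c = 1" "c ^ 2 * b = 1" unfolding m1 square_factorizations_def by blast
      then have "c * (c * b) = 1" by (simp only: power2_eq_square mult.assoc)
      then show "x \<in> {(1, 1)}" using u2[OF x(2), of "c * b"] x(1) by simp
    qed (simp add: m1 square_factorizations_def)
    ultimately
    show ?thesis by (simp add: root_count_1 leg_1)
  next
    case False
    then have "degree m > 0" by simp
    then obtain Q where Q: "irreducible Q" "lead_coeff Q = 1" "Q dvd m" by (rule ex_monic_irreducible_dvd)
    have Qi: "irreducible_poly Q" by unfold_locales (use Q odd_card in auto)
    then interpret Q: irreducible_poly Q .
    obtain k m' where m': "m = Q ^ k * m'" "\<not> Q dvd m'" using Q.padic_decomp[OF m0] .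
    have "k \<noteq> 0" using m' Q(3) by (cases k) auto
    have m'0: "m' \<noteq> 0" using m' m0 by auto
    have "degree m = k * degree Q + degree m'" using m' m'0 by (simp add: degree_mult_eq Q.degree_P_pow)
    then have lt: "degree m' < degree m" using \<open>k \<noteq> 0\<close> Q.deg_pos by simp
    have lc: "lead_coeff m' = 1" using m' less.prems Q(2) by (simp add: lead_coeff_mult lead_coeff_power)
    have "(\<Sum>(c, a)\<in>square_factorizations m. int (root_count P a)) =
      (\<Sum>(j, (c, a))\<in>{..k div 2} \<times> square_factorizations m'. int (root_count P (Q ^ (k - 2 * j) * a)))"
      unfolding m'(1) by (subst sum.reindex_bij_betw[OF Q.square_factorizations_extend[OF m'(2) m'0], symmetric])
        (simp add: case_prod_unfold)
    also have "\<dots> = (\<Sum>(j, (c, a))\<in>{..k div 2} \<times> square_factorizations m'. int (root_count P (Q ^ (k - 2 * j))) * int (root_count P a))"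
    proof (rule sum.cong)
      fix x assume x: "x \<in> {..k div 2} \<times> square_factorizations m'"
      obtain j c a where [simp]: "x = (j, (c, a))" by (cases x) auto
      have "c ^ 2 * a = m'" using x by (auto simp: square_factorizations_def)
      then have "\<not> Q dvd a" using m'(2) by auto
      then have "coprime a (Q ^ (k - 2 * j))"
        using coprime_poly_power_right[of a Q] coprime_irreducible_iff[OF Q(1)] by blast
      moreover have "a \<noteq> 0" using \<open>\<not> Q dvd a\<close> by auto
      ultimately have "root_count P (Q ^ (k - 2 * j) * a) = root_count P (Q ^ (k - 2 * j)) * root_count P a"
        by (intro root_count_mult) (auto simp: coprime_commute)
      then show "(case x of (j, c, a) \<Rightarrow> int (root_count P (Q ^ (k - 2 * j) * a))) =
        (case x of (j, c, a) \<Rightarrow> int (root_count P (Q ^ (k - 2 * j))) * int (root_count P a))" by simp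
    qed simp
    also have "\<dots> = (\<Sum>j\<le>k div 2. int (root_count P (Q ^ (k - 2 * j)))) * (\<Sum>(c, a)\<in>square_factorizations m'. int (root_count P a))"
      by (simp add: sum_product sum.cartesian_product case_prod_unfold)
    also have "\<dots> = (\<Sum>i\<le>k. leg P Q ^ i) * (\<Sum>(g, h)\<in>factorizations m'. leg P g)"
      using less.hyps[OF lt lc] sum_root_count_prime_power[OF Qi] by simp
    also have "\<dots> = (\<Sum>(i, (g, h))\<in>{..k} \<times> factorizations m'. leg P (Q ^ i * g))"
      by (simp add: sum_product sum.cartesian_product case_prod_unfold leg_mult leg_power)
    also have "\<dots> = (\<Sum>(g, h)\<in>factorizations m. leg P g)"
      unfolding m'(1) by (subst sum.reindex_bij_betw[OF Q.factorizations_extend[OF m'(2) m'0], symmetric])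
        (simp add: case_prod_unfold)
    finally show ?thesis .
  qed
qed

end

section \<open>The generating function of the ideal norms\<close>

definition monics :: "nat \<Rightarrow> 'a::field poly set" where
  "monics n = {g. lead_coeff g = 1 \<and> degree g = n}"

lemma monics_iff: "g \<in> monics n \<longleftrightarrow> coeff g n = 1 \<and> g \<in> polys_below (Suc n)"
proof
  assume "coeff g n = 1 \<and> g \<in> polys_below (Suc n)"
  moreover from this have "degree g \<ge> n" by (intro le_degree) simp
  ultimately have "degree g = n" by (auto simp: mem_polys_below)
  then show "g \<in> monics n" using \<open>coeff g n = 1 \<and> g \<in> polys_below (Suc n)\<close> by (simp add: monics_def)
qed (auto simp: monics_def mem_polys_below)

lemma monics_nonzero: "g \<in> monics n \<Longrightarrow> g \<noteq> 0"
  by (auto simp: monics_def)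

lemma monics_mult:
  assumes "g \<in> monics k" "h \<in> monics l"
  shows "g * h \<in> monics (k + l)"
proof -
  have "lead_coeff g = 1" "lead_coeff h = 1" using assms by (auto simp: monics_def)
  then have "lead_coeff (g * h) = 1" by (simp only: lead_coeff_mult mult_1)
  moreover have "degree (g * h) = k + l" using assms monics_nonzero by (subst degree_mult_eq) (auto simp: monics_def)
  ultimately show ?thesis unfolding monics_def by blast
qed

lemma monics_mult_cancel:
  assumes "g \<in> monics k" "g * h \<in> monics n"
  shows "h \<in> monics (n - k)"
proof -
  have "h \<noteq> 0" "g \<noteq> 0" using assms monics_nonzero[of "g * h" n] by auto
  then have "degree (g * h) = degree g + degree h" by (simp add: degree_mult_eq)
  moreover have "lead_coeff (g * h) = lead_coeff g * lead_coeff h" by (rule lead_coeff_mult)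
  ultimately show ?thesis using assms unfolding monics_def by auto
qed

lemma monics_add: "r \<in> polys_below n \<Longrightarrow> g \<in> monics n \<Longrightarrow> r + g \<in> monics n"
  by (simp add: monics_iff polys_below_def)

lemma monics_eq: "monics n = (\<lambda>r. monom 1 n + r) ` polys_below n"
proof (intro equalityI subsetI)
  fix g :: "'a poly" assume g: "g \<in> monics n"
  then have "g - monom 1 n \<in> polys_below n"
    by (auto simp: monics_def polys_below_def coeff_eq_0 le_less)
  moreover have "g = monom 1 n + (g - monom 1 n)" by simp
  ultimately show "g \<in> (\<lambda>r. monom 1 n + r) ` polys_below n" by blast
next
  fix g :: "'a poly" assume "g \<in> (\<lambda>r. monom 1 n + r) ` polys_below n"
  then obtain r where r: "g = monom 1 n + r" "r \<in> polys_below n" by blast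
  have c: "coeff g n = 1" using r by (simp add: polys_below_def)
  have "degree g \<le> n" by (rule degree_le) (use r in \<open>auto simp: polys_below_def\<close>)
  moreover have "degree g \<ge> n" using c by (intro le_degree) simp
  ultimately show "g \<in> monics n" using c by (simp add: monics_def)
qed

lemma finite_monics [simp]: "finite (monics n :: 'a::{finite,field} poly set)"
  by (simp add: monics_eq)

lemma card_monics: "card (monics n :: 'a::{finite,field} poly set) = CARD('a) ^ n"
  unfolding monics_eq by (subst card_image) (auto simp: inj_on_def card_polys_below)

lemma monic_below_eq: "monic_below n = (\<Union>k<n. monics k :: 'a::field poly set)"
  by (auto simp: monic_below_def monics_def mem_polys_below)

text \<open>Indexes the ideals of norm degree \<open>n\<close> of the ring generated by a square root of \<open>- P\<close>.\<close>

definition ideal_data :: "'a::field poly \<Rightarrow> nat \<Rightarrow> ('a poly \<times> 'a poly \<times> 'a poly) set" where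
  "ideal_data P n = {(c, a, b). lead_coeff c = 1 \<and> lead_coeff a = 1 \<and> b \<in> polys_below (degree a) \<and>
     a dvd b ^ 2 + P \<and> 2 * degree c + degree a = n}"

lemma ideal_data_eq:
  "ideal_data P n = (\<lambda>(m, (c, a), b). (c, a, b)) `
     (SIGMA m:monics n. SIGMA (c, a):square_factorizations m. {b \<in> polys_below (degree a). a dvd b ^ 2 + P})"
proof (intro equalityI subsetI)
  fix x assume x: "x \<in> ideal_data P n"
  obtain c a b where [simp]: "x = (c, a, b)" by (cases x) auto
  have x': "lead_coeff c = 1" "lead_coeff a = 1" "2 * degree c + degree a = n"
    "b \<in> polys_below (degree a)" "a dvd b ^ 2 + P" using x by (auto simp: ideal_data_def)
  then have "c * (c * a) \<in> monics (degree c + (degree c + degree a))" by (intro monics_mult) (auto simp: monics_def)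
  moreover have "degree c + (degree c + degree a) = n" using x'(3) by simp
  ultimately have "c ^ 2 * a \<in> monics n" by (simp add: power2_eq_square mult.assoc)
  then show "x \<in> (\<lambda>(m, (c, a), b). (c, a, b)) `
     (SIGMA m:monics n. SIGMA (c, a):square_factorizations m. {b \<in> polys_below (degree a). a dvd b ^ 2 + P})"
    using x' by (intro image_eqI[of _ _ "(c ^ 2 * a, (c, a), b)"]) (auto simp: square_factorizations_def)
next
  fix x assume "x \<in> (\<lambda>(m, (c, a), b). (c, a, b)) `
     (SIGMA m:monics n. SIGMA (c, a):square_factorizations m. {b \<in> polys_below (degree a). a dvd b ^ 2 + P})"
  then obtain m c a b where [simp]: "x = (c, a, b)" and *: "m \<in> monics n" "(c, a) \<in> square_factorizations m"
    "b \<in> polys_below (degree a)" "a dvd b ^ 2 + P" by auto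
  have "lead_coeff c = 1" "lead_coeff a = 1" "degree (c ^ 2 * a) = n" using * by (auto simp: square_factorizations_def monics_def)
  moreover from this have "c \<noteq> 0" "a \<noteq> 0" by auto
  ultimately show "x \<in> ideal_data P n" using *
    by (simp add: ideal_data_def degree_mult_eq degree_power_eq)
qed

lemma card_ideal_data:
  "card (ideal_data P n) = (\<Sum>m\<in>monics n. \<Sum>(c, a)\<in>square_factorizations m. root_count P a)"
  for P :: "'a::{finite,field} poly"
proof -
  have "card (ideal_data P n) = card (SIGMA m:monics n. SIGMA (c, a):square_factorizations m. {b \<in> polys_below (degree a). a dvd b ^ 2 + P})"
    unfolding ideal_data_eq by (rule card_image) (auto simp: inj_on_def square_factorizations_def)
  also have "\<dots> = (\<Sum>m\<in>monics n. \<Sum>(c, a)\<in>square_factorizations m. root_count P a)"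
    by (simp add: card_SigmaI case_prod_unfold root_count_def)
  finally show ?thesis .
qed

lemma finite_ideal_data [simp]: "finite (ideal_data P n)"
  for P :: "'a::{finite,field} poly"
  unfolding ideal_data_eq by (intro finite_imageI finite_SigmaI) (auto simp: case_prod_unfold)

lemma sum_factorizations:
  fixes F :: "'a::{finite,field} poly \<Rightarrow> int"
  shows "(\<Sum>m\<in>monics n. \<Sum>(g, h)\<in>factorizations m. F g) = (\<Sum>k\<le>n. int CARD('a) ^ (n - k) * (\<Sum>g\<in>monics k. F g))"
proof -
  have bij: "bij_betw (\<lambda>(k, g, h). (g * h, g, h)) (SIGMA k:{..n}. (monics k :: 'a poly set) \<times> monics (n - k))
    (SIGMA m:monics n. factorizations m)"
  proof (rule bij_betwI[where g = "\<lambda>(m, g, h). (degree g, g, h)"])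
    show "(\<lambda>(k, g, h). (g * h, g, h)) \<in> (SIGMA k:{..n}. (monics k :: 'a poly set) \<times> monics (n - k)) \<rightarrow> (SIGMA m:monics n. factorizations m)"
    proof
      fix x :: "nat \<times> 'a poly \<times> 'a poly" assume x: "x \<in> (SIGMA k:{..n}. monics k \<times> monics (n - k))"
      obtain k g h where [simp]: "x = (k, g, h)" by (cases x) auto
      have gh: "k \<le> n" "g \<in> monics k" "h \<in> monics (n - k)" using x by auto
      then have "g * h \<in> monics n" using monics_mult[OF gh(2,3)] by simp
      moreover have "lead_coeff g = 1" "lead_coeff h = 1" using gh by (auto simp: monics_def)
      ultimately show "(case x of (k, g, h) \<Rightarrow> (g * h, g, h)) \<in> (SIGMA m:monics n. factorizations m)"
        by (simp add: factorizations_def)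
    qed
    show "(\<lambda>(m, g, h). (degree g, g, h)) \<in> (SIGMA m:monics n. factorizations m) \<rightarrow> (SIGMA k:{..n}. (monics k :: 'a poly set) \<times> monics (n - k))"
    proof
      fix x :: "'a poly \<times> 'a poly \<times> 'a poly" assume x: "x \<in> (SIGMA m:monics n. factorizations m)"
      obtain m g h where [simp]: "x = (m, g, h)" by (cases x) auto
      have gh: "lead_coeff g = 1" "lead_coeff h = 1" "g * h \<in> monics n" using x by (auto simp: factorizations_def)
      then have g: "g \<in> monics (degree g)" by (simp add: monics_def)
      then have "h \<in> monics (n - degree g)" using monics_mult_cancel gh(3) by blast
      moreover have "h \<noteq> 0" using gh(2) by auto
      then have "degree g \<le> n" using degree_mult_right_le[of h g] gh(3) by (simp add: monics_def)
      ultimately show "(case x of (m, g, h) \<Rightarrow> (degree g, g, h)) \<in> (SIGMA k:{..n}. monics k \<times> monics (n - k))"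
        using g by simp
    qed
  qed (auto simp: monics_def factorizations_def)
  have "(\<Sum>m\<in>monics n. \<Sum>(g, h)\<in>factorizations m. F g) = (\<Sum>(m, g, h)\<in>(SIGMA m:monics n. factorizations m). F g)"
    by (simp add: sum.Sigma)
  also have "\<dots> = (\<Sum>(k, g, h)\<in>(SIGMA k:{..n}. (monics k :: 'a poly set) \<times> (monics (n - k) :: 'a poly set)). F g)"
    by (subst sum.reindex_bij_betw[OF bij, symmetric]) (simp add: case_prod_unfold)
  also have "\<dots> = (\<Sum>k\<le>n. \<Sum>(g, h)\<in>(monics k :: 'a poly set) \<times> (monics (n - k) :: 'a poly set). F g)"
    by (simp add: sum.Sigma)
  also have "\<dots> = (\<Sum>k\<le>n. \<Sum>g\<in>monics k. \<Sum>h\<in>(monics (n - k) :: 'a poly set). F g)"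
    by (simp only: sum.cartesian_product)
  also have "\<dots> = (\<Sum>k\<le>n. int CARD('a) ^ (n - k) * (\<Sum>g\<in>monics k. F g))"
    by (simp add: card_monics sum_distrib_left)
  finally show ?thesis .
qed

context ramified_prime begin

lemma card_ideal_data_eq:
  "int (card (ideal_data P n)) = (\<Sum>k\<le>n. int CARD('a) ^ (n - k) * (\<Sum>g\<in>monics k. leg P g))"
proof -
  have "int (card (ideal_data P n)) = (\<Sum>m\<in>monics n. \<Sum>(c, a)\<in>square_factorizations m. int (root_count P a))"
    unfolding card_ideal_data by (simp add: case_prod_unfold)
  also have "\<dots> = (\<Sum>m\<in>monics n. \<Sum>(g, h)\<in>factorizations m. leg P g)"
    by (rule sum.cong[OF refl], rule sum_root_count_eq) (unfold monics_def, blast)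
  finally show ?thesis unfolding sum_factorizations .
qed

lemma sum_leg_monics_large:
  assumes "n \<ge> degree P"
  shows "(\<Sum>g\<in>monics n. leg P g) = 0"
proof -
  let ?d = "degree P"
  have P_monics: "P \<in> monics ?d" using monic by (simp add: monics_def)
  have eq: "(\<Sum>r\<in>polys_below ?d. leg P r) = (\<Sum>r\<in>polys_below ?d. leg P (- r))"
    by (rule sum.reindex_bij_witness[of _ uminus uminus]) (auto simp: polys_below_def)
  have "leg P (- r) = - leg P r" for r using leg_minus odd_half_order by simp
  then have 0: "(\<Sum>r\<in>polys_below ?d. leg P r) = 0" using eq by (simp add: sum_negf)
  have bij: "bij_betw (\<lambda>(r, s). r + P * s) (polys_below ?d \<times> monics (n - ?d)) (monics n)"
  proof (rule bij_betwI[where g = "\<lambda>g. (g mod P, g div P)"])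
    show "(\<lambda>(r, s). r + P * s) \<in> polys_below ?d \<times> monics (n - ?d) \<rightarrow> monics n"
    proof (clarify)
      fix r s :: "'a poly" assume rs: "r \<in> polys_below ?d" "s \<in> monics (n - ?d)"
      have "P * s \<in> monics n" using monics_mult[OF P_monics rs(2)] assms by simp
      moreover have "r \<in> polys_below n" using rs(1) assms by (auto simp: polys_below_def)
      ultimately show "r + P * s \<in> monics n" using monics_add by blast
    qed
    show "(\<lambda>g. (g mod P, g div P)) \<in> monics n \<rightarrow> polys_below ?d \<times> monics (n - ?d)"
    proof
      fix g :: "'a poly" assume g: "g \<in> monics n"
      have r: "g mod P \<in> polys_below ?d" by (rule mod_mem_polys_below) simp
      then have "- (g mod P) \<in> polys_below n" using assms by (auto simp: polys_below_def)
      then have "- (g mod P) + g \<in> monics n" using g by (rule monics_add)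
      moreover have "P * (g div P) = - (g mod P) + g" by (simp add: minus_mod_eq_mult_div)
      ultimately have "g div P \<in> monics (n - ?d)" using monics_mult_cancel[OF P_monics] by simp
      then show "(g mod P, g div P) \<in> polys_below ?d \<times> monics (n - ?d)" using r by simp
    qed
    show "(\<lambda>g. (g mod P, g div P)) ((\<lambda>(r, s). r + P * s) x) = x" if "x \<in> polys_below ?d \<times> monics (n - ?d)" for x
      using that mod_poly_add_mult_eq[of "fst x" P "snd x"] by (auto split: prod.splits simp del: mod_mult_self2 div_mult_self2)
  qed simp
  have "(\<Sum>g\<in>monics n. leg P g) = (\<Sum>(r, s)\<in>polys_below ?d \<times> monics (n - ?d). leg P (r + P * s))"
    by (subst sum.reindex_bij_betw[OF bij, symmetric]) (simp add: case_prod_unfold)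
  also have "\<dots> = (\<Sum>(r, s)\<in>(polys_below ?d :: 'a poly set) \<times> (monics (n - ?d) :: 'a poly set). leg P r)"
  proof -
    have "leg P (r + P * s) = leg P r" for r s by (rule leg_cong) (simp add: cong_def)
    then show ?thesis by (simp only:)
  qed
  also have "\<dots> = (\<Sum>r\<in>(polys_below ?d :: 'a poly set). \<Sum>s\<in>(monics (n - ?d) :: 'a poly set). leg P r)"
    by (simp only: sum.cartesian_product)
  also have "\<dots> = 0" using 0 by (simp flip: sum_distrib_left)
  finally show ?thesis .
qed

lemma sum_leg_eq_ideal_count:
  assumes "M \<ge> degree P"
  shows "(\<Sum>g\<in>monic_below (degree P). leg P g) =
    int (card (ideal_data P M)) - (int CARD('a) - 1) * (\<Sum>n<M. int (card (ideal_data P n)))"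
proof -
  define s where "s k = (\<Sum>g\<in>monics k. leg P g)" for k
  define Z where "Z n = int (card (ideal_data P n))" for n
  have Z: "Z n = (\<Sum>k\<le>n. int CARD('a) ^ (n - k) * s k)" for n
    unfolding Z_def s_def by (rule card_ideal_data_eq)
  have Z_Suc: "Z (Suc n) = s (Suc n) + int CARD('a) * Z n" for n
  proof -
    have "Z (Suc n) = s (Suc n) + (\<Sum>k\<le>n. int CARD('a) ^ (Suc n - k) * s k)" unfolding Z by simp
    also have "(\<Sum>k\<le>n. int CARD('a) ^ (Suc n - k) * s k) = (\<Sum>k\<le>n. int CARD('a) * (int CARD('a) ^ (n - k) * s k))"
      by (rule sum.cong) (auto simp: Suc_diff_le)
    finally show ?thesis unfolding Z by (simp add: sum_distrib_left)
  qed
  have tele: "(\<Sum>k\<le>M. s k) = Z M - (int CARD('a) - 1) * (\<Sum>n<M. Z n)" for M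
  proof (induction M)
    case 0
    then show ?case using Z[of 0] by simp
  next
    case (Suc M)
    then show ?case by (simp add: Z_Suc algebra_simps)
  qed
  have "(\<Sum>g\<in>monic_below (degree P). leg P g) = (\<Sum>k<degree P. s k)"
    unfolding monic_below_eq s_def by (rule sum.UNION_disjoint) (simp_all, auto simp: monics_def)
  also have "\<dots> = (\<Sum>k\<le>M. s k)"
    by (rule sum.mono_neutral_left) (use assms sum_leg_monics_large in \<open>auto simp: s_def\<close>)
  finally show ?thesis unfolding tele Z_def .
qed

end

section \<open>Ideals of the quadratic order\<close>

lemma poly_ideal_generator:
  fixes J :: "'a::field poly set"
  assumes add: "\<And>x y. x \<in> J \<Longrightarrow> y \<in> J \<Longrightarrow> x + y \<in> J" and mul: "\<And>x s. x \<in> J \<Longrightarrow> s * x \<in> J"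
    and nz: "x0 \<in> J" "x0 \<noteq> 0"
  obtains g where "g \<in> J" "lead_coeff g = 1" "\<And>x. x \<in> J \<Longrightarrow> g dvd x"
proof -
  define n where "n = (LEAST n. \<exists>g\<in>J. g \<noteq> 0 \<and> degree g = n)"
  have "\<exists>g\<in>J. g \<noteq> 0 \<and> degree g = n" unfolding n_def by (rule LeastI[of _ "degree x0"]) (use nz in auto)
  then obtain g where g: "g \<in> J" "g \<noteq> 0" "degree g = n" by blast
  have least: "degree y \<ge> n" if "y \<in> J" "y \<noteq> 0" for y
    unfolding n_def by (rule Least_le) (use that in auto)
  have dv: "g dvd x" if "x \<in> J" for x
  proof (rule ccontr)
    assume "\<not> g dvd x"
    then have "x mod g \<noteq> 0" by (simp add: mod_eq_0_iff_dvd)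
    then have "degree (x mod g) < n" using degree_mod_less'[OF g(2)] g(3) by simp
    moreover have "x mod g = x + (- (x div g)) * g" by (simp add: minus_div_mult_eq_mod)
    then have "x mod g \<in> J" using add mul that g(1) by metis
    ultimately show False using least \<open>x mod g \<noteq> 0\<close> by force
  qed
  let ?c = "inverse (lead_coeff g)"
  have "smult ?c g \<in> J" using mul[OF g(1), of "[:?c:]"] by simp
  moreover have "lead_coeff (smult ?c g) = 1" using g(2) by simp
  moreover have "smult ?c g dvd x" if "x \<in> J" for x using dv[OF that] g(2) by (simp add: smult_dvd)
  ultimately show thesis by (rule that)
qed

lemma degree_add_cong:
  fixes p q p' q' :: "'a::field poly"
  assumes "degree p = degree p'" "degree q = degree q'" "p = 0 \<longleftrightarrow> p' = 0" "q = 0 \<longleftrightarrow> q' = 0"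
    and "p \<noteq> 0 \<Longrightarrow> q \<noteq> 0 \<Longrightarrow> degree p \<noteq> degree q"
  shows "degree (p + q) = degree (p' + q')" "p + q = 0 \<longleftrightarrow> p = 0 \<and> q = 0"
proof -
  consider "p = 0" | "q = 0" | "p \<noteq> 0" "q \<noteq> 0" "degree p < degree q" | "p \<noteq> 0" "q \<noteq> 0" "degree q < degree p"
    using assms(5) by (metis linorder_neqE_nat)
  then show "degree (p + q) = degree (p' + q')"
    by cases (use assms in \<open>auto simp: degree_add_eq_left degree_add_eq_right\<close>)
  show "p + q = 0 \<longleftrightarrow> p = 0 \<and> q = 0"
    using assms(5) by (metis add.inverse_unique add_0 add_cancel_left_right degree_minus)
qed

locale quadratic_order = irreducible_poly P for P :: "'a::{finite,field} poly" +
  fixes \<iota> :: "'a poly \<Rightarrow> 'l::field" and w :: 'l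
  assumes odd_deg: "odd (degree P)"
    and \<iota>_add: "\<iota> (a + b) = \<iota> a + \<iota> b" and \<iota>_mult: "\<iota> (a * b) = \<iota> a * \<iota> b" and \<iota>_1: "\<iota> 1 = 1"
    and w_square: "w * w = - \<iota> P"
    and indep: "\<iota> a + \<iota> b * w = 0 \<Longrightarrow> a = 0 \<and> b = 0"
begin

lemma \<iota>_0: "\<iota> 0 = 0" using \<iota>_add[of 0 0] unfolding add_0_left add_cancel_right_right .

lemma \<iota>_minus: "\<iota> (- a) = - \<iota> a"
  using \<iota>_add[of a "- a"] \<iota>_0 by (simp add: eq_neg_iff_add_eq_0 add.commute)

lemma \<iota>_eq_0_iff: "\<iota> a = 0 \<longleftrightarrow> a = 0"
  using indep[of a 0] \<iota>_0 by auto

lemma \<iota>_diff: "\<iota> (a - b) = \<iota> a - \<iota> b"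
  using \<iota>_add[of a "- b"] \<iota>_minus by simp

lemmas \<iota>_simps = \<iota>_add \<iota>_mult \<iota>_minus \<iota>_diff \<iota>_0 \<iota>_1

definition elt :: "'a poly \<Rightarrow> 'a poly \<Rightarrow> 'l" where "elt a b = \<iota> a + \<iota> b * w"

lemma elt_eq_iff: "elt a b = elt a' b' \<longleftrightarrow> a = a' \<and> b = b'"
proof
  assume "elt a b = elt a' b'"
  then have "\<iota> (a - a') + \<iota> (b - b') * w = 0" by (simp add: elt_def \<iota>_simps algebra_simps)
  from indep[OF this] show "a = a' \<and> b = b'" by simp
qed simp

lemma elt_add: "elt a b + elt a' b' = elt (a + a') (b + b')"
  by (simp add: elt_def \<iota>_simps algebra_simps)

lemma elt_minus: "- elt a b = elt (- a) (- b)"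
  by (simp add: elt_def \<iota>_simps)

lemma elt_diff: "elt a b - elt a' b' = elt (a - a') (b - b')"
  by (simp add: elt_def \<iota>_simps algebra_simps)

lemma elt_mult: "elt a b * elt a' b' = elt (a * a' - P * b * b') (a * b' + b * a')"
proof -
  have "elt a b * elt a' b' = \<iota> a * \<iota> a' + \<iota> b * \<iota> b' * (w * w) + (\<iota> a * \<iota> b' + \<iota> b * \<iota> a') * w"
    by (simp add: elt_def algebra_simps)
  then show ?thesis unfolding w_square by (simp add: elt_def \<iota>_simps algebra_simps)
qed

lemma elt_0: "elt 0 0 = 0" by (simp add: elt_def \<iota>_simps)
lemma elt_real: "elt a 0 = \<iota> a" by (simp add: elt_def \<iota>_simps)
lemma elt_eq_0_iff: "elt a b = 0 \<longleftrightarrow> a = 0 \<and> b = 0" using elt_eq_iff[of a b 0 0] elt_0 by simp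

definition order_ring :: "'l set" where "order_ring = {elt a b |a b. True}"

lemma order_ringE: assumes "z \<in> order_ring" obtains a b where "z = elt a b"
  using assms by (auto simp: order_ring_def)

lemma elt_mem [simp]: "elt a b \<in> order_ring" by (auto simp: order_ring_def)
lemma \<iota>_mem [simp]: "\<iota> a \<in> order_ring" using elt_mem[of a 0] by (simp add: elt_real)
lemma zero_mem [simp]: "0 \<in> order_ring" using elt_mem[of 0 0] by (simp add: elt_0)
lemma one_mem [simp]: "1 \<in> order_ring" using \<iota>_mem[of 1] by (simp add: \<iota>_1)
lemma add_mem: "x \<in> order_ring \<Longrightarrow> y \<in> order_ring \<Longrightarrow> x + y \<in> order_ring"
  by (auto elim!: order_ringE simp: elt_add)
lemma mult_mem: "x \<in> order_ring \<Longrightarrow> y \<in> order_ring \<Longrightarrow> x * y \<in> order_ring"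
  by (auto elim!: order_ringE simp: elt_mult)
lemma minus_mem: "x \<in> order_ring \<Longrightarrow> - x \<in> order_ring"
  by (auto elim!: order_ringE simp: elt_minus)

definition coords :: "'l \<Rightarrow> 'a poly \<times> 'a poly" where "coords z = (SOME p. z = elt (fst p) (snd p))"

lemma coords_elt [simp]: "coords (elt a b) = (a, b)"
  unfolding coords_def by (rule some_equality) (auto simp: elt_eq_iff)

definition cj :: "'l \<Rightarrow> 'l" where "cj z = elt (fst (coords z)) (- snd (coords z))"
definition nm :: "'l \<Rightarrow> 'a poly" where "nm z = fst (coords z) ^ 2 + P * snd (coords z) ^ 2"

lemma cj_elt [simp]: "cj (elt a b) = elt a (- b)" by (simp add: cj_def)
lemma nm_elt [simp]: "nm (elt a b) = a ^ 2 + P * b ^ 2" by (simp add: nm_def)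

lemma cj_mem [simp]: "cj z \<in> order_ring" by (simp add: cj_def)
lemma cj_add: "x \<in> order_ring \<Longrightarrow> y \<in> order_ring \<Longrightarrow> cj (x + y) = cj x + cj y"
  by (auto elim!: order_ringE simp: elt_add elt_eq_iff)
lemma cj_mult: "x \<in> order_ring \<Longrightarrow> y \<in> order_ring \<Longrightarrow> cj (x * y) = cj x * cj y"
  by (auto elim!: order_ringE simp: elt_mult elt_eq_iff)
lemma cj_cj: "x \<in> order_ring \<Longrightarrow> cj (cj x) = x" by (auto elim!: order_ringE)
lemma cj_\<iota>: "cj (\<iota> a) = \<iota> a" using cj_elt[of a 0] by (simp add: elt_real)
lemma cj_0: "cj 0 = 0" using cj_\<iota>[of 0] by (simp add: \<iota>_0)
lemma mult_cj: "x \<in> order_ring \<Longrightarrow> x * cj x = \<iota> (nm x)"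
  by (auto elim!: order_ringE simp: elt_mult elt_eq_iff power2_eq_square algebra_simps simp flip: elt_real)
lemma nm_mult: "x \<in> order_ring \<Longrightarrow> y \<in> order_ring \<Longrightarrow> nm (x * y) = nm x * nm y"
  by (auto elim!: order_ringE simp: elt_mult power2_eq_square algebra_simps)
lemma nm_\<iota>: "nm (\<iota> a) = a ^ 2" using nm_elt[of a 0] by (simp add: elt_real)

text \<open>
  The degree of the norm is the degree of \<open>a(X\<^sup>2) + X\<^bsup>deg P\<^esup> b(X\<^sup>2)\<close>, which, unlike the norm, is linear in
  the element \<open>elt a b\<close>.
\<close>

definition twist :: "'l \<Rightarrow> 'a poly" where
  "twist z = pcompose (fst (coords z)) [:0, 0, 1:] + monom 1 (degree P) * pcompose (snd (coords z)) [:0, 0, 1:]"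

lemma twist_elt: "twist (elt a b) = pcompose a [:0, 0, 1:] + monom 1 (degree P) * pcompose b [:0, 0, 1:]"
  by (simp add: twist_def)

lemma twist_add: "x \<in> order_ring \<Longrightarrow> y \<in> order_ring \<Longrightarrow> twist (x + y) = twist x + twist y"
  by (auto elim!: order_ringE simp: elt_add twist_elt pcompose_add algebra_simps)

lemma twist_const_mult: "x \<in> order_ring \<Longrightarrow> twist (\<iota> [:c:] * x) = smult c (twist x)"
proof (elim order_ringE)
  fix a b assume "x = elt a b"
  then have "\<iota> [:c:] * x = elt (smult c a) (smult c b)" by (simp add: elt_mult flip: elt_real)
  then show "twist (\<iota> [:c:] * x) = smult c (twist x)" using \<open>x = elt a b\<close>
    by (simp add: twist_elt pcompose_smult smult_add_right)
qed

lemma degree_twist: "z \<in> order_ring \<Longrightarrow> degree (twist z) = degree (nm z)"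
  and twist_eq_0_iff: "z \<in> order_ring \<Longrightarrow> twist z = 0 \<longleftrightarrow> z = 0"
  and nm_eq_0_iff: "z \<in> order_ring \<Longrightarrow> nm z = 0 \<longleftrightarrow> z = 0"
proof -
  let ?d = "degree P"
  have 1: "degree (pcompose a [:0, 0, 1:]) = 2 * degree a" for a :: "'a poly" by (simp add: degree_pcompose)
  have 2: "pcompose a [:0, 0, 1:] = 0 \<longleftrightarrow> a = 0" for a :: "'a poly" by (rule pcompose_eq_0_iff) simp
  have 3: "degree (monom 1 ?d * pcompose b [:0, 0, 1:]) = ?d + 2 * degree b" if "b \<noteq> 0" for b :: "'a poly"
    using that 2[of b] by (simp add: degree_mult_eq degree_monom_eq 1)
  have 4: "degree (P * b ^ 2) = ?d + 2 * degree b" if "b \<noteq> 0" for b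
    using that by (simp add: degree_mult_eq degree_power_eq)
  have 5: "degree (a ^ 2) = 2 * degree a" for a :: "'a poly" by (cases "a = 0") (simp_all add: degree_power_eq)
  have *: "degree (twist (elt a b)) = degree (nm (elt a b)) \<and> (twist (elt a b) = 0 \<longleftrightarrow> a = 0 \<and> b = 0)
     \<and> (nm (elt a b) = 0 \<longleftrightarrow> a = 0 \<and> b = 0)" for a b
  proof -
    have ne: "2 * degree a \<noteq> ?d + 2 * degree b" using odd_deg by presburger
    note A = degree_add_cong[of "pcompose a [:0, 0, 1:]" "a ^ 2" "monom 1 ?d * pcompose b [:0, 0, 1:]" "P * b ^ 2"]
    note B = degree_add_cong[of "a ^ 2" "pcompose a [:0, 0, 1:]" "P * b ^ 2" "monom 1 ?d * pcompose b [:0, 0, 1:]"]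
    have "degree (monom 1 ?d * pcompose b [:0, 0, 1:]) = degree (P * b ^ 2)" using 3 4 by (cases "b = 0") auto
    then show ?thesis using A B 1 2 3 4 5 ne unfolding twist_elt nm_elt by (cases "b = 0") auto
  qed
  show "degree (twist z) = degree (nm z)" "twist z = 0 \<longleftrightarrow> z = 0" "nm z = 0 \<longleftrightarrow> z = 0" if zO: "z \<in> order_ring"
  proof -
    obtain a b where z: "z = elt a b" using zO by (rule order_ringE)
    show "degree (twist z) = degree (nm z)" "twist z = 0 \<longleftrightarrow> z = 0" "nm z = 0 \<longleftrightarrow> z = 0"
      unfolding z elt_eq_0_iff using *[of a b] by blast+
  qed
qed

lemma twist_inj: "inj_on twist order_ring"
proof (rule inj_onI)
  fix x y assume xy: "x \<in> order_ring" "y \<in> order_ring" "twist x = twist y"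
  have m: "- y \<in> order_ring" using xy minus_mem by blast
  have "twist (x + - y) = twist x + twist (- y)" using xy m by (intro twist_add)
  moreover have "twist (y + - y) = twist y + twist (- y)" using xy m by (intro twist_add)
  moreover have "twist (y + - y) = 0" using twist_eq_0_iff[of 0] by simp
  ultimately have "twist (x + - y) = 0" using xy(3) by simp
  then have "x + - y = 0" using twist_eq_0_iff[OF add_mem[OF xy(1) m]] by simp
  then show "x = y" by simp
qed

definition ideals :: "'l set set" where
  "ideals = {I. I \<subseteq> order_ring \<and> 0 \<in> I \<and> (\<forall>x\<in>I. \<forall>y\<in>I. x + y \<in> I) \<and> (\<forall>x\<in>I. \<forall>s\<in>order_ring. s * x \<in> I) \<and> I \<noteq> {0}}"

lemma ideals_D:
  assumes "I \<in> ideals"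
  shows "x \<in> I \<Longrightarrow> x \<in> order_ring" "0 \<in> I" "x \<in> I \<Longrightarrow> y \<in> I \<Longrightarrow> x + y \<in> I"
    "x \<in> I \<Longrightarrow> s \<in> order_ring \<Longrightarrow> s * x \<in> I" "\<exists>x\<in>I. x \<noteq> 0"
  using assms unfolding ideals_def by blast+

lemma ideals_minus: "I \<in> ideals \<Longrightarrow> x \<in> I \<Longrightarrow> - x \<in> I"
  using ideals_D(4)[of I x "- 1"] minus_mem[OF one_mem] by simp

lemma ideals_diff: "I \<in> ideals \<Longrightarrow> x \<in> I \<Longrightarrow> y \<in> I \<Longrightarrow> x - y \<in> I"
  using ideals_D(3)[of I x "- y"] ideals_minus by simp

definition std_ideal :: "'a poly \<Rightarrow> 'a poly \<Rightarrow> 'a poly \<Rightarrow> 'l set" where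
  "std_ideal c a b = {elt (c * (u * a + v * b)) (c * v) |u v. True}"

lemma std_ideal_in_ideals:
  assumes "c \<noteq> 0" "a \<noteq> 0" "a dvd b ^ 2 + P"
  shows "std_ideal c a b \<in> ideals"
proof -
  obtain a' where a': "b ^ 2 + P = a * a'" using assms(3) by (rule dvdE)
  have "s * x \<in> std_ideal c a b" if xs: "x \<in> std_ideal c a b" "s \<in> order_ring" for x s
  proof -
    obtain u v where x: "x = elt (c * (u * a + v * b)) (c * v)" using xs(1) by (auto simp: std_ideal_def)
    obtain r t where s: "s = elt r t" using xs(2) by (rule order_ringE)
    have P: "P = a * a' - b ^ 2" using a' by (simp add: algebra_simps)
    have "s * x = elt (c * ((r * u - t * (v * a' + u * b)) * a + (r * v + t * (u * a + v * b)) * b)) (c * (r * v + t * (u * a + v * b)))"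
      unfolding x s elt_mult elt_eq_iff P by (simp add: algebra_simps power2_eq_square)
    then show ?thesis unfolding std_ideal_def by blast
  qed
  moreover have "x + y \<in> std_ideal c a b" if xy: "x \<in> std_ideal c a b" "y \<in> std_ideal c a b" for x y
  proof -
    obtain u v u' v' where "x = elt (c * (u * a + v * b)) (c * v)" "y = elt (c * (u' * a + v' * b)) (c * v')"
      using xy by (auto simp: std_ideal_def)
    then have "x + y = elt (c * ((u + u') * a + (v + v') * b)) (c * (v + v'))"
      by (simp add: elt_add elt_eq_iff algebra_simps)
    then show ?thesis unfolding std_ideal_def by blast
  qed
  moreover have "elt (c * (0 * a + 0 * b)) (c * 0) \<in> std_ideal c a b" "elt (c * (1 * a + 0 * b)) (c * 0) \<in> std_ideal c a b"
    unfolding std_ideal_def by blast+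
  then have "0 \<in> std_ideal c a b" "elt (c * a) 0 \<in> std_ideal c a b" by (simp_all add: elt_0)
  moreover have "elt (c * a) 0 \<noteq> 0" using assms by (simp add: elt_eq_0_iff)
  moreover have "std_ideal c a b \<subseteq> order_ring" by (auto simp: std_ideal_def)
  ultimately show ?thesis unfolding ideals_def by auto
qed

lemma ideal_eq_std_ideal:
  assumes I: "I \<in> ideals"
  obtains c a b where "lead_coeff c = 1" "lead_coeff a = 1" "b \<in> polys_below (degree a)" "a dvd b ^ 2 + P"
    "I = std_ideal c a b"
proof -
  note D = ideals_D[OF I]
  obtain x0 where x0: "x0 \<in> I" "x0 \<noteq> 0" using D(5) by blast
  have x0O: "x0 \<in> order_ring" using D(1) x0 by blast
  have nI: "elt (nm x0) 0 \<in> I"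
    using D(4)[OF x0(1) cj_mem[of x0]] mult_cj[OF x0O] by (simp add: elt_real mult.commute)
  have n0: "nm x0 \<noteq> 0" using nm_eq_0_iff[OF x0O] x0 by simp
  have wm: "elt (- P * b) a \<in> I" if "elt a b \<in> I" for a b
    using D(4)[OF that elt_mem[of 0 1]] by (simp add: elt_mult)
  have sm: "elt (s * a) (s * b) \<in> I" if "elt a b \<in> I" for s a b
    using D(4)[OF that elt_mem[of s 0]] by (simp add: elt_mult)
  have am: "elt (a + a') (b + b') \<in> I" if "elt a b \<in> I" "elt a' b' \<in> I" for a b a' b'
    using D(3)[OF that] by (simp add: elt_add)
  have dm: "elt (a - a') (b - b') \<in> I" if "elt a b \<in> I" "elt a' b' \<in> I" for a b a' b'
    using ideals_diff[OF I that] by (simp add: elt_diff)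
  obtain c where c: "c \<in> {y. \<exists>x. elt x y \<in> I}" "lead_coeff c = 1" "\<And>y. y \<in> {y. \<exists>x. elt x y \<in> I} \<Longrightarrow> c dvd y"
  proof (rule poly_ideal_generator[of "{y. \<exists>x. elt x y \<in> I}" "nm x0"])
    show "x + y \<in> {y. \<exists>x. elt x y \<in> I}" if "x \<in> {y. \<exists>x. elt x y \<in> I}" "y \<in> {y. \<exists>x. elt x y \<in> I}" for x y
      using that am by blast
    show "s * x \<in> {y. \<exists>x. elt x y \<in> I}" if "x \<in> {y. \<exists>x. elt x y \<in> I}" for x s using that sm by blast
    show "nm x0 \<in> {y. \<exists>x. elt x y \<in> I}" using wm[OF nI] by auto
  qed (use n0 in auto)
  obtain b0 where b0: "elt b0 c \<in> I" using c(1) by blast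
  obtain a0 where a0: "a0 \<in> {x. elt x 0 \<in> I}" "lead_coeff a0 = 1" "\<And>x. x \<in> {x. elt x 0 \<in> I} \<Longrightarrow> a0 dvd x"
  proof (rule poly_ideal_generator[of "{x. elt x 0 \<in> I}" "nm x0"])
    show "x + y \<in> {x. elt x 0 \<in> I}" if "x \<in> {x. elt x 0 \<in> I}" "y \<in> {x. elt x 0 \<in> I}" for x y
      using that am[of x 0 y 0] by auto
    show "s * x \<in> {x. elt x 0 \<in> I}" if "x \<in> {x. elt x 0 \<in> I}" for x s using that sm[of x 0 s] by auto
  qed (use n0 nI in auto)
  have c0: "c \<noteq> 0" using c(2) by auto
  have "c dvd a0" using wm[of a0 0] a0(1) c(3)[of a0] by auto
  then obtain a where a: "a0 = c * a" by (rule dvdE)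
  have a_nz: "a \<noteq> 0" using a a0(2) by auto
  have lca: "lead_coeff a = 1" using a a0(2) c(2) by (simp add: lead_coeff_mult)
  have "c dvd b0" using wm[OF b0] c(3)[of b0] by auto
  then obtain b1 where b1: "b0 = c * b1" by (rule dvdE)
  define b where "b = b1 mod a"
  have bI: "elt (c * b) c \<in> I"
  proof -
    have "c * b = c * b1 - (b1 div a) * a0" unfolding b_def a by (simp add: algebra_simps flip: minus_div_mult_eq_mod)
    then show ?thesis using dm[OF b0 sm[of a0 0 "b1 div a"]] a0(1) b1 by simp
  qed
  have "elt (b * (c * b) - (- P * c)) (b * c - c * b) \<in> I" using dm[OF sm[OF bI, of b] wm[OF bI]] .
  then have "a0 dvd b * (c * b) - (- P * c)" using a0(3) by (simp add: mult.commute)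
  then have "c * a dvd c * (b ^ 2 + P)" unfolding a by (simp add: algebra_simps power2_eq_square)
  then have dvd: "a dvd b ^ 2 + P" using c0 by simp
  have "I = std_ideal c a b"
  proof (intro equalityI subsetI)
    fix z assume z: "z \<in> I"
    obtain x y where [simp]: "z = elt x y" using D(1)[OF z] by (rule order_ringE)
    have "c dvd y" using z c(3) by auto
    then obtain v where v: "y = c * v" by (rule dvdE)
    have "elt (x - v * (c * b)) (y - v * c) \<in> I" using dm[of x y "v * (c * b)" "v * c"] z sm[OF bI] by simp
    then have "a0 dvd x - v * (c * b)" using a0(3) v by (simp add: mult.commute)
    then obtain u where "x - v * (c * b) = a0 * u" by (rule dvdE)
    then have "x = c * (u * a + v * b)" by (simp add: a algebra_simps)
    then show "z \<in> std_ideal c a b" unfolding std_ideal_def using v by auto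
  next
    fix z assume "z \<in> std_ideal c a b"
    then obtain u v where z: "z = elt (c * (u * a + v * b)) (c * v)" by (auto simp: std_ideal_def)
    have "elt (u * a0 + v * (c * b)) (u * 0 + v * c) \<in> I" using am[OF sm[of a0 0 u] sm[OF bI, of v]] a0(1) by simp
    then show "z \<in> I" unfolding z a by (simp add: algebra_simps)
  qed
  moreover have "b \<in> polys_below (degree a)" unfolding b_def by (rule mod_mem_polys_below[OF a_nz])
  ultimately show thesis using that c(2) lca dvd by blast
qed

lemma std_ideal_inj:
  assumes "lead_coeff c = 1" "lead_coeff a = 1" "b \<in> polys_below (degree a)"
    and "lead_coeff c' = 1" "lead_coeff a' = 1" "b' \<in> polys_below (degree a')"
    and eq: "std_ideal c a b = std_ideal c' a' b'"
  shows "c = c' \<and> a = a' \<and> b = b'"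
proof -
  have mem: "elt (c * a) 0 \<in> std_ideal c a b" "elt (c * b) c \<in> std_ideal c a b" for c a b
    unfolding std_ideal_def by (rule CollectI, rule exI[of _ 1], rule exI[of _ 0], simp)
      (rule CollectI, rule exI[of _ 0], rule exI[of _ 1], simp)
  have dv: "c' dvd c \<and> (c = c' \<longrightarrow> a' dvd a \<and> (a = a' \<longrightarrow> a dvd b - b'))"
    if eq': "std_ideal c a b = std_ideal c' a' b'" and "c \<noteq> 0" for c a b c' a' b'
  proof -
    obtain u v where 1: "elt (c * b) c = elt (c' * (u * a' + v * b')) (c' * v)"
      using mem(2)[of c b a] unfolding eq' unfolding std_ideal_def by blast
    obtain u' v' where 2: "elt (c * a) 0 = elt (c' * (u' * a' + v' * b')) (c' * v')"
      using mem(1)[of c a b] unfolding eq' unfolding std_ideal_def by blast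
    have "c' dvd c" using 1 by (auto simp: elt_eq_iff)
    moreover have "a' dvd a \<and> (a = a' \<longrightarrow> a dvd b - b')" if "c = c'"
    proof -
      have "v' = 0" "v = 1" using 1 2 \<open>c \<noteq> 0\<close> that by (auto simp: elt_eq_iff)
      then have "a = u' * a'" "b - b' = u * a'" using 1 2 \<open>c \<noteq> 0\<close> that by (auto simp: elt_eq_iff)
      then show ?thesis by auto
    qed
    ultimately show ?thesis by blast
  qed
  have nz: "c \<noteq> 0" "c' \<noteq> 0" using assms by auto
  have c: "c = c'" using dv[OF eq nz(1)] dv[OF eq[symmetric] nz(2)] monic_dvd_antisym assms by blast
  have a: "a = a'" using dv[OF eq nz(1)] dv[OF eq[symmetric] nz(2)] monic_dvd_antisym assms c by blast
  have "a dvd b - b'" using dv[OF eq nz(1)] c a by blast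
  moreover have "b - b' \<in> polys_below (degree a)" using assms a by (simp add: polys_below_def)
  ultimately have "b - b' = 0" by (auto simp: mem_polys_below dest: dvd_imp_degree_le)
  then show ?thesis using c a by simp
qed

definition ideals_of_degree :: "nat \<Rightarrow> 'l set set" where
  "ideals_of_degree n = (\<lambda>(c, a, b). std_ideal c a b) ` ideal_data P n"

lemma card_ideals_of_degree: "card (ideals_of_degree n) = card (ideal_data P n)"
  unfolding ideals_of_degree_def
proof (rule card_image, rule inj_onI)
  fix x y assume xy: "x \<in> ideal_data P n" "y \<in> ideal_data P n"
    "(case x of (c, a, b) \<Rightarrow> std_ideal c a b) = (case y of (c, a, b) \<Rightarrow> std_ideal c a b)"
  obtain c a b c' a' b' where [simp]: "x = (c, a, b)" "y = (c', a', b')" by (cases x, cases y) auto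
  show "x = y" using xy std_ideal_inj[of c a b c' a' b'] by (simp add: ideal_data_def)
qed

lemma finite_ideals_of_degree [simp]: "finite (ideals_of_degree n)"
  by (simp add: ideals_of_degree_def)

lemma ideals_of_degree_subset: "ideals_of_degree n \<subseteq> ideals"
  unfolding ideals_of_degree_def by (auto simp: ideal_data_def intro!: std_ideal_in_ideals)

lemma ideals_eq: "ideals = (\<Union>n. ideals_of_degree n)"
proof (intro equalityI subsetI)
  fix I assume "I \<in> ideals"
  then obtain c a b where *: "lead_coeff c = 1" "lead_coeff a = 1" "b \<in> polys_below (degree a)" "a dvd b ^ 2 + P"
    "I = std_ideal c a b" by (rule ideal_eq_std_ideal)
  then have "(c, a, b) \<in> ideal_data P (2 * degree c + degree a)" by (simp add: ideal_data_def)
  then show "I \<in> (\<Union>n. ideals_of_degree n)" unfolding ideals_of_degree_def using *(5) by force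
qed (use ideals_of_degree_subset in auto)

end

lemma card_subspace_level:
  fixes W :: "'a::{finite,field} poly set"
  assumes add: "\<And>x y. x \<in> W \<Longrightarrow> y \<in> W \<Longrightarrow> x + y \<in> W" and smult: "\<And>c x. x \<in> W \<Longrightarrow> smult c x \<in> W"
    and p0: "p0 \<in> W" "p0 \<noteq> 0" "degree p0 = M"
  shows "card {p \<in> W. p \<noteq> 0 \<and> degree p = M} = (CARD('a) - 1) * (1 + (\<Sum>m<M. card {p \<in> W. p \<noteq> 0 \<and> degree p = m}))"
proof -
  let ?L = "\<lambda>m. {p \<in> W. p \<noteq> 0 \<and> degree p = m}"
  have c0: "coeff p0 M \<noteq> 0" using p0 by auto
  have diff: "x - y \<in> W" if "x \<in> W" "y \<in> W" for x y using add[OF that(1) smult[OF that(2), of "- 1"]] by simp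
  have L: "p \<in> ?L M \<longleftrightarrow> p \<in> W \<and> p \<in> polys_below (Suc M) \<and> coeff p M \<noteq> 0" for p
  proof -
    have "p \<noteq> 0 \<and> degree p = M \<longleftrightarrow> p \<in> polys_below (Suc M) \<and> coeff p M \<noteq> 0"
      by (auto simp: mem_polys_below le_antisym[OF _ le_degree])
    then show ?thesis by blast
  qed
  have "bij_betw (\<lambda>(c, y). smult c p0 + y) ((UNIV - {0}) \<times> (W \<inter> polys_below M)) (?L M)"
  proof (rule bij_betwI[where g = "\<lambda>p. (coeff p M / coeff p0 M, p - smult (coeff p M / coeff p0 M) p0)"])
    have p0b: "p0 \<in> polys_below (Suc M)" using p0 by (simp add: mem_polys_below)
    show "(\<lambda>(c, y). smult c p0 + y) \<in> (UNIV - {0}) \<times> (W \<inter> polys_below M) \<rightarrow> ?L M"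
    proof (rule Pi_I)
      fix x :: "'a \<times> 'a poly" assume x: "x \<in> (UNIV - {0}) \<times> (W \<inter> polys_below M)"
      obtain c y where cy: "x = (c, y)" by (cases x)
      then have "smult c p0 + y \<in> W" "smult c p0 + y \<in> polys_below (Suc M)" "coeff (smult c p0 + y) M \<noteq> 0"
        using x add smult p0(1) p0b c0 by (auto simp: polys_below_def)
      then show "(case x of (c, y) \<Rightarrow> smult c p0 + y) \<in> ?L M" unfolding L cy prod.case by blast
    qed
    show "(\<lambda>p. (coeff p M / coeff p0 M, p - smult (coeff p M / coeff p0 M) p0)) \<in> ?L M \<rightarrow> (UNIV - {0}) \<times> (W \<inter> polys_below M)"
    proof
      fix p assume "p \<in> ?L M"
      then have p: "p \<in> W" "p \<in> polys_below (Suc M)" "coeff p M \<noteq> 0" unfolding L by auto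
      have "coeff (p - smult (coeff p M / coeff p0 M) p0) i = 0" if "i \<ge> M" for i
        using that p p0b c0 by (cases "i = M") (auto simp: polys_below_def)
      then have "p - smult (coeff p M / coeff p0 M) p0 \<in> polys_below M" unfolding polys_below_def by blast
      moreover have "coeff p M / coeff p0 M \<noteq> 0" using p(3) c0 by simp
      ultimately show "(coeff p M / coeff p0 M, p - smult (coeff p M / coeff p0 M) p0) \<in> (UNIV - {0}) \<times> (W \<inter> polys_below M)"
        using diff[OF p(1) smult[OF p0(1)]]
        by (simp only: mem_Sigma_iff Int_iff Diff_iff UNIV_I singleton_iff simp_thms)
    qed
    show "(\<lambda>p. (coeff p M / coeff p0 M, p - smult (coeff p M / coeff p0 M) p0)) ((\<lambda>(c, y). smult c p0 + y) x) = x"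
      if "x \<in> (UNIV - {0}) \<times> (W \<inter> polys_below M)" for x
      using that c0 by (auto simp: polys_below_def)
  qed (use c0 in auto)
  from bij_betw_same_card[OF this, symmetric]
  have "card (?L M) = card ((UNIV - {0::'a}) \<times> (W \<inter> polys_below M))" .
  also have "\<dots> = (CARD('a) - 1) * card (W \<inter> polys_below M)" by (simp add: card_cartesian_product card_Diff_singleton)
  also have "W \<inter> polys_below M = insert 0 (\<Union>m<M. ?L m)"
    using smult[OF p0(1), of 0] by (auto simp: mem_polys_below)
  also have "card \<dots> = 1 + card (\<Union>m<M. ?L m)"
  proof -
    have "(\<Union>m<M. ?L m) \<subseteq> polys_below M" by (auto simp: mem_polys_below)
    then have "finite (\<Union>m<M. ?L m)" by (rule finite_subset) simp
    then show ?thesis by simp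
  qed
  also have "card (\<Union>m<M. ?L m) = (\<Sum>m<M. card (?L m))"
  proof (rule card_UN_disjoint)
    have "?L m \<subseteq> polys_below (Suc m)" for m by (auto simp: mem_polys_below)
    then show "\<forall>i\<in>{..<M}. finite (?L i)" using finite_subset finite_polys_below by blast
  qed auto
  finally show ?thesis .
qed

context quadratic_order begin

text \<open>
  The product of \<open>I\<close> and its conjugate is the principal ideal generated by \<open>n\<close>. Quantifying over all
  additively closed \<open>K\<close> replaces the finite sums of products.
\<close>

definition norm_generator :: "'l set \<Rightarrow> 'a poly \<Rightarrow> bool" where
  "norm_generator I n \<longleftrightarrow> (\<forall>x\<in>I. \<forall>y\<in>I. \<exists>s\<in>order_ring. x * cj y = \<iota> n * s) \<and>
     (\<forall>K. (\<forall>x\<in>K. \<forall>y\<in>K. x + y \<in> K) \<longrightarrow> (\<forall>x\<in>I. \<forall>y\<in>I. x * cj y \<in> K) \<longrightarrow> \<iota> n \<in> K)"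

lemma norm_generatorD1: "norm_generator I n \<Longrightarrow> x \<in> I \<Longrightarrow> y \<in> I \<Longrightarrow> \<exists>s\<in>order_ring. x * cj y = \<iota> n * s"
  by (simp add: norm_generator_def)

lemma norm_generatorD2:
  assumes "norm_generator I n" "\<And>x y. x \<in> K \<Longrightarrow> y \<in> K \<Longrightarrow> x + y \<in> K" "\<And>x y. x \<in> I \<Longrightarrow> y \<in> I \<Longrightarrow> x * cj y \<in> K"
  shows "\<iota> n \<in> K"
  using assms(1)[unfolded norm_generator_def, THEN conjunct2, THEN spec[of _ K]] assms(2,3) by blast

lemma std_ideal_coprime_coefficients:
  assumes a': "b ^ 2 + P = a * a'"
  obtains r s t where "r * a + s * b + t * a' = 1"
proof -
  obtain u v where g: "(u * a + v * b) dvd a" "(u * a + v * b) dvd b" by (rule field_poly_bezout)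
  obtain u' v' where h: "(u' * (u * a + v * b) + v' * a') dvd (u * a + v * b)" "(u' * (u * a + v * b) + v' * a') dvd a'"
    by (rule field_poly_bezout)
  define h where "h = u' * (u * a + v * b) + v' * a'"
  have hd: "h dvd a" "h dvd b" "h dvd a'" using g h dvd_trans unfolding h_def by blast+
  have "h * h dvd a * a' - b * b" using hd by (intro dvd_diff mult_dvd_mono)
  also have "a * a' - b * b = P" using a' by (simp add: algebra_simps power2_eq_square)
  finally obtain k where "P = h * h * k" by (rule dvdE)
  then have k: "P = h * (h * k)" by (simp only: mult.assoc)
  then have "is_unit h \<or> is_unit (h * k)" using irr irreducibleD by blast
  then have "is_unit h" by (auto dest: dvd_mult_left)
  then obtain z where "1 = h * z" by (rule dvdE)
  then have "(z * u' * u) * a + (z * u' * v) * b + (z * v') * a' = 1" unfolding h_def by (simp add: algebra_simps)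
  then show thesis by (rule that)
qed

lemma norm_generator_std_ideal:
  assumes "a dvd b ^ 2 + P"
  shows "norm_generator (std_ideal c a b) (c ^ 2 * a)"
  unfolding norm_generator_def
proof (intro conjI ballI allI impI)
  obtain a' where a': "b ^ 2 + P = a * a'" using assms by (rule dvdE)
  have P: "P = a * a' - b ^ 2" using a' by (simp add: algebra_simps)
  show "\<exists>s\<in>order_ring. x * cj y = \<iota> (c ^ 2 * a) * s" if xy: "x \<in> std_ideal c a b" "y \<in> std_ideal c a b" for x y
  proof -
    obtain u v u' v' where x: "x = elt (c * (u * a + v * b)) (c * v)" and y: "y = elt (c * (u' * a + v' * b)) (c * v')"
      using xy unfolding std_ideal_def by blast
    have "x * cj y = elt (c ^ 2 * a) 0 * elt (u * u' * a + b * (u * v' + v * u') + v * v' * a') (v * u' - u * v')"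
      unfolding x y cj_elt elt_mult elt_eq_iff P by (simp add: algebra_simps power2_eq_square)
    then show ?thesis unfolding elt_real using elt_mem by blast
  qed
  fix K assume add: "\<forall>x\<in>K. \<forall>y\<in>K. x + y \<in> K" and K: "\<forall>x\<in>std_ideal c a b. \<forall>y\<in>std_ideal c a b. x * cj y \<in> K"
  obtain r s t where rst: "r * a + s * b + t * a' = 1" using a' by (rule std_ideal_coprime_coefficients)
  define s2 where "s2 = smult (1 / 2) s"
  have s2: "s2 + s2 = s" using two_neq_0 by (simp add: s2_def flip: smult_add_left)
  have mem: "elt (c * (u * a + v * b)) (c * v) \<in> std_ideal c a b" for u v by (auto simp: std_ideal_def)
  have A: "elt (c * (r * a)) 0 \<in> std_ideal c a b" "elt (c * a) 0 \<in> std_ideal c a b" "elt (c * (s2 * a)) 0 \<in> std_ideal c a b"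
    "elt (c * b) c \<in> std_ideal c a b" "elt (c * (s2 * b)) (c * s2) \<in> std_ideal c a b" "elt (c * (t * b)) (c * t) \<in> std_ideal c a b"
    using mem[of r 0] mem[of 1 0] mem[of s2 0] mem[of 0 1] mem[of 0 s2] mem[of 0 t] by simp_all
  have "elt (c * (r * a)) 0 * cj (elt (c * a) 0) + (elt (c * (s2 * a)) 0 * cj (elt (c * b) c) +
     (elt (c * (s2 * b)) (c * s2) * cj (elt (c * a) 0) + elt (c * (t * b)) (c * t) * cj (elt (c * b) c))) \<in> K" (is "?x \<in> K")
    using A K add by blast
  also have "?x = elt (c ^ 2 * a * (r * a + (s2 + s2) * b + t * a')) 0"
    unfolding cj_elt elt_mult elt_add elt_eq_iff P by (simp add: algebra_simps power2_eq_square)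
  finally show "\<iota> (c ^ 2 * a) \<in> K" unfolding s2 rst by (simp add: elt_real)
qed

lemma ideals_of_degreeE:
  assumes "I \<in> ideals_of_degree k"
  obtains c a b where "I = std_ideal c a b" "lead_coeff c = 1" "lead_coeff a = 1" "b \<in> polys_below (degree a)"
    "a dvd b ^ 2 + P" "2 * degree c + degree a = k" "norm_generator I (c ^ 2 * a)" "degree (c ^ 2 * a) = k" "c ^ 2 * a \<noteq> 0"
proof -
  obtain c a b where 1: "(c, a, b) \<in> ideal_data P k" "I = std_ideal c a b" using assms by (auto simp: ideals_of_degree_def)
  then have 2: "lead_coeff c = 1" "lead_coeff a = 1" "b \<in> polys_below (degree a)" "a dvd b ^ 2 + P" "2 * degree c + degree a = k"
    by (auto simp: ideal_data_def)
  then have "c \<noteq> 0" "a \<noteq> 0" by auto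
  then have "degree (c ^ 2 * a) = k" "c ^ 2 * a \<noteq> 0" using 2 by (simp_all add: degree_mult_eq degree_power_eq)
  with 1 2 show thesis using that norm_generator_std_ideal by blast
qed

lemma norm_dvd:
  assumes I: "I \<in> ideals" and J: "J \<in> ideals" and n: "norm_generator I n" and m: "norm_generator J m"
    and x: "x \<in> order_ring" and y: "y \<in> order_ring" and eq: "(*) x ` I = (*) y ` J"
  shows "nm y * m dvd nm x * n"
proof -
  let ?K = "{k. \<exists>s\<in>order_ring. \<iota> (nm x) * k = \<iota> (nm y * m) * s}"
  have "\<iota> n \<in> ?K"
  proof (rule norm_generatorD2[OF n])
    fix k l assume "k \<in> ?K" "l \<in> ?K"
    then obtain s t where "s \<in> order_ring" "t \<in> order_ring" "\<iota> (nm x) * k = \<iota> (nm y * m) * s" "\<iota> (nm x) * l = \<iota> (nm y * m) * t"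
      by blast
    then have "s + t \<in> order_ring" "\<iota> (nm x) * (k + l) = \<iota> (nm y * m) * (s + t)" by (simp_all add: add_mem distrib_left)
    then show "k + l \<in> ?K" by blast
  next
    fix i j assume ij: "i \<in> I" "j \<in> I"
    obtain z where z: "z \<in> J" "x * i = y * z" using eq ij(1) by blast
    obtain t where t: "t \<in> J" "x * j = y * t" using eq ij(2) by blast
    have O: "i \<in> order_ring" "j \<in> order_ring" "z \<in> order_ring" "t \<in> order_ring"
      using ideals_D(1)[OF I] ideals_D(1)[OF J] ij z t by auto
    obtain s where s: "s \<in> order_ring" "z * cj t = \<iota> m * s" using norm_generatorD1[OF m z(1) t(1)] by blast
    have "\<iota> (nm x) * (i * cj j) = (x * i) * (cj x * cj j)" using mult_cj[OF x] by (simp add: ac_simps)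
    also have "cj x * cj j = cj (x * j)" using cj_mult x O by simp
    also have "(x * i) * cj (x * j) = (y * z) * (cj y * cj t)" using z t cj_mult y O by simp
    also have "\<dots> = (y * cj y) * (z * cj t)" by (simp add: ac_simps)
    also have "\<dots> = \<iota> (nm y * m) * s" unfolding mult_cj[OF y] s(2) by (simp add: \<iota>_mult)
    finally show "i * cj j \<in> ?K" using s(1) by blast
  qed
  then obtain s where s: "s \<in> order_ring" "\<iota> (nm x) * \<iota> n = \<iota> (nm y * m) * s" by blast
  obtain a b where "s = elt a b" using s(1) by (rule order_ringE)
  then have "elt (nm x * n) 0 = elt (nm y * m * a) (nm y * m * b)" using s(2)
    by (simp add: elt_mult elt_real flip: \<iota>_mult) (simp add: elt_mult flip: elt_real)
  then have "nm x * n = nm y * m * a" by (simp add: elt_eq_iff)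
  then show ?thesis by simp
qed

lemma degree_norm_eq:
  assumes I: "I \<in> ideals_of_degree k" and J: "J \<in> ideals_of_degree l"
    and x: "x \<in> order_ring" "x \<noteq> 0" and y: "y \<in> order_ring" "y \<noteq> 0" and eq: "(*) x ` I = (*) y ` J"
  shows "degree (nm x) + k = degree (nm y) + l"
proof -
  obtain n where n: "norm_generator I n" "degree n = k" "n \<noteq> 0" using I
    by (elim ideals_of_degreeE) blast
  obtain m where m: "norm_generator J m" "degree m = l" "m \<noteq> 0" using J
    by (elim ideals_of_degreeE) blast
  have II: "I \<in> ideals" "J \<in> ideals" using I J ideals_of_degree_subset by auto
  have nz: "nm x * n \<noteq> 0" "nm y * m \<noteq> 0" using n m nm_eq_0_iff x y by auto
  have "degree (nm x * n) = degree (nm y * m)"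
    using norm_dvd[OF II n(1) m(1) x(1) y(1) eq] norm_dvd[OF II(2,1) m(1) n(1) y(1) x(1) eq[symmetric]] nz
    by (meson dvd_imp_degree_le le_antisym)
  then show ?thesis using n m nz by (simp add: degree_mult_eq)
qed

definition class_rel :: "('l set \<times> 'l set) set" where
  "class_rel = {(I, J). I \<in> ideals \<and> J \<in> ideals \<and>
     (\<exists>a \<in> order_ring - {0}. \<exists>b \<in> order_ring - {0}. (*) a ` I = (*) b ` J)}"

lemma class_relI:
  assumes "I \<in> ideals" "J \<in> ideals" "a \<in> order_ring" "a \<noteq> 0" "b \<in> order_ring" "b \<noteq> 0" "(*) a ` I = (*) b ` J"
  shows "(I, J) \<in> class_rel"
  using assms unfolding class_rel_def by blast

lemma class_relE:
  assumes "(I, J) \<in> class_rel"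
  obtains a b where "I \<in> ideals" "J \<in> ideals" "a \<in> order_ring" "a \<noteq> 0" "b \<in> order_ring" "b \<noteq> 0" "(*) a ` I = (*) b ` J"
  using assms unfolding class_rel_def by blast

lemma image_mult_assoc: "(*) a ` (*) b ` I = (*) (a * b) ` (I :: 'l set)"
  by (simp add: image_image mult.assoc)

lemma equiv_class_rel: "equiv ideals class_rel"
proof (rule equivI)
  show "class_rel \<subseteq> ideals \<times> ideals" by (auto simp: class_rel_def)
  show "refl_on ideals class_rel" by (rule refl_onI) (rule class_relI[where a = 1 and b = 1], auto)
  show "sym class_rel" by (rule symI) (erule class_relE, rule class_relI[OF _ _ _ _ _ _ sym])
  show "trans class_rel"
  proof (rule transI)
    fix I J K assume "(I, J) \<in> class_rel" "(J, K) \<in> class_rel"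
    from this(1) obtain a b where ab: "I \<in> ideals" "a \<in> order_ring" "a \<noteq> 0" "b \<in> order_ring" "b \<noteq> 0"
      "(*) a ` I = (*) b ` J" by (rule class_relE)
    from \<open>(J, K) \<in> class_rel\<close> obtain c d where cd: "K \<in> ideals" "c \<in> order_ring" "c \<noteq> 0" "d \<in> order_ring" "d \<noteq> 0"
      "(*) c ` J = (*) d ` K" by (rule class_relE)
    have "(*) (c * a) ` I = (*) c ` (*) b ` J" unfolding image_mult_assoc[symmetric] ab(6) ..
    also have "\<dots> = (*) b ` (*) c ` J" unfolding image_mult_assoc by (simp only: mult.commute)
    also have "\<dots> = (*) (b * d) ` K" unfolding cd(6) image_mult_assoc ..
    finally show "(I, K) \<in> class_rel" using ab cd
      by (intro class_relI[where a = "c * a" and b = "b * d"] mult_mem) auto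
  qed
qed

lemma norm_degree_0:
  assumes "z \<in> order_ring" "z \<noteq> 0" "degree (nm z) = 0"
  obtains c where "c \<noteq> 0" "z = \<iota> [:c:]"
proof -
  obtain a b where z: "z = elt a b" using assms(1) by (rule order_ringE)
  have d: "degree (P * b ^ 2) = degree P + 2 * degree b" if "b \<noteq> 0"
    using that by (simp add: degree_mult_eq degree_power_eq)
  have ne: "degree (a ^ 2) \<noteq> degree P + 2 * degree b"
  proof (cases "a = 0")
    case False
    then have "even (degree (a ^ 2))" by (simp add: degree_power_eq)
    then show ?thesis using odd_deg by auto
  qed (use deg_pos in simp)
  have "b = 0"
  proof (rule ccontr)
    assume b: "b \<noteq> 0"
    have "degree (a ^ 2 + P * b ^ 2) > 0"
      using ne d[OF b] deg_pos by (cases "degree (a ^ 2) < degree (P * b ^ 2)")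
       (auto simp: degree_add_eq_left degree_add_eq_right)
    then show False using assms(3) by (simp add: z)
  qed
  then have "a \<noteq> 0" "degree a = 0" using assms by (auto simp: z elt_eq_0_iff degree_power_eq)
  then obtain c where "a = [:c:]" "c \<noteq> 0" by (auto elim: degree_eq_zeroE)
  then show thesis using that \<open>b = 0\<close> by (simp add: z elt_real)
qed

end

section \<open>Counting ideals in a class\<close>

context quadratic_order begin

definition quotient_ideal :: "'l set \<Rightarrow> 'a poly \<Rightarrow> 'l \<Rightarrow> 'l set" where
  "quotient_ideal I n x = {z \<in> order_ring. \<iota> n * z \<in> (*) x ` I}"

lemma cj_ideal: assumes "I \<in> ideals" shows "cj ` I \<in> ideals"
proof -
  note D = ideals_D[OF assms]
  have "cj x + cj y \<in> cj ` I" if "x \<in> I" "y \<in> I" for x y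
    using D(3)[OF that] cj_add[of x y] D(1) that by (metis imageI)
  moreover have "s * cj x \<in> cj ` I" if "x \<in> I" "s \<in> order_ring" for x s
    using D(4)[OF that(1) cj_mem[of s]] cj_mult[of "cj s" x] cj_cj[OF that(2)] D(1)[OF that(1)] by (metis cj_mem imageI)
  moreover have "0 \<in> cj ` I" using D(2) cj_0 by (metis imageI)
  moreover obtain x where x: "x \<in> I" "x \<noteq> 0" using D(5) by blast
  then have "cj x \<noteq> 0" using cj_cj[of x] D(1)[of x] cj_0 by auto
  then have "cj ` I \<noteq> {0}" using x by auto
  ultimately show ?thesis unfolding ideals_def using D(1) by auto
qed

context
  fixes I :: "'l set" and n :: "'a poly"
  assumes I: "I \<in> ideals" and n: "norm_generator I n" "n \<noteq> 0"
begin

lemma \<iota>_norm_neq_0: "\<iota> n \<noteq> 0" using n(2) by (simp add: \<iota>_eq_0_iff)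

lemma mult_quotient_ideal:
  assumes x: "x \<in> cj ` I"
  shows "(*) (\<iota> n) ` quotient_ideal I n x = (*) x ` I"
proof (intro equalityI subsetI)
  fix z assume "z \<in> (*) x ` I"
  then obtain i where i: "i \<in> I" "z = x * i" by blast
  obtain j where j: "j \<in> I" "x = cj j" using x by blast
  obtain s where "s \<in> order_ring" "i * cj j = \<iota> n * s" using norm_generatorD1[OF n(1) i(1) j(1)] by blast
  then have "z = \<iota> n * s" "s \<in> order_ring" using i j by (simp_all add: mult.commute)
  then show "z \<in> (*) (\<iota> n) ` quotient_ideal I n x" using \<open>z \<in> (*) x ` I\<close> by (auto simp: quotient_ideal_def)
qed (auto simp: quotient_ideal_def)

lemma quotient_ideal_in_ideals:
  assumes x: "x \<in> cj ` I" "x \<noteq> 0"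
  shows "quotient_ideal I n x \<in> ideals"
proof -
  note D = ideals_D[OF I]
  have zero: "0 \<in> quotient_ideal I n x" using D(2) by (auto simp: quotient_ideal_def intro: image_eqI[of _ _ 0])
  moreover have "y + z \<in> quotient_ideal I n x" if yz: "y \<in> quotient_ideal I n x" "z \<in> quotient_ideal I n x" for y z
  proof -
    obtain i j where ij: "i \<in> I" "\<iota> n * y = x * i" "j \<in> I" "\<iota> n * z = x * j" using yz by (auto simp: quotient_ideal_def)
    then have "\<iota> n * (y + z) = x * (i + j)" by (simp add: distrib_left)
    then show ?thesis using D(3)[OF ij(1,3)] yz add_mem by (auto simp: quotient_ideal_def)
  qed
  moreover have "s * y \<in> quotient_ideal I n x" if y: "y \<in> quotient_ideal I n x" and s: "s \<in> order_ring" for s y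
  proof -
    obtain i where i: "i \<in> I" "\<iota> n * y = x * i" using y by (auto simp: quotient_ideal_def)
    then have "\<iota> n * (s * y) = x * (s * i)" by (simp add: mult.left_commute)
    then have "\<iota> n * (s * y) \<in> (*) x ` I" using D(4)[OF i(1) s] by blast
    then show ?thesis using y s mult_mem by (simp add: quotient_ideal_def)
  qed
  moreover have "quotient_ideal I n x \<noteq> {0}"
  proof
    assume "quotient_ideal I n x = {0}"
    then have "(*) x ` I = {0}" using mult_quotient_ideal[OF x(1)] by auto
    moreover obtain i where "i \<in> I" "i \<noteq> 0" using D(5) by blast
    ultimately have "x * i \<in> {0}" "i \<noteq> 0" by blast+
    then show False using x(2) by simp
  qed
  ultimately show ?thesis unfolding ideals_def by (auto simp: quotient_ideal_def)
qed

lemma quotient_ideal_class: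
  assumes x: "x \<in> cj ` I" "x \<noteq> 0"
  shows "(I, quotient_ideal I n x) \<in> class_rel"
proof (rule class_relI[where a = x and b = "\<iota> n"])
  show "x \<in> order_ring" using x(1) by auto
qed (use I quotient_ideal_in_ideals[OF x] x mult_quotient_ideal[OF x(1)] \<iota>_norm_neq_0 in auto)

lemma ex_quotient_ideal:
  assumes "(I, J) \<in> class_rel"
  obtains x where "x \<in> cj ` I" "x \<noteq> 0" "J = quotient_ideal I n x"
proof -
  obtain b a where ab: "J \<in> ideals" "b \<in> order_ring" "b \<noteq> 0" "a \<in> order_ring" "a \<noteq> 0" "(*) b ` I = (*) a ` J"
    using assms by (rule class_relE)
  note V = ideals_D[OF cj_ideal[OF I]]
  let ?K = "{k. \<exists>v\<in>cj ` I. b * k = a * v}"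
  have "\<iota> n \<in> ?K"
  proof (rule norm_generatorD2[OF n(1)])
    fix k l assume "k \<in> ?K" "l \<in> ?K"
    then obtain v v' where "v \<in> cj ` I" "v' \<in> cj ` I" "b * k = a * v" "b * l = a * v'" by blast
    then have "v + v' \<in> cj ` I" "b * (k + l) = a * (v + v')" using V(3) by (simp_all add: distrib_left)
    then show "k + l \<in> ?K" by blast
  next
    fix i i' assume i: "i \<in> I" "i' \<in> I"
    then obtain j where j: "j \<in> J" "b * i = a * j" using ab(6) by blast
    have "j \<in> order_ring" using ideals_D(1)[OF ab(1)] j by blast
    then have "j * cj i' \<in> cj ` I" using V(4)[of "cj i'" j] i by blast
    moreover have "b * (i * cj i') = a * (j * cj i')" using j(2) by (simp add: mult.assoc[symmetric])
    ultimately show "i * cj i' \<in> ?K" by blast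
  qed
  then obtain x where x: "x \<in> cj ` I" "b * \<iota> n = a * x" by blast
  have x0: "x \<noteq> 0" using x ab \<iota>_norm_neq_0 by auto
  have "(*) a ` (*) (\<iota> n) ` J = (*) (\<iota> n) ` (*) b ` I" unfolding ab(6) image_mult_assoc by (simp only: mult.commute)
  also have "\<dots> = (*) a ` (*) x ` I" unfolding image_mult_assoc using x(2) by (simp only: mult.commute)
  also have "\<dots> = (*) a ` (*) (\<iota> n) ` quotient_ideal I n x" unfolding mult_quotient_ideal[OF x(1)] ..
  finally have "(*) (a * \<iota> n) ` J = (*) (a * \<iota> n) ` quotient_ideal I n x" unfolding image_mult_assoc .
  moreover have "inj ((*) (a * \<iota> n))" using ab \<iota>_norm_neq_0 by (auto simp: inj_on_def)
  ultimately have "J = quotient_ideal I n x" by (simp add: inj_image_eq_iff)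
  with x x0 show thesis using that by blast
qed

lemma quotient_ideal_eq_imp_dvd:
  assumes x: "x \<in> cj ` I" and y: "y \<in> cj ` I" and eq: "quotient_ideal I n x = quotient_ideal I n y"
  shows "\<exists>s\<in>order_ring. x = y * s"
proof -
  have xy: "(*) x ` I = (*) y ` I" using mult_quotient_ideal[OF x] mult_quotient_ideal[OF y] eq by simp
  let ?K = "{k. \<exists>s\<in>order_ring. x * k = \<iota> n * (y * s)}"
  have "\<iota> n \<in> ?K"
  proof (rule norm_generatorD2[OF n(1)])
    fix k l assume "k \<in> ?K" "l \<in> ?K"
    then obtain s t where "s \<in> order_ring" "t \<in> order_ring" "x * k = \<iota> n * (y * s)" "x * l = \<iota> n * (y * t)" by blast
    then have "s + t \<in> order_ring" "x * (k + l) = \<iota> n * (y * (s + t))" using add_mem by (simp_all add: distrib_left)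
    then show "k + l \<in> ?K" by blast
  next
    fix i j assume ij: "i \<in> I" "j \<in> I"
    then obtain i' where i': "i' \<in> I" "x * i = y * i'" using xy by blast
    obtain s where s: "s \<in> order_ring" "i' * cj j = \<iota> n * s" using norm_generatorD1[OF n(1) i'(1) ij(2)] by blast
    have "x * (i * cj j) = y * (i' * cj j)" using i'(2) by (simp add: mult.assoc[symmetric])
    also have "\<dots> = \<iota> n * (y * s)" unfolding s(2) by (simp only: mult.left_commute)
    finally show "i * cj j \<in> ?K" using s(1) by blast
  qed
  then obtain s where s: "s \<in> order_ring" "x * \<iota> n = \<iota> n * (y * s)" by blast
  then have "\<iota> n * x = \<iota> n * (y * s)" by (simp only: mult.commute)
  then have "x = y * s" using \<iota>_norm_neq_0 by simp
  with s(1) show ?thesis by blast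
qed

lemma quotient_ideal_eq_iff:
  assumes x: "x \<in> cj ` I" "x \<noteq> 0" and y: "y \<in> cj ` I" "y \<noteq> 0"
  shows "quotient_ideal I n x = quotient_ideal I n y \<longleftrightarrow> (\<exists>c. c \<noteq> 0 \<and> y = \<iota> [:c:] * x)"
proof
  assume eq: "quotient_ideal I n x = quotient_ideal I n y"
  obtain s where s: "s \<in> order_ring" "x = y * s" using quotient_ideal_eq_imp_dvd[OF x(1) y(1) eq] by blast
  obtain t where t: "t \<in> order_ring" "y = x * t" using quotient_ideal_eq_imp_dvd[OF y(1) x(1) eq[symmetric]] by blast
  have "x * 1 = x * (t * s)" using s(2) unfolding t(2) by (simp add: mult.assoc)
  then have "t * s = 1" using x(2) by simp
  then have "nm t * nm s = nm 1" using nm_mult[OF t(1) s(1)] by simp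
  also have "nm 1 = 1" using nm_\<iota>[of 1] by (simp add: \<iota>_1)
  finally have "nm t * nm s = 1" .
  then have "is_unit (nm t)" by (metis dvd_triv_left)
  then have "degree (nm t) = 0" using is_unit_iff_degree[of "nm t"] by (cases "nm t = 0") auto
  moreover have "t \<noteq> 0" using t y by auto
  ultimately obtain c where "c \<noteq> 0" "t = \<iota> [:c:]" using norm_degree_0[OF t(1)] by blast
  then show "\<exists>c. c \<noteq> 0 \<and> y = \<iota> [:c:] * x" using t(2) by (auto simp: mult.commute)
next
  assume "\<exists>c. c \<noteq> 0 \<and> y = \<iota> [:c:] * x"
  then obtain c where c: "c \<noteq> 0" "y = \<iota> [:c:] * x" by blast
  have u: "\<iota> [:c:] * \<iota> [:inverse c:] = 1" using c by (simp flip: \<iota>_mult \<iota>_1 one_pCons)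
  have "(*) (\<iota> [:c:]) ` I = I"
  proof (intro equalityI subsetI)
    fix i assume i: "i \<in> I"
    then have "\<iota> [:inverse c:] * i \<in> I" using ideals_D(4)[OF I i] by simp
    moreover have "i = \<iota> [:c:] * (\<iota> [:inverse c:] * i)" using u by (simp add: mult.assoc[symmetric])
    ultimately show "i \<in> (*) (\<iota> [:c:]) ` I" by blast
  qed (use ideals_D(4)[OF I] in auto)
  then have "(*) y ` I = (*) x ` I" unfolding c(2) by (metis image_mult_assoc mult.commute)
  then show "quotient_ideal I n x = quotient_ideal I n y" by (simp add: quotient_ideal_def)
qed

end

lemma finite_norm_degree: "finite {x \<in> order_ring. degree (nm x) < m}"
proof (rule finite_imageD)
  have "twist x \<in> polys_below m" if "x \<in> order_ring" "degree (nm x) < m" for x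
    using that degree_twist by (simp add: mem_polys_below)
  then have "twist ` {x \<in> order_ring. degree (nm x) < m} \<subseteq> polys_below m" by auto
  then show "finite (twist ` {x \<in> order_ring. degree (nm x) < m})" by (rule finite_subset) simp
  show "inj_on twist {x \<in> order_ring. degree (nm x) < m}" by (rule inj_on_subset[OF twist_inj]) auto
qed

lemma card_level:
  assumes V: "V \<in> ideals" and ex: "\<exists>x\<in>V. x \<noteq> 0 \<and> degree (nm x) = M"
  shows "card {x \<in> V. x \<noteq> 0 \<and> degree (nm x) = M} =
    (CARD('a) - 1) * (1 + (\<Sum>m<M. card {x \<in> V. x \<noteq> 0 \<and> degree (nm x) = m}))"
proof -
  note D = ideals_D[OF V]
  have inj: "inj_on twist {x \<in> V. x \<noteq> 0 \<and> degree (nm x) = m}" for m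
    by (rule inj_on_subset[OF twist_inj]) (use D in auto)
  have "twist ` {x \<in> V. x \<noteq> 0 \<and> degree (nm x) = m} = {p \<in> twist ` V. p \<noteq> 0 \<and> degree p = m}" for m
  proof (intro equalityI subsetI)
    fix p assume "p \<in> {p \<in> twist ` V. p \<noteq> 0 \<and> degree p = m}"
    then obtain x where x: "x \<in> V" "p = twist x" "twist x \<noteq> 0" "degree (twist x) = m" by blast
    then have "x \<in> {x \<in> V. x \<noteq> 0 \<and> degree (nm x) = m}"
      using twist_eq_0_iff[OF D(1)] degree_twist[OF D(1)] by auto
    then show "p \<in> twist ` {x \<in> V. x \<noteq> 0 \<and> degree (nm x) = m}" using x by blast
  qed (use twist_eq_0_iff[OF D(1)] degree_twist[OF D(1)] in auto)
  then have c: "card {x \<in> V. x \<noteq> 0 \<and> degree (nm x) = m} = card {p \<in> twist ` V. p \<noteq> 0 \<and> degree p = m}" for m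
    using card_image[OF inj, of m] by simp
  obtain x where x: "x \<in> V" "x \<noteq> 0" "degree (nm x) = M" using ex by blast
  show ?thesis unfolding c
  proof (rule card_subspace_level)
    show "p + r \<in> twist ` V" if pr: "p \<in> twist ` V" "r \<in> twist ` V" for p r
    proof -
      obtain y z where "y \<in> V" "z \<in> V" "p = twist y" "r = twist z" using pr by blast
      then show ?thesis using twist_add[OF D(1) D(1)] D(3) by (metis imageI)
    qed
    show "smult a p \<in> twist ` V" if p: "p \<in> twist ` V" for a p
    proof -
      obtain y where "y \<in> V" "p = twist y" using p by blast
      then show ?thesis using twist_const_mult[OF D(1)] D(4)[of y "\<iota> [:a:]"] by (metis \<iota>_mem imageI)
    qed
    show "twist x \<in> twist ` V" "twist x \<noteq> 0" "degree (twist x) = M"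
      using x twist_eq_0_iff[OF D(1)] degree_twist[OF D(1)] by auto
  qed
qed

lemma quotient_ideal_degree:
  assumes I: "I \<in> ideals_of_degree k" and n: "norm_generator I n" "n \<noteq> 0" "degree n = k"
    and x: "x \<in> cj ` I" "x \<noteq> 0"
  shows "quotient_ideal I n x \<in> ideals_of_degree m \<longleftrightarrow> degree (nm x) = m + k"
proof -
  have II: "I \<in> ideals" using I ideals_of_degree_subset by blast
  have deg: "degree (nm x) = l + k" if "quotient_ideal I n x \<in> ideals_of_degree l" for l
  proof -
    have "degree (nm x) + k = degree (nm (\<iota> n)) + l"
      by (rule degree_norm_eq[OF I that]) (use x n \<iota>_eq_0_iff mult_quotient_ideal[OF II n(1,2) x(1)] in auto)
    moreover have "degree (nm (\<iota> n)) = 2 * k" using n by (simp add: nm_\<iota> degree_power_eq)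
    ultimately show ?thesis by simp
  qed
  obtain l where "quotient_ideal I n x \<in> ideals_of_degree l"
    using quotient_ideal_in_ideals[OF II n(1,2) x] unfolding ideals_eq by blast
  then show ?thesis using deg by fastforce
qed

lemma card_class_degree:
  assumes I: "I \<in> ideals_of_degree k" and n: "norm_generator I n" "n \<noteq> 0" "degree n = k"
  shows "card {x \<in> cj ` I. x \<noteq> 0 \<and> degree (nm x) = m + k} =
    (CARD('a) - 1) * card {J \<in> ideals_of_degree m. (I, J) \<in> class_rel}"
proof -
  let ?A = "{x \<in> cj ` I. x \<noteq> 0 \<and> degree (nm x) = m + k}"
  let ?f = "quotient_ideal I n"
  have II: "I \<in> ideals" using I ideals_of_degree_subset by blast
  have V: "cj ` I \<in> ideals" by (rule cj_ideal[OF II])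
  have fin: "finite ?A"
    by (rule finite_subset[OF _ finite_norm_degree[of "Suc (m + k)"]]) auto
  have img: "?f ` ?A = {J \<in> ideals_of_degree m. (I, J) \<in> class_rel}"
  proof (intro equalityI subsetI)
    fix J assume "J \<in> {J \<in> ideals_of_degree m. (I, J) \<in> class_rel}"
    then have J: "J \<in> ideals_of_degree m" "(I, J) \<in> class_rel" by auto
    obtain x where "x \<in> cj ` I" "x \<noteq> 0" "J = ?f x" using ex_quotient_ideal[OF II n(1,2) J(2)] .
    then show "J \<in> ?f ` ?A" using J quotient_ideal_degree[OF I n] by blast
  next
    fix J assume "J \<in> ?f ` ?A"
    then obtain x where x: "x \<in> cj ` I" "x \<noteq> 0" "degree (nm x) = m + k" "J = ?f x" by blast
    then show "J \<in> {J \<in> ideals_of_degree m. (I, J) \<in> class_rel}"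
      using quotient_ideal_degree[OF I n x(1,2)] quotient_ideal_class[OF II n(1,2) x(1,2)] by blast
  qed
  have fiber: "card {x \<in> ?A. ?f x = J} = CARD('a) - 1" if J: "J \<in> ?f ` ?A" for J
  proof -
    obtain x where x: "x \<in> cj ` I" "x \<noteq> 0" "degree (nm x) = m + k" "J = ?f x" using J by blast
    have xO: "x \<in> order_ring" using x(1) by auto
    have "{y \<in> ?A. ?f y = J} = (\<lambda>c. \<iota> [:c:] * x) ` (UNIV - {0})"
    proof (intro equalityI subsetI)
      fix y assume "y \<in> {y \<in> ?A. ?f y = J}"
      then show "y \<in> (\<lambda>c. \<iota> [:c:] * x) ` (UNIV - {0})"
        using quotient_ideal_eq_iff[OF II n(1,2) x(1,2), of y] x(4) by auto
    next
      fix y assume "y \<in> (\<lambda>c. \<iota> [:c:] * x) ` (UNIV - {0})"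
      then obtain c where c: "c \<noteq> 0" "y = \<iota> [:c:] * x" by blast
      have y: "y \<in> cj ` I" "y \<noteq> 0" using c x ideals_D(4)[OF V x(1)] \<iota>_eq_0_iff by auto
      have "degree (nm y) = degree (nm x)"
        unfolding c(2) using c(1) by (simp add: nm_mult xO nm_\<iota> power2_eq_square)
      moreover have "?f y = J" using quotient_ideal_eq_iff[OF II n(1,2) x(1,2) y] c x(4) by auto
      ultimately show "y \<in> {y \<in> ?A. ?f y = J}" using y x(3) by simp
    qed
    moreover have "inj_on (\<lambda>c. \<iota> [:c:] * x) (UNIV - {0})"
    proof (rule inj_onI)
      fix c d assume "\<iota> [:c:] * x = \<iota> [:d:] * x"
      then have "\<iota> [:c:] = \<iota> [:d:]" using x(2) by simp
      then have "\<iota> ([:c:] - [:d:]) = 0" unfolding \<iota>_diff by simp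
      then show "c = d" by (simp add: \<iota>_eq_0_iff)
    qed
    ultimately show ?thesis by (simp add: card_image card_Diff_singleton)
  qed
  have "card ?A = (\<Sum>x\<in>?A. 1)" by simp
  also have "\<dots> = (\<Sum>J\<in>?f ` ?A. \<Sum>x\<in>{x \<in> ?A. ?f x = J}. 1)" by (rule sum.image_gen[OF fin])
  also have "\<dots> = (\<Sum>J\<in>?f ` ?A. CARD('a) - 1)" by (rule sum.cong) (use fiber in auto)
  finally show ?thesis unfolding img by (simp add: mult.commute)
qed

lemma ex_norm_degree:
  assumes I: "I \<in> ideals_of_degree k" and M: "M \<ge> 2 * k + degree P"
  shows "\<exists>x\<in>cj ` I. x \<noteq> 0 \<and> degree (nm x) = M"
proof -
  have II: "I \<in> ideals" using I ideals_of_degree_subset by blast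
  note V = ideals_D[OF cj_ideal[OF II]]
  obtain c a b where I': "I = std_ideal c a b" "lead_coeff c = 1" "lead_coeff a = 1" "2 * degree c + degree a = k"
    using I by (rule ideals_of_degreeE)
  have ca: "c * a \<noteq> 0" using I' by auto
  have dca: "degree (c * a) \<le> k" using I' ca by (simp add: degree_mult_eq)
  have "elt (c * (1 * a + 0 * b)) (c * 0) \<in> I" unfolding I'(1) std_ideal_def by blast
  then have "elt (c * a) 0 \<in> I" by simp
  then have "cj (elt (c * a) 0) \<in> cj ` I" by (rule imageI)
  then have m: "elt (c * a) 0 \<in> cj ` I" by simp
  show ?thesis
  proof (cases "even M")
    case True
    define j where "j = (M - 2 * degree (c * a)) div 2"
    let ?x = "elt (monom 1 j) 0 * elt (c * a) 0"
    have j: "2 * j + 2 * degree (c * a) = M" using True M dca unfolding j_def by simp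
    have "?x = elt (monom 1 j * (c * a)) 0" by (simp add: elt_mult)
    moreover have "?x \<in> cj ` I" using V(4)[OF m] by simp
    moreover have nz: "monom 1 j * (c * a) \<noteq> 0" using ca by simp
    moreover have "degree ((monom 1 j * (c * a)) ^ 2) = M"
    proof -
      have "degree (monom 1 j * (c * a)) = j + degree (c * a)" using ca by (subst degree_mult_eq) (auto simp: degree_monom_eq)
      then show ?thesis using nz j by (subst degree_power_eq) auto
    qed
    ultimately show ?thesis by (intro bexI[of _ ?x]) (auto simp: elt_eq_0_iff)
  next
    case False
    define j where "j = (M - degree P - 2 * degree (c * a)) div 2"
    let ?x = "elt 0 (monom 1 j) * elt (c * a) 0"
    have "even (M - degree P - 2 * degree (c * a))" using False odd_deg M dca by simp
    then have j: "degree P + (2 * j + 2 * degree (c * a)) = M" using M dca unfolding j_def by simp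
    have "?x = elt 0 (monom 1 j * (c * a))" by (simp add: elt_mult)
    moreover have "?x \<in> cj ` I" using V(4)[OF m] by simp
    moreover have nz: "monom 1 j * (c * a) \<noteq> 0" using ca by simp
    moreover have "degree (P * (monom 1 j * (c * a)) ^ 2) = M"
    proof -
      have "degree (monom 1 j * (c * a)) = j + degree (c * a)" using ca by (subst degree_mult_eq) (auto simp: degree_monom_eq)
      then show ?thesis using nz j by (subst degree_mult_eq) (auto simp: degree_power_eq)
    qed
    ultimately show ?thesis by (intro bexI[of _ ?x]) (auto simp: elt_eq_0_iff)
  qed
qed

text \<open>Minimising the norm degree in a class forces it to be at most that of \<open>P\<close>, since \<open>b + w\<close> reduces larger ideals.\<close>

lemma ex_reduced_ideal:
  assumes "I \<in> ideals"
  obtains J k where "(I, J) \<in> class_rel" "J \<in> ideals_of_degree k" "k \<le> degree P"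
proof -
  let ?Q = "\<lambda>k. \<exists>J. (I, J) \<in> class_rel \<and> J \<in> ideals_of_degree k"
  define k where "k = (LEAST k. ?Q k)"
  have refl: "(I, I) \<in> class_rel" using equiv_class_rel assms by (auto simp: equiv_def refl_on_def)
  obtain k0 where "I \<in> ideals_of_degree k0" using assms unfolding ideals_eq by blast
  then have "?Q k0" using refl by blast
  then have "?Q k" unfolding k_def by (rule LeastI)
  then obtain J where J: "(I, J) \<in> class_rel" "J \<in> ideals_of_degree k" by blast
  have least: "k \<le> l" if "?Q l" for l unfolding k_def by (rule Least_le[of ?Q, OF that])
  have JI: "J \<in> ideals" using J ideals_of_degree_subset by blast
  obtain c a b where J': "J = std_ideal c a b" "lead_coeff c = 1" "lead_coeff a = 1" "b \<in> polys_below (degree a)"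
    "2 * degree c + degree a = k" and n: "norm_generator J (c ^ 2 * a)" "c ^ 2 * a \<noteq> 0" "degree (c ^ 2 * a) = k"
    using J(2) by (rule ideals_of_degreeE) blast
  have c0: "c \<noteq> 0" using J' by auto
  have "elt (c * (0 * a + 1 * b)) (c * 1) \<in> J" unfolding J'(1) std_ideal_def by blast
  then have "cj (elt (c * b) c) \<in> cj ` J" by (intro imageI) simp
  then have x: "elt (c * b) (- c) \<in> cj ` J" "elt (c * b) (- c) \<noteq> 0" using c0 by (simp_all add: elt_eq_0_iff)
  let ?x = "elt (c * b) (- c)"
  let ?J = "quotient_ideal J (c ^ 2 * a) ?x"
  obtain l where l: "?J \<in> ideals_of_degree l"
    using quotient_ideal_in_ideals[OF JI n(1,2) x] unfolding ideals_eq by blast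
  have "(I, ?J) \<in> class_rel"
    using equiv_class_rel J(1) quotient_ideal_class[OF JI n(1,2) x] by (meson equiv_def transD)
  then have kl: "k \<le> l" using l least by blast
  have dl: "degree (nm ?x) = l + k" using quotient_ideal_degree[OF J(2) n x] l by blast
  have "nm ?x = c ^ 2 * (b ^ 2 + P)" by (simp add: power_mult_distrib algebra_simps)
  then have "degree (nm ?x) \<le> 2 * degree c + degree (b ^ 2 + P)"
    using degree_mult_le[of "c ^ 2" "b ^ 2 + P"] c0 by (simp add: degree_power_eq)
  moreover have "degree (b ^ 2 + P) \<le> max (degree (b ^ 2)) (degree P)" by (rule degree_add_le_max)
  moreover have "degree (b ^ 2) = 2 * degree b" by (cases "b = 0") (simp_all add: degree_power_eq)
  moreover have "b = 0 \<or> degree b < degree a" using J'(4) by (simp add: mem_polys_below)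
  ultimately have "k \<le> degree P" using kl dl J'(5) by (auto simp: max_def split: if_splits)
  then show thesis using that J by blast
qed

lemma finite_classes: "finite (ideals // class_rel)"
proof (rule finite_subset)
  show "ideals // class_rel \<subseteq> (\<lambda>J. class_rel `` {J}) ` (\<Union>k\<le>degree P. ideals_of_degree k)"
  proof
    fix C assume "C \<in> ideals // class_rel"
    then obtain I where I: "I \<in> ideals" "C = class_rel `` {I}" by (auto elim: quotientE)
    obtain J k where J: "(I, J) \<in> class_rel" "J \<in> ideals_of_degree k" "k \<le> degree P" using I(1) by (rule ex_reduced_ideal)
    have "C = class_rel `` {J}" using I(2) equiv_class_eq[OF equiv_class_rel J(1)] by simp
    then show "C \<in> (\<lambda>J. class_rel `` {J}) ` (\<Union>k\<le>degree P. ideals_of_degree k)" using J by blast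
  qed
qed simp

lemma card_class_level:
  assumes C: "C \<in> ideals // class_rel" and M: "M \<ge> 2 * degree P"
  shows "card (C \<inter> ideals_of_degree M) = 1 + (CARD('a) - 1) * (\<Sum>l<M. card (C \<inter> ideals_of_degree l))"
proof -
  obtain I where I: "I \<in> ideals" "C = class_rel `` {I}" using C by (auto elim: quotientE)
  obtain J k where J: "(I, J) \<in> class_rel" "J \<in> ideals_of_degree k" "k \<le> degree P" using I(1) by (rule ex_reduced_ideal)
  have C': "C = class_rel `` {J}" using I(2) equiv_class_eq[OF equiv_class_rel J(1)] by simp
  obtain n where n: "norm_generator J n" "n \<noteq> 0" "degree n = k" using J(2) by (elim ideals_of_degreeE) blast
  have JI: "J \<in> ideals" using J ideals_of_degree_subset by blast
  let ?q = "CARD('a) - 1"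
  let ?c = "\<lambda>m. card {x \<in> cj ` J. x \<noteq> 0 \<and> degree (nm x) = m}"
  have cc: "?c (l + k) = ?q * card (C \<inter> ideals_of_degree l)" for l
  proof -
    have "C \<inter> ideals_of_degree l = {J' \<in> ideals_of_degree l. (J, J') \<in> class_rel}" unfolding C' by blast
    then show ?thesis using card_class_degree[OF J(2) n] by simp
  qed
  have c0: "?c m = 0" if "m < k" for m
  proof -
    have False if x: "x \<in> cj ` J" "x \<noteq> 0" "degree (nm x) = m" for x
    proof -
      obtain l where "quotient_ideal J n x \<in> ideals_of_degree l"
        using quotient_ideal_in_ideals[OF JI n(1,2) x(1,2)] unfolding ideals_eq by blast
      then have "degree (nm x) = l + k" using quotient_ideal_degree[OF J(2) n x(1,2)] by blast
      then show False using x(3) \<open>m < k\<close> by simp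
    qed
    then have "{x \<in> cj ` J. x \<noteq> 0 \<and> degree (nm x) = m} = {}" by blast
    then show ?thesis by (simp only: card.empty)
  qed
  have "?q * card (C \<inter> ideals_of_degree M) = ?c (M + k)" using cc by simp
  also have "\<dots> = ?q * (1 + (\<Sum>m<M + k. ?c m))"
    by (rule card_level[OF cj_ideal[OF JI] ex_norm_degree[OF J(2)]]) (use M J(3) in simp)
  also have "(\<Sum>m<M + k. ?c m) = (\<Sum>l<M. ?c (l + k))"
  proof -
    have "(\<Sum>m<M + k. ?c m) = (\<Sum>m\<in>{k..<M + k}. ?c m)"
      by (rule sum.mono_neutral_right) (use c0 in auto)
    also have "\<dots> = (\<Sum>l<M. ?c (l + k))"
      using sum.shift_bounds_nat_ivl[of ?c 0 k M] by (simp add: lessThan_atLeast0)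
    finally show ?thesis .
  qed
  also have "\<dots> = ?q * (\<Sum>l<M. card (C \<inter> ideals_of_degree l))" by (simp only: cc sum_distrib_left)
  finally have "?q * card (C \<inter> ideals_of_degree M) = ?q * (1 + ?q * (\<Sum>l<M. card (C \<inter> ideals_of_degree l)))" .
  moreover have "?q \<noteq> 0"
  proof -
    have "card {0, 1::'a} \<le> CARD('a)" by (rule card_mono) auto
    then show ?thesis by simp
  qed
  ultimately show ?thesis by (simp only: mult_cancel1 simp_thms)
qed

theorem class_number_formula:
  assumes "ramified_prime P S"
  shows "int (card (ideals // class_rel)) = (\<Sum>g\<in>monic_below (degree P). leg P g)"
proof -
  interpret R: ramified_prime P S by fact
  let ?Cl = "ideals // class_rel" and ?q = "int CARD('a) - 1"
  define M where "M = 2 * degree P"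
  have tot: "int (card (ideal_data P l)) = (\<Sum>C\<in>?Cl. int (card (C \<inter> ideals_of_degree l)))" for l
  proof -
    have U: "ideals_of_degree l = (\<Union>C\<in>?Cl. C \<inter> ideals_of_degree l)"
      using Union_quotient[OF equiv_class_rel] ideals_of_degree_subset by blast
    have "card (ideals_of_degree l) = (\<Sum>C\<in>?Cl. card (C \<inter> ideals_of_degree l))"
    proof (subst U, rule card_UN_disjoint)
      show "\<forall>C\<in>?Cl. \<forall>D\<in>?Cl. C \<noteq> D \<longrightarrow> C \<inter> ideals_of_degree l \<inter> (D \<inter> ideals_of_degree l) = {}"
        using quotient_disj[OF equiv_class_rel] by blast
    qed (use finite_classes in auto)
    then show ?thesis by (simp add: card_ideals_of_degree)
  qed
  have "int CARD('a) - 1 = int (CARD('a) - 1)" using zero_less_card_finite[where 'a = 'a] by simp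
  then have lev: "int (card (C \<inter> ideals_of_degree M)) = 1 + ?q * (\<Sum>l<M. int (card (C \<inter> ideals_of_degree l)))"
    if "C \<in> ?Cl" for C
    using card_class_level[OF that, of M] by (simp add: M_def)
  have "int (card (ideal_data P M)) = (\<Sum>C\<in>?Cl. 1 + ?q * (\<Sum>l<M. int (card (C \<inter> ideals_of_degree l))))"
    unfolding tot using lev by (rule sum.cong[OF refl])
  also have "\<dots> = int (card ?Cl) + ?q * (\<Sum>C\<in>?Cl. \<Sum>l<M. int (card (C \<inter> ideals_of_degree l)))"
    by (simp add: sum.distrib sum_distrib_left)
  also have "(\<Sum>C\<in>?Cl. \<Sum>l<M. int (card (C \<inter> ideals_of_degree l))) = (\<Sum>l<M. int (card (ideal_data P l)))"
    unfolding tot by (rule sum.swap)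
  finally show ?thesis using R.sum_leg_eq_ideal_count[of M] by (simp add: M_def)
qed

end

section \<open>The maximal order of the quadratic function field\<close>

lemma common_divisor_decomposition:
  fixes s t :: "'a::field poly"
  assumes "t \<noteq> 0"
  obtains h t' s' where "t = h * t'" "s = h * s'" "h \<noteq> 0" "coprime s' t'"
proof -
  obtain u v where h: "(u * t + v * s) dvd t" "(u * t + v * s) dvd s" by (rule field_poly_bezout)
  obtain h where h_def: "h = u * t + v * s" by blast
  obtain t' s' where ts: "t = h * t'" "s = h * s'" using h unfolding h_def[symmetric] by (elim dvdE) blast
  have h0: "h \<noteq> 0" using assms ts by auto
  have "h * (u * t' + v * s') = u * (h * t') + v * (h * s')" by (simp add: algebra_simps)
  also have "\<dots> = u * t + v * s" using ts by simp
  also have "\<dots> = h * 1" using h_def by simp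
  finally have bz: "u * t' + v * s' = 1" using h0 by simp
  have "coprime s' t'"
  proof (rule coprimeI)
    fix d assume "d dvd s'" "d dvd t'"
    then have "d dvd u * t' + v * s'" by simp
    then show "is_unit d" using bz by simp
  qed
  with ts h0 show thesis by (rule that)
qed

lemma coprime_poly_powers:
  fixes s t :: "'a::field poly"
  assumes "coprime s t" shows "coprime (s ^ n) (t ^ n)"
  using coprime_poly_power_right[OF assms, of n] coprime_poly_power_right[of "t ^ n" s n] by (simp add: coprime_commute)

lemma all_powers_dvd_imp_dvd:
  fixes s t c :: "'a::field poly"
  assumes "\<And>n. t ^ n dvd c * s ^ n" "c \<noteq> 0"
  shows "t dvd s"
proof (cases "t = 0")
  case True
  then show ?thesis using assms(1)[of 1] assms(2) by simp
next
  case False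
  then obtain h t' s' where ts: "t = h * t'" "s = h * s'" "h \<noteq> 0" "coprime s' t'" by (rule common_divisor_decomposition)
  have "t' ^ n dvd c" for n
  proof -
    have "h ^ n * t' ^ n dvd h ^ n * (c * s' ^ n)" using assms(1)[of n] ts by (simp add: power_mult_distrib ac_simps)
    then have "t' ^ n dvd s' ^ n * c" using ts(3) by (simp add: mult.commute)
    then show ?thesis using coprime_dvd_mult_poly[OF coprime_poly_powers[OF ts(4)]] by blast
  qed
  then have le: "degree (t' ^ n) \<le> degree c" for n using assms(2) dvd_imp_degree_le by blast
  have t'0: "t' \<noteq> 0" using ts False by auto
  have "degree t' = 0"
  proof (rule ccontr)
    assume "degree t' \<noteq> 0"
    then have "Suc (degree c) * 1 \<le> Suc (degree c) * degree t'" by (intro mult_le_mono2) simp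
    also have "\<dots> = degree (t' ^ Suc (degree c))" using t'0 by (subst degree_power_eq) auto
    also have "\<dots> \<le> degree c" by (rule le)
    finally show False by simp
  qed
  then have "is_unit t'" using t'0 by (simp add: is_unit_iff_degree)
  then have "t' dvd s'" by (rule unit_imp_dvd)
  then show ?thesis unfolding ts by (rule mult_dvd_mono[OF dvd_refl])
qed

lemma square_dvd_irreducible_mult:
  fixes P e b :: "'a::field poly"
  assumes "irreducible P" "e ^ 2 dvd P * b ^ 2" "e \<noteq> 0"
  shows "e dvd b"
proof -
  obtain h e' b' where eb: "e = h * e'" "b = h * b'" "h \<noteq> 0" "coprime b' e'" using assms(3) by (rule common_divisor_decomposition)
  have "h ^ 2 * e' ^ 2 dvd h ^ 2 * (b' ^ 2 * P)" using assms(2) eb by (simp add: power_mult_distrib ac_simps)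
  then have "e' ^ 2 dvd b' ^ 2 * P" using eb(3) by simp
  then have "e' ^ 2 dvd P" using coprime_dvd_mult_poly[OF coprime_poly_powers[OF eb(4)]] by blast
  then have "e' * e' dvd P" by (simp only: power2_eq_square)
  then obtain k where "P = e' * e' * k" by (rule dvdE)
  then have k: "P = e' * (e' * k)" by (simp only: mult.assoc)
  then have "is_unit e' \<or> is_unit (e' * k)" using assms(1) irreducibleD by blast
  then have "is_unit e'" by (auto dest: dvd_mult_left)
  then have "e' dvd b'" by (rule unit_imp_dvd)
  then show ?thesis unfolding eb by (rule mult_dvd_mono[OF dvd_refl])
qed

context quadratic_order begin

lemma power_mem: "x \<in> order_ring \<Longrightarrow> x ^ n \<in> order_ring"
  by (induction n) (auto intro: mult_mem)

lemma nm_power: "x \<in> order_ring \<Longrightarrow> nm (x ^ n) = nm x ^ n"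
  using nm_\<iota>[of 1] by (induction n) (simp_all add: nm_mult power_mem \<iota>_1)

lemma \<iota>_power: "\<iota> (a ^ n) = \<iota> a ^ n"
  by (induction n) (simp_all add: \<iota>_simps)

lemma bounded_denominator_norm:
  assumes "\<iota> e * z \<in> order_ring" "c \<noteq> 0" "\<And>n. \<iota> c * z ^ n \<in> order_ring"
  shows "e ^ 2 dvd nm (\<iota> e * z)"
proof (rule all_powers_dvd_imp_dvd[where c = "c ^ 2"])
  fix n
  let ?x = "\<iota> e * z" and ?y = "\<iota> c * z ^ n"
  have "?x ^ n = \<iota> (e ^ n) * z ^ n" by (simp only: \<iota>_power power_mult_distrib)
  then have "\<iota> c * ?x ^ n = \<iota> (e ^ n) * ?y" by (simp only: mult.left_commute)
  then have "nm (\<iota> c * ?x ^ n) = nm (\<iota> (e ^ n) * ?y)" by (rule arg_cong)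
  then have "c ^ 2 * nm ?x ^ n = (e ^ n) ^ 2 * nm ?y"
    using assms by (simp add: nm_mult nm_power nm_\<iota> power_mem)
  then show "(e ^ 2) ^ n dvd c ^ 2 * nm ?x ^ n" by (simp add: power_mult[symmetric] mult.commute)
qed (use assms in simp)

lemma sum_mem: "(\<And>i. i \<in> A \<Longrightarrow> f i \<in> order_ring) \<Longrightarrow> sum f A \<in> order_ring"
  by (induction A rule: infinite_finite_induct) (auto intro: add_mem)

lemma integral_mem_order_ring:
  assumes e: "\<iota> e * z \<in> order_ring" "e \<noteq> 0"
    and p: "lead_coeff p = 1" "poly (map_poly \<iota> p) z = 0"
  shows "z \<in> order_ring"
proof -
  define N where "N = degree p"
  have coeff: "coeff (map_poly \<iota> p) i = \<iota> (coeff p i)" for i by (simp add: coeff_map_poly \<iota>_0)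
  have dp: "degree (map_poly \<iota> p) = N" unfolding N_def
    by (rule degree_map_poly) (simp add: \<iota>_eq_0_iff)
  have "poly (map_poly \<iota> p) z = (\<Sum>i\<le>N. \<iota> (coeff p i) * z ^ i)" by (simp add: poly_altdef dp coeff)
  also have "\<dots> = (\<Sum>i<N. \<iota> (coeff p i) * z ^ i) + z ^ N"
    using p(1) by (simp add: N_def \<iota>_1 flip: lessThan_Suc_atMost)
  finally have zN: "z ^ N = - (\<Sum>i<N. \<iota> (coeff p i) * z ^ i)" using p(2) by (simp add: eq_neg_iff_add_eq_0 add.commute)
  define c where "c = e ^ N"
  have c0: "c \<noteq> 0" using e by (simp add: c_def)
  have b: "\<iota> c * z ^ n \<in> order_ring" for n
  proof (induction n rule: less_induct)
    case (less n)
    show ?case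
    proof (cases "n < N")
      case True
      have "\<iota> c * z ^ n = \<iota> (e ^ (N - n)) * (\<iota> e * z) ^ n"
        using True by (simp add: c_def \<iota>_power power_mult_distrib mult.assoc[symmetric] flip: power_add)
      then show ?thesis using power_mem[OF e(1)] mult_mem by simp
    next
      case False
      have "z ^ n = z ^ N * z ^ (n - N)" using False by (simp flip: power_add)
      then have "\<iota> c * z ^ n = - (\<Sum>i<N. \<iota> (coeff p i) * (\<iota> c * z ^ (n - N + i)))"
        unfolding zN by (simp add: sum_distrib_left sum_distrib_right power_add ac_simps)
      also have "\<dots> \<in> order_ring"
        by (intro minus_mem sum_mem mult_mem \<iota>_mem less.IH) (use False in auto)
      finally show ?thesis .
    qed
  qed
  have b': "\<iota> c * z ^ k * (z + 1) ^ n \<in> order_ring" for n k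
  proof (induction n arbitrary: k)
    case (Suc n)
    have "\<iota> c * z ^ k * (z + 1) ^ Suc n = \<iota> c * z ^ Suc k * (z + 1) ^ n + \<iota> c * z ^ k * (z + 1) ^ n"
      by (simp add: algebra_simps)
    then show ?case using Suc add_mem by metis
  qed (use b in simp)
  obtain a0 b0 where x: "\<iota> e * z = elt a0 b0" using e(1) by (rule order_ringE)
  have x': "\<iota> e * (z + 1) = elt (a0 + e) b0" using x elt_add[of a0 b0 e 0] by (simp add: distrib_left elt_real)
  have 1: "e ^ 2 dvd a0 ^ 2 + P * b0 ^ 2" using bounded_denominator_norm[OF e(1) c0 b] unfolding x by simp
  have "\<iota> e * (z + 1) \<in> order_ring" unfolding x' by simp
  then have 2: "e ^ 2 dvd (a0 + e) ^ 2 + P * b0 ^ 2"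
    using bounded_denominator_norm[of e "z + 1", OF _ c0] b'[of 0] unfolding x' by simp
  have "e ^ 2 dvd ((a0 + e) ^ 2 + P * b0 ^ 2) - (a0 ^ 2 + P * b0 ^ 2) - e ^ 2" by (intro dvd_diff 1 2 dvd_refl)
  also have "((a0 + e) ^ 2 + P * b0 ^ 2) - (a0 ^ 2 + P * b0 ^ 2) - e ^ 2 = e * (2 * a0)"
    by (simp add: power2_eq_square algebra_simps)
  finally have "e * e dvd e * (2 * a0)" by (simp only: power2_eq_square)
  then have "e dvd 2 * a0" using e(2) by simp
  then have ea: "e dvd a0" using is_unit_two dvd_mult_unit_iff' by blast
  then have "e ^ 2 dvd a0 ^ 2" by (rule dvd_power_same)
  then have "e ^ 2 dvd P * b0 ^ 2" using 1 dvd_add_right_iff by blast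
  then have eb: "e dvd b0" using square_dvd_irreducible_mult[OF irr] e(2) by blast
  obtain a1 b1 where ab: "a0 = e * a1" "b0 = e * b1" using ea eb by (auto elim!: dvdE)
  have "\<iota> e * z = \<iota> e * elt a1 b1" unfolding x ab by (simp add: elt_mult flip: elt_real)
  then have "z = elt a1 b1" using e(2) by (simp add: \<iota>_eq_0_iff)
  then show ?thesis by simp
qed

lemma elt_integral: "\<exists>p. lead_coeff p = 1 \<and> poly (map_poly \<iota> p) (elt a b) = 0"
proof (intro exI conjI)
  let ?p = "[:a ^ 2 + P * b ^ 2, - (2 * a), 1:]"
  show "lead_coeff ?p = 1" by simp
  have "map_poly \<iota> ?p = [:\<iota> (a ^ 2 + P * b ^ 2), \<iota> (- (2 * a)), 1:]"
    by (simp add: map_poly_pCons \<iota>_0 \<iota>_1)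
  moreover have "elt a b * elt a b = elt (2 * a) 0 * elt a b - elt (a ^ 2 + P * b ^ 2) 0"
    by (simp add: elt_mult elt_diff elt_eq_iff power2_eq_square algebra_simps)
  ultimately show "poly (map_poly \<iota> ?p) (elt a b) = 0"
    by (simp add: \<iota>_minus elt_real algebra_simps)
qed

end

lemma ring_of_type_algebra_simps:
  "carrier ring_of_type_algebra = UNIV" "monoid.mult ring_of_type_algebra = (*)" "ring.add ring_of_type_algebra = (+)"
  "monoid.one ring_of_type_algebra = 1" "ring.zero ring_of_type_algebra = 0"
  by (simp_all add: ring_of_type_algebra_def)

lemma ring_of_type_algebra_a_inv: "a_inv (ring_of_type_algebra :: 'l::field ring) x = - x"
proof -
  interpret field "ring_of_type_algebra :: 'l ring" by (rule field_from_type_algebra)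
  show ?thesis by (rule minus_equality) (simp_all add: ring_of_type_algebra_simps)
qed

lemma ring_of_type_algebra_m_inv: "x \<noteq> 0 \<Longrightarrow> m_inv (ring_of_type_algebra :: 'l::field ring) x = inverse x"
proof -
  interpret field "ring_of_type_algebra :: 'l ring" by (rule field_from_type_algebra)
  show "x \<noteq> 0 \<Longrightarrow> m_inv (ring_of_type_algebra :: 'l::field ring) x = inverse x"
    by (rule comm_inv_char) (simp_all add: ring_of_type_algebra_simps)
qed

lemma ring_sub_of_type_algebra:
  fixes R :: "'l::field set"
  assumes R: "0 \<in> R" "1 \<in> R" "\<And>x y. x \<in> R \<Longrightarrow> y \<in> R \<Longrightarrow> x + y \<in> R" "\<And>x y. x \<in> R \<Longrightarrow> y \<in> R \<Longrightarrow> x * y \<in> R"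
    "\<And>x. x \<in> R \<Longrightarrow> - x \<in> R"
  shows "ring (ring_of_type_algebra\<lparr>carrier := R\<rparr>)"
proof (rule ringI)
  show "abelian_group (ring_of_type_algebra\<lparr>carrier := R\<rparr>)"
    by (rule abelian_groupI) (use R in \<open>auto simp: ring_of_type_algebra_def add.assoc add.commute intro: bexI[of _ "- _"]\<close>)
  show "monoid (ring_of_type_algebra\<lparr>carrier := R\<rparr>)"
    by (rule monoidI) (use R in \<open>auto simp: ring_of_type_algebra_def mult.assoc\<close>)
qed (auto simp: ring_of_type_algebra_def algebra_simps)

lemma ideal_sub_of_type_algebra_iff:
  fixes R :: "'l::field set"
  assumes R: "0 \<in> R" "1 \<in> R" "\<And>x y. x \<in> R \<Longrightarrow> y \<in> R \<Longrightarrow> x + y \<in> R" "\<And>x y. x \<in> R \<Longrightarrow> y \<in> R \<Longrightarrow> x * y \<in> R"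
    "\<And>x. x \<in> R \<Longrightarrow> - x \<in> R"
  shows "ideal I (ring_of_type_algebra\<lparr>carrier := R\<rparr>) \<longleftrightarrow>
    I \<subseteq> R \<and> 0 \<in> I \<and> (\<forall>x\<in>I. \<forall>y\<in>I. x + y \<in> I) \<and> (\<forall>x\<in>I. \<forall>s\<in>R. s * x \<in> I)"
proof
  assume "ideal I (ring_of_type_algebra\<lparr>carrier := R\<rparr>)"
  then interpret ideal I "ring_of_type_algebra\<lparr>carrier := R\<rparr>" .
  show "I \<subseteq> R \<and> 0 \<in> I \<and> (\<forall>x\<in>I. \<forall>y\<in>I. x + y \<in> I) \<and> (\<forall>x\<in>I. \<forall>s\<in>R. s * x \<in> I)"
    using a_subset additive_subgroup.zero_closed[OF is_additive_subgroup] additive_subgroup.a_closed[OF is_additive_subgroup]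
      I_l_closed by (auto simp: ring_of_type_algebra_def)
next
  assume I: "I \<subseteq> R \<and> 0 \<in> I \<and> (\<forall>x\<in>I. \<forall>y\<in>I. x + y \<in> I) \<and> (\<forall>x\<in>I. \<forall>s\<in>R. s * x \<in> I)"
  interpret ring "ring_of_type_algebra\<lparr>carrier := R\<rparr>" using R by (rule ring_sub_of_type_algebra)
  have neg: "a_inv (ring_of_type_algebra\<lparr>carrier := R\<rparr>) x = - x" if "x \<in> R" for x
    by (rule minus_equality) (use that R in \<open>auto simp: ring_of_type_algebra_def\<close>)
  have m: "- x \<in> I" if "x \<in> I" for x
  proof -
    have "(- 1) * x \<in> I" using I that R by blast
    then show ?thesis by simp
  qed
  show "ideal I (ring_of_type_algebra\<lparr>carrier := R\<rparr>)"
  proof (rule idealI[OF ring_axioms])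
    show "subgroup I (add_monoid (ring_of_type_algebra\<lparr>carrier := R\<rparr>))"
    proof
      fix x assume x: "x \<in> I"
      then have "x \<in> R" using I by blast
      then have "m_inv (add_monoid (ring_of_type_algebra\<lparr>carrier := R\<rparr>)) x = - x" using neg by (simp add: a_inv_def)
      then show "m_inv (add_monoid (ring_of_type_algebra\<lparr>carrier := R\<rparr>)) x \<in> I" using m x by simp
    qed (use I in \<open>auto simp: ring_of_type_algebra_def\<close>)
  qed (use I in \<open>auto simp: ring_of_type_algebra_def mult.commute\<close>)
qed

lemma poly_to_ac_simps:
  "poly_to_ac (a + b) = poly_to_ac a + poly_to_ac b" "poly_to_ac (a * b) = poly_to_ac a * poly_to_ac b"
  "poly_to_ac 1 = 1" "poly_to_ac (- a) = - poly_to_ac a"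
  by (simp_all add: poly_to_ac_def)

lemma poly_to_ac_eq_0_iff: "poly_to_ac a = 0 \<longleftrightarrow> a = 0"
  by (simp add: poly_to_ac_def)

lemma fract_common_denominator:
  fixes u v :: "'a::idom fract"
  obtains a b c where "c \<noteq> 0" "u = to_fract a / to_fract c" "v = to_fract b / to_fract c"
proof -
  obtain a1 c1 where 1: "u = Fract a1 c1" "c1 \<noteq> 0" by (cases u) auto
  obtain a2 c2 where 2: "v = Fract a2 c2" "c2 \<noteq> 0" by (cases v) auto
  have "u = to_fract (a1 * c2) / to_fract (c1 * c2)" "v = to_fract (a2 * c1) / to_fract (c1 * c2)"
    using 1 2 by (simp_all add: Fract_conv_to_fract field_simps)
  moreover have "c1 * c2 \<noteq> 0" using 1 2 by simp
  ultimately show thesis using that by blast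
qed

locale quadratic_function_field = irreducible_poly P for P :: "'a::{finite,field} poly" +
  fixes w :: "'a poly fract alg_closure"
  assumes odd_degree: "odd (degree P)" and w: "w ^ 2 = poly_to_ac (- P)"
begin

sublocale quadratic_order P poly_to_ac w
proof
  show "odd (degree P)" by (rule odd_degree)
  show "w * w = - poly_to_ac P" using w by (simp add: power2_eq_square poly_to_ac_simps)
  fix a b :: "'a poly"
  show "poly_to_ac (a + b) = poly_to_ac a + poly_to_ac b" "poly_to_ac (a * b) = poly_to_ac a * poly_to_ac b"
    by (simp_all add: poly_to_ac_simps)
  show "a = 0 \<and> b = 0" if e: "poly_to_ac a + poly_to_ac b * w = 0"
  proof -
    have "poly_to_ac a = - (poly_to_ac b * w)" using e by (simp add: eq_neg_iff_add_eq_0)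
    then have "poly_to_ac a ^ 2 = poly_to_ac b ^ 2 * w ^ 2" by (simp add: power_mult_distrib)
    then have "poly_to_ac (a ^ 2 + P * b ^ 2) = 0"
      unfolding w by (simp add: power2_eq_square poly_to_ac_simps)
    then have "a ^ 2 + P * b ^ 2 = 0" by (simp only: poly_to_ac_eq_0_iff)
    then have ab: "a ^ 2 = - (P * b ^ 2)" by (simp add: eq_neg_iff_add_eq_0)
    have "b = 0"
    proof (rule ccontr)
      assume b: "b \<noteq> 0"
      then have d: "degree (a ^ 2) = degree P + 2 * degree b" unfolding ab by (simp add: degree_mult_eq degree_power_eq)
      have "a \<noteq> 0" using ab b by auto
      then have "even (degree (a ^ 2))" by (simp add: degree_power_eq)
      then show False using d odd_degree by simp
    qed
    then show ?thesis using ab by simp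
  qed
qed (simp add: poly_to_ac_simps)

lemma w_square_roots: "y ^ 2 = poly_to_ac (- P) \<longleftrightarrow> y = w \<or> y = - w"
  using w power2_eq_iff by metis

lemma quad_function_field_eq: "quad_function_field (- P) = {to_ac u + to_ac v * w |u v. True}" (is "_ = ?F")
proof (intro equalityI subsetI)
  let ?R = "ring_of_type_algebra :: 'a poly fract alg_closure ring"
  let ?H = "range to_ac \<union> {y. y ^ 2 = poly_to_ac (- P)}"
  note simps = ring_of_type_algebra_simps
  fix z assume "z \<in> quad_function_field (- P)"
  then have "z \<in> generate_field ?R ?H" by (simp only: quad_function_field_def)
  then show "z \<in> ?F"
  proof (induction rule: generate_field.induct)
    case one
    have "1 = to_ac 1 + to_ac 0 * w" by simp
    then show ?case unfolding simps by blast
  next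
    case (incl h)
    then consider u where "h = to_ac u" | "h = w" | "h = - w" using w_square_roots by blast
    then show ?case
    proof cases
      case 1
      then have "h = to_ac u + to_ac 0 * w" by simp
      then show ?thesis by blast
    next
      case 2
      then have "h = to_ac 0 + to_ac 1 * w" by simp
      then show ?thesis by blast
    next
      case 3
      then have "h = to_ac 0 + to_ac (- 1) * w" by simp
      then show ?thesis by blast
    qed
  next
    case (a_inv h)
    then obtain u v where "h = to_ac u + to_ac v * w" by blast
    then have "- h = to_ac (- u) + to_ac (- v) * w" by simp
    then show ?case unfolding ring_of_type_algebra_a_inv by blast
  next
    case (m_inv h)
    then obtain u v where h: "h = to_ac u + to_ac v * w" by blast
    have h0: "h \<noteq> 0" using m_inv by (simp add: simps)
    let ?N = "u ^ 2 + v ^ 2 * to_fract P"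
    have ww: "w * w = - to_ac (to_fract P)" using w_square by (simp add: poly_to_ac_def)
    have "h * (to_ac u - to_ac v * w) = to_ac u ^ 2 - to_ac v ^ 2 * (w * w)" unfolding h by (simp add: algebra_simps power2_eq_square)
    then have N: "h * (to_ac u - to_ac v * w) = to_ac ?N" unfolding ww by simp
    have N0: "to_ac ?N \<noteq> 0"
    proof
      assume "to_ac ?N = 0"
      then have e: "to_ac u - to_ac v * w = 0" using N h0 by simp
      obtain a b c where abc: "c \<noteq> 0" "u = to_fract a / to_fract c" "v = to_fract b / to_fract c" by (rule fract_common_denominator)
      have c0: "poly_to_ac c \<noteq> 0" using abc by (simp add: poly_to_ac_eq_0_iff)
      have "poly_to_ac a / poly_to_ac c - poly_to_ac b / poly_to_ac c * w = 0"
        using e abc by (simp add: poly_to_ac_def)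
      then have "poly_to_ac a - poly_to_ac b * w = 0" using c0 by (simp add: field_simps)
      then have "poly_to_ac a + poly_to_ac (- b) * w = 0" by (simp add: poly_to_ac_simps)
      from indep[OF this] have "a = 0" "b = 0" by auto
      then show False using h h0 abc by simp
    qed
    have "inverse h * to_ac ?N = to_ac u - to_ac v * w" unfolding N[symmetric] using h0 by simp
    then have "inverse h = (to_ac u - to_ac v * w) / to_ac ?N" by (subst nonzero_eq_divide_eq[OF N0])
    also have "\<dots> = to_ac (u / ?N) + to_ac (- v / ?N) * w" by (simp add: diff_divide_distrib)
    finally have "inverse h = to_ac (u / ?N) + to_ac (- v / ?N) * w" .
    then show ?case unfolding ring_of_type_algebra_m_inv[OF h0] by blast
  next
    case (eng_add h1 h2)
    then obtain u v u' v' where "h1 = to_ac u + to_ac v * w" "h2 = to_ac u' + to_ac v' * w" by blast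
    then have "h1 + h2 = to_ac (u + u') + to_ac (v + v') * w" by (simp add: algebra_simps)
    then show ?case unfolding simps by blast
  next
    case (eng_mult h1 h2)
    then obtain u v u' v' where h: "h1 = to_ac u + to_ac v * w" "h2 = to_ac u' + to_ac v' * w" by blast
    have ww: "w * w = - to_ac (to_fract P)" using w_square by (simp add: poly_to_ac_def)
    have "h1 * h2 = to_ac u * to_ac u' + to_ac v * to_ac v' * (w * w) + (to_ac u * to_ac v' + to_ac v * to_ac u') * w"
      unfolding h by (simp add: algebra_simps)
    then have "h1 * h2 = to_ac (u * u' - v * v' * to_fract P) + to_ac (u * v' + v * u') * w" unfolding ww by simp
    then show ?case unfolding simps by blast
  qed
next
  let ?R = "ring_of_type_algebra :: 'a poly fract alg_closure ring"
  let ?H = "range to_ac \<union> {y. y ^ 2 = poly_to_ac (- P)}"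
  fix z assume "z \<in> ?F"
  then obtain u v where z: "z = to_ac u + to_ac v * w" by blast
  have "to_ac u \<in> generate_field ?R ?H" "to_ac v \<in> generate_field ?R ?H" "w \<in> generate_field ?R ?H"
    using w by (auto intro: generate_field.incl)
  then have "ring.add ?R (to_ac u) (monoid.mult ?R (to_ac v) w) \<in> generate_field ?R ?H"
    by (intro generate_field.eng_add generate_field.eng_mult)
  then show "z \<in> quad_function_field (- P)" by (simp add: quad_function_field_def z ring_of_type_algebra_simps)
qed

lemma quad_integers_eq: "quad_integers (- P) = order_ring"
proof (intro equalityI subsetI)
  fix z assume "z \<in> quad_integers (- P)"
  then obtain p where z: "z \<in> quad_function_field (- P)" and p: "lead_coeff p = 1" "poly (map_poly poly_to_ac p) z = 0"
    unfolding quad_integers_def by blast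
  obtain u v where uv: "z = to_ac u + to_ac v * w" using z unfolding quad_function_field_eq by blast
  obtain a b c where abc: "c \<noteq> 0" "u = to_fract a / to_fract c" "v = to_fract b / to_fract c" by (rule fract_common_denominator)
  have c0: "poly_to_ac c \<noteq> 0" using abc by (simp add: poly_to_ac_eq_0_iff)
  have "z = poly_to_ac a / poly_to_ac c + poly_to_ac b / poly_to_ac c * w"
    unfolding uv abc by (simp add: poly_to_ac_def)
  then have "poly_to_ac c * z = elt a b" using c0 by (simp add: elt_def field_simps)
  then show "z \<in> order_ring" using integral_mem_order_ring[of c z p] abc(1) p by simp
next
  fix z assume "z \<in> order_ring"
  then obtain a b where z: "z = elt a b" by (rule order_ringE)
  then have "z = to_ac (to_fract a) + to_ac (to_fract b) * w" by (simp add: elt_def poly_to_ac_def)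
  then have "z \<in> quad_function_field (- P)" unfolding quad_function_field_eq by blast
  then show "z \<in> quad_integers (- P)" using elt_integral[of a b] unfolding quad_integers_def z by blast
qed

lemma nonzero_ideals_eq: "nonzero_ideals (- P) = ideals"
  unfolding nonzero_ideals_def ideals_def quad_integer_ring_def quad_integers_eq
  using ideal_sub_of_type_algebra_iff[OF zero_mem one_mem add_mem mult_mem minus_mem] by auto

lemma class_number_eq: "class_number (- P) = card (ideals // class_rel)"
proof -
  have "ideal_class_rel (- P) = class_rel"
    unfolding ideal_class_rel_def class_rel_def nonzero_ideals_eq quad_integers_eq ..
  then show ?thesis by (simp add: class_number_def nonzero_ideals_eq)
qed

end

theorem artin_class_number:
  assumes "ramified_prime P S"
  shows "int (class_number (- P)) = (\<Sum>g\<in>monic_below (degree P). leg P g)"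
proof -
  interpret R: ramified_prime P S by fact
  obtain w where "w ^ 2 = poly_to_ac (- P)" using nth_root_exists[of 2 "poly_to_ac (- P)"] by auto
  then interpret Q: quadratic_function_field P w
    by unfold_locales (use R.odd_deg in auto)
  show ?thesis unfolding Q.class_number_eq by (rule Q.class_number_formula[OF assms])
qed

section \<open>The order of the half-system product\<close>

lemma ord_eqI:
  fixes g f :: "'a::field poly"
  assumes "coprime f g" "d > 0" "[g ^ d = 1] (mod f)" "\<And>m. 0 < m \<Longrightarrow> m < d \<Longrightarrow> \<not> [g ^ m = 1] (mod f)"
  shows "ord f g = d"
proof -
  have "(LEAST d. d > 0 \<and> [g ^ d = 1] (mod f)) = d"
    by (rule Least_equality) (use assms(2-4) in \<open>auto simp: not_less[symmetric]\<close>)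
  then show ?thesis using assms(1) by (simp add: ord_def)
qed

lemma cong_power_1_imp_coprime:
  fixes g f :: "'a::field poly"
  assumes "[g ^ d = 1] (mod f)" "d > 0"
  shows "coprime f g"
proof (rule coprimeI)
  fix c assume "c dvd f" "c dvd g"
  then have "c dvd g ^ d" using assms(2) dvd_power[of d g] dvd_trans by blast
  moreover have "c dvd g ^ d - 1" using assms(1) \<open>c dvd f\<close> dvd_trans by (auto simp: cong_iff_dvd_diff)
  ultimately have "c dvd g ^ d - (g ^ d - 1)" by (rule dvd_diff)
  then show "is_unit c" by simp
qed

lemma ord_sign:
  fixes g f :: "'a::field poly"
  assumes "[g ^ 2 = 1] (mod f)"
  shows "ord f g = (if [g = 1] (mod f) then 1 else 2)"
proof (cases "[g = 1] (mod f)")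
  case True
  then have "ord f g = 1" by (intro ord_eqI cong_power_1_imp_coprime[of g 1]) auto
  then show ?thesis using True by simp
next
  case False
  have "ord f g = 2"
  proof (rule ord_eqI)
    fix m :: nat assume "0 < m" "m < 2"
    then have "m = 1" by simp
    then show "\<not> [g ^ m = 1] (mod f)" using False by simp
  qed (use assms cong_power_1_imp_coprime[OF assms] in auto)
  then show ?thesis using False by simp
qed

lemma ord_square_minus_1:
  fixes g f :: "'a::field poly"
  assumes "[g ^ 2 = - 1] (mod f)" "\<not> f dvd 2"
  shows "ord f g = 4"
proof -
  have "[(g ^ 2) ^ 2 = (- 1) ^ 2] (mod f)" using assms(1) by (rule cong_pow)
  then have 4: "[g ^ 4 = 1] (mod f)" by (simp flip: power_mult)
  have n1: "\<not> [(1 :: 'a poly) = - 1] (mod f)" using assms(2) by (simp add: cong_iff_dvd_diff)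
  have n2: "\<not> [g ^ 2 = 1] (mod f)" using assms(1) n1 cong_trans[OF cong_sym] by blast
  have n13: "\<not> [g ^ m = 1] (mod f)" if "m = 1 \<or> m = 3" for m
  proof
    assume m: "[g ^ m = 1] (mod f)"
    show False
    proof (cases "m = 1")
      case True
      then show False using cong_pow[OF m, of 2] n2 by simp
    next
      case False
      then have "[g ^ 3 * g = 1 * g] (mod f)" using m that by (intro cong_scalar_right) auto
      then have "[g ^ 4 = g] (mod f)" by (simp add: power_numeral_reduce mult.commute mult.left_commute)
      then have "[g = 1] (mod f)" using 4 cong_trans[OF cong_sym] by blast
      then show False using cong_pow[of g 1 f 2] n2 by simp
    qed
  qed
  show ?thesis
  proof (rule ord_eqI[OF cong_power_1_imp_coprime[OF 4]])
    fix m :: nat assume "0 < m" "m < 4"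
    then have "m = 1 \<or> m = 2 \<or> m = 3" by auto
    then show "\<not> [g ^ m = 1] (mod f)" using n2 n13 by auto
  qed (use 4 in auto)
qed

lemma coprime_irreducible_powers:
  fixes P Q :: "'a::field poly"
  assumes "irreducible P" "irreducible Q" "lead_coeff P = 1" "lead_coeff Q = 1" "P \<noteq> Q"
  shows "coprime (P ^ i) (Q ^ j)"
proof -
  have "\<not> P dvd Q" using monic_irreducible_dvd_eq[OF assms(1-4)] assms(5) by blast
  then have "coprime Q P" using coprime_irreducible_iff[OF assms(1)] by blast
  then have "coprime P (Q ^ j)" by (intro coprime_poly_power_right) (simp add: coprime_commute)
  then have "coprime (Q ^ j) (P ^ i)" by (intro coprime_poly_power_right) (simp add: coprime_commute)
  then show ?thesis by (simp add: coprime_commute)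
qed

lemma prod_dvd_iff_coprime:
  fixes m :: "'i \<Rightarrow> 'a::field poly"
  assumes "finite A" "\<And>i j. i \<in> A \<Longrightarrow> j \<in> A \<Longrightarrow> i \<noteq> j \<Longrightarrow> coprime (m i) (m j)"
  shows "(\<Prod>i\<in>A. m i) dvd x \<longleftrightarrow> (\<forall>i\<in>A. m i dvd x)"
  using assms
proof (induction A rule: finite_induct)
  case (insert i A)
  have cop: "coprime (m i) (\<Prod>i\<in>A. m i)" using insert by (intro coprime_poly_prod_right) auto
  have "m i * (\<Prod>i\<in>A. m i) dvd x \<longleftrightarrow> m i dvd x \<and> (\<Prod>i\<in>A. m i) dvd x"
  proof
    assume "m i dvd x \<and> (\<Prod>i\<in>A. m i) dvd x"
    then obtain y where y: "x = m i * y" "(\<Prod>i\<in>A. m i) dvd m i * y" by (auto elim: dvdE)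
    then have "(\<Prod>i\<in>A. m i) dvd y" using coprime_dvd_mult_poly[OF cop] by blast
    then show "m i * (\<Prod>i\<in>A. m i) dvd x" unfolding y(1) by (intro mult_dvd_mono) auto
  qed (auto dest: dvd_mult_left dvd_mult_right)
  then show ?case using insert by simp
qed simp

locale factored_modulus =
  fixes f :: "'a::{finite,field} poly" and a :: 'a and t :: nat and P :: "nat \<Rightarrow> 'a poly" and e :: "nat \<Rightarrow> nat"
    and S :: "'a set"
  assumes odd_card: "odd CARD('a)" and deg_f: "degree f \<ge> 1"
    and f: "f = smult a (\<Prod>j\<in>{1..t}. P j ^ e j)" and a: "a \<noteq> 0"
    and inj: "inj_on P {1..t}"
    and monic: "\<And>j. j \<in> {1..t} \<Longrightarrow> lead_coeff (P j) = 1"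
    and irr: "\<And>j. j \<in> {1..t} \<Longrightarrow> irreducible (P j)"
    and e: "\<And>j. j \<in> {1..t} \<Longrightarrow> e j \<ge> 1"
    and S: "half_system S"
begin

lemma irreducible_poly_P: "j \<in> {1..t} \<Longrightarrow> irreducible_poly (P j)"
  using monic irr odd_card by unfold_locales auto

lemma t_pos: "t \<ge> 1"
  using deg_f unfolding f by (cases t) auto

lemma P_neq: "i \<in> {1..t} \<Longrightarrow> j \<in> {1..t} \<Longrightarrow> i \<noteq> j \<Longrightarrow> P i \<noteq> P j"
  using inj_onD[OF inj, of i j] by blast

lemma dvd_f_iff: "f dvd x \<longleftrightarrow> (\<forall>j\<in>{1..t}. P j ^ e j dvd x)"
proof -
  have "(\<Prod>j\<in>{1..t}. P j ^ e j) dvd x \<longleftrightarrow> (\<forall>j\<in>{1..t}. P j ^ e j dvd x)"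
    by (rule prod_dvd_iff_coprime) (simp, intro coprime_irreducible_powers irr monic P_neq)
  then show ?thesis unfolding f using a by (simp add: smult_dvd_iff)
qed

lemma degree_f: "degree f = (\<Sum>j\<in>{1..t}. e j * degree (P j))"
proof -
  have nz: "P j \<noteq> 0" if "j \<in> {1..t}" for j using irr[OF that] by auto
  have "degree f = degree (\<Prod>j\<in>{1..t}. P j ^ e j)" unfolding f using a by simp
  also have "\<dots> = (\<Sum>j\<in>{1..t}. degree (P j ^ e j))" by (rule degree_prod_eq_sum_degree) (use nz in auto)
  also have "\<dots> = (\<Sum>j\<in>{1..t}. e j * degree (P j))" by (rule sum.cong) (use nz in \<open>auto simp: degree_power_eq\<close>)
  finally show ?thesis .
qed

lemma coprime_f_iff: "coprime g f \<longleftrightarrow> (\<forall>j\<in>{1..t}. \<not> P j dvd g)"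
proof
  assume cop: "coprime g f"
  show "\<forall>j\<in>{1..t}. \<not> P j dvd g"
  proof
    fix j assume j: "j \<in> {1..t}"
    have "P j ^ e j dvd f" using j dvd_f_iff[of f] by simp
    moreover have "P j dvd P j ^ e j" using e[OF j] by (simp add: dvd_power)
    ultimately have "P j dvd f" using dvd_trans by blast
    then show "\<not> P j dvd g" using cop coprime_common_divisor[of g f "P j"] irreducible_not_unit[OF irr[OF j]] by blast
  qed
next
  assume nd: "\<forall>j\<in>{1..t}. \<not> P j dvd g"
  have "coprime g (\<Prod>j\<in>{1..t}. P j ^ e j)"
    by (intro coprime_poly_prod_right coprime_poly_power_right) (use nd coprime_irreducible_iff[OF irr] in blast)
  moreover have "coprime g [:a:]" using a by (intro coprimeI) (meson is_unit_triv dvd_unit_imp_unit)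
  ultimately have "coprime g ([:a:] * (\<Prod>j\<in>{1..t}. P j ^ e j))" by (intro coprime_poly_mult_right)
  then show "coprime g f" by (simp add: f)
qed

lemma G_eq: "G f S = \<Prod>(signed_below S (degree f) (P ` {1..t}))"
proof -
  have "0 \<notin> S" using S by (auto simp: half_system_def)
  then have "{g. g \<noteq> 0 \<and> lead_coeff g \<in> S \<and> degree g < degree f \<and> coprime g f} = signed_below S (degree f) (P ` {1..t})"
    by (auto simp: signed_below_def mem_polys_below coprime_f_iff)
  then show ?thesis by (simp add: G_def)
qed

lemma not_f_dvd_2: "\<not> f dvd 2"
proof
  assume d: "f dvd 2"
  have "degree (2 :: 'a poly) = 0" by simp
  moreover have "(2 :: 'a poly) \<noteq> 0" using odd_card_two_neq_0[OF odd_card] by (metis numeral_poly pCons_eq_0_iff)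
  ultimately show False using dvd_imp_degree_le[OF d] deg_f by simp
qed

lemma G_sign:
  assumes "t \<ge> 2" and i: "i \<in> {1..t}"
  shows "\<exists>s\<in>{1, -1 :: int}. [G f S = of_int s] (mod P i ^ e i) \<and> (t \<ge> 3 \<longrightarrow> s = 1) \<and>
    (t = 2 \<longrightarrow> (\<forall>j\<in>{1..t}. j \<noteq> i \<longrightarrow> s = leg (P i) (P j) * (- 1) ^ ((CARD('a) ^ degree (P j) - 1) div 2)))"
proof -
  interpret Pi: irreducible_poly "P i" using i by (rule irreducible_poly_P)
  let ?R = "P ` ({1..t} - {i})"
  have ei: "e i > 0" using e[OF i] by simp
  have injR: "inj_on P ({1..t} - {i})" using inj by (rule inj_on_subset) auto
  have cR: "card ?R = t - 1" using card_image[OF injR] i by simp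
  have R0: "?R \<noteq> {}"
  proof
    assume "?R = {}"
    then have "card ?R = 0" by (simp only: card.empty)
    then have "t - 1 = 0" using cR by linarith
    then show False using assms(1) by simp
  qed
  have ins: "insert (P i) ?R = P ` {1..t}" using i by auto
  have Rp: "irreducible Q \<and> lead_coeff Q = 1 \<and> Q \<noteq> P i" if "Q \<in> ?R" for Q
    using that irr monic P_neq[OF _ i] by auto
  have "(\<Sum>Q\<in>?R. degree Q) = (\<Sum>j\<in>{1..t} - {i}. degree (P j))" by (subst sum.reindex[OF injR]) (simp add: comp_def)
  also have "\<dots> \<le> (\<Sum>j\<in>{1..t} - {i}. e j * degree (P j))" by (rule sum_mono) (use e in auto)
  finally have m: "degree f \<ge> e i * degree (P i) + (\<Sum>Q\<in>?R. degree Q)"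
    unfolding degree_f using sum.remove[of "{1..t}" i "\<lambda>j. e j * degree (P j)"] i by simp
  have fin: "finite ?R" by simp
  obtain s :: int where s': "s \<in> {1, -1}" "card ?R \<ge> 2 \<longrightarrow> s = 1"
    "\<And>m. m \<ge> e i * degree (P i) + (\<Sum>Q\<in>?R. degree Q) \<Longrightarrow> [\<Prod>(signed_below S m (insert (P i) ?R)) = of_int s] (mod P i ^ e i)"
    using Pi.signed_below_many_primes[OF ei S fin R0] Rp by blast
  have s: "s \<in> {1, -1}" "card ?R \<ge> 2 \<longrightarrow> s = 1" "[G f S = of_int s] (mod P i ^ e i)"
    using s'(1,2) s'(3)[OF m] unfolding ins G_eq by blast+
  have "s = leg (P i) (P j) * (- 1) ^ ((CARD('a) ^ degree (P j) - 1) div 2)"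
    if t2: "t = 2" and j: "j \<in> {1..t}" "j \<noteq> i" for j
  proof -
    have "{1..t} = {i, j}" using t2 i j by (auto simp: numeral_2_eq_2 atLeastAtMostSuc_conv)
    then have R: "?R = {P j}" using j(2) by auto
    have Q: "irreducible (P j)" "lead_coeff (P j) = 1" "P j \<noteq> P i" using Rp[of "P j"] R by auto
    have "[G f S = of_int (leg (P i) (P j) * (- 1) ^ ((CARD('a) ^ degree (P j) - 1) div 2))] (mod P i ^ e i)"
      using Pi.signed_below_two_primes(1)[OF ei S Q, of "degree f"] m ins unfolding R G_eq by (simp add: insert_commute)
    then have "[of_int s = of_int (leg (P i) (P j) * (- 1) ^ ((CARD('a) ^ degree (P j) - 1) div 2))] (mod P i ^ e i)"
      using cong_trans[OF cong_sym[OF s(3)]] by blast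
    moreover have "P i dvd P i ^ e i" using ei by (simp add: dvd_power)
    ultimately have "[of_int s = of_int (leg (P i) (P j) * (- 1) ^ ((CARD('a) ^ degree (P j) - 1) div 2))] (mod P i)"
      by (rule cong_dvd_modulus_poly)
    moreover have "leg (P i) (P j) * (- 1) ^ ((CARD('a) ^ degree (P j) - 1) div 2) \<in> {1, -1}"
      using Pi.leg_sign[OF Pi.not_dvd_monic[OF Q]] by (auto simp: minus_one_power_iff)
    ultimately show ?thesis using s(1) by (intro Pi.sign_cong_iff)
  qed
  then show ?thesis using s cR by (intro bexI[of _ s]) auto
qed

lemma cong_f_iff: "[x = y] (mod f) \<longleftrightarrow> (\<forall>j\<in>{1..t}. [x = y] (mod P j ^ e j))"
  by (simp add: cong_iff_dvd_diff dvd_f_iff)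

lemma sign_cong_power_iff:
  assumes i: "i \<in> {1..t}" and s: "s \<in> {1, -1 :: int}" and g: "[g = of_int s] (mod P i ^ e i)"
  shows "[g = 1] (mod P i ^ e i) \<longleftrightarrow> s = 1"
proof
  interpret Pi: irreducible_poly "P i" using i by (rule irreducible_poly_P)
  assume "[g = 1] (mod P i ^ e i)"
  then have "[of_int s = of_int 1] (mod P i ^ e i)" using cong_trans[OF cong_sym[OF g]] by simp
  moreover have "P i dvd P i ^ e i" using e[OF i] by (simp add: dvd_power)
  ultimately have "[of_int s = of_int 1] (mod P i)" by (rule cong_dvd_modulus_poly)
  then show "s = 1" using s by (intro Pi.sign_cong_iff) auto
qed (use g in auto)

lemma G_square: assumes "t \<ge> 2" shows "[G f S ^ 2 = 1] (mod f)"
  unfolding cong_f_iff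
proof
  fix i assume "i \<in> {1..t}"
  then obtain s :: int where "s \<in> {1, -1}" "[G f S = of_int s] (mod P i ^ e i)" using G_sign[OF assms] by blast
  then have "[G f S ^ 2 = of_int s ^ 2] (mod P i ^ e i)" by (intro cong_pow)
  moreover have "of_int s ^ 2 = (1 :: 'a poly)" using \<open>s \<in> {1, -1}\<close> by auto
  ultimately show "[G f S ^ 2 = 1] (mod P i ^ e i)" by simp
qed

lemma ord_three_primes: assumes "t \<ge> 3" shows "ord f (G f S) = 1"
proof -
  have t2: "t \<ge> 2" using assms by simp
  have "[G f S = 1] (mod f)" unfolding cong_f_iff using G_sign[OF t2] assms by fastforce
  then show ?thesis using ord_sign[OF G_square[OF t2]] by simp
qed

lemma ord_two_primes:
  assumes t: "t = 2"
  defines "h \<equiv> \<lambda>j. (CARD('a) ^ degree (P j) - 1) div 2"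
  shows "ord f (G f S) = (if even (h 1) \<and> even (h 2) \<and> poly_QuadRes (P 2) (P 1) then 1 else 2)"
proof -
  have t2: "t \<ge> 2" and i: "1 \<in> {1..t}" "2 \<in> {1..t}" using t by auto
  interpret P1: irreducible_poly "P 1" using i(1) by (rule irreducible_poly_P)
  interpret P2: irreducible_poly "P 2" using i(2) by (rule irreducible_poly_P)
  have ne: "P 1 \<noteq> P 2" using P_neq[OF i] by simp
  have h: "P1.half_order = h 1" "P2.half_order = h 2" unfolding P1.half_order_def P2.half_order_def h_def by (rule refl)+
  define l1 where "l1 = leg (P 1) (P 2)"
  define l2 where "l2 = leg (P 2) (P 1)"
  have l: "l1 \<in> {1, -1}" "l2 \<in> {1, -1}"
    unfolding l1_def l2_def using P1.leg_sign[OF P1.not_dvd_monic[OF P2.irr P2.monic ne[symmetric]]]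
      P2.leg_sign[OF P2.not_dvd_monic[OF P1.irr P1.monic ne]] by auto
  have rec: "l1 * l2 = (- 1) ^ (h 1 * h 2)"
    unfolding l1_def l2_def using quadratic_reciprocity[OF S P1.irreducible_poly_axioms P2.irreducible_poly_axioms ne] h by simp
  have s1: "[G f S = of_int (l1 * (- 1) ^ h 2)] (mod P 1 ^ e 1)"
  proof -
    obtain s :: int where s: "[G f S = of_int s] (mod P 1 ^ e 1)"
      "\<forall>j\<in>{1..t}. j \<noteq> 1 \<longrightarrow> s = leg (P 1) (P j) * (- 1) ^ h j"
      using G_sign[OF t2 i(1)] t unfolding h_def by blast
    from s(2) i(2) have "2 \<noteq> (1::nat) \<longrightarrow> s = leg (P 1) (P 2) * (- 1) ^ h 2" by (rule bspec)
    then have "s = l1 * (- 1) ^ h 2" unfolding l1_def by (rule mp) simp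
    then show ?thesis using s(1) by blast
  qed
  have s2: "[G f S = of_int (l2 * (- 1) ^ h 1)] (mod P 2 ^ e 2)"
  proof -
    obtain s :: int where s: "[G f S = of_int s] (mod P 2 ^ e 2)"
      "\<forall>j\<in>{1..t}. j \<noteq> 2 \<longrightarrow> s = leg (P 2) (P j) * (- 1) ^ h j"
      using G_sign[OF t2 i(2)] t unfolding h_def by blast
    from s(2) i(1) have "1 \<noteq> (2::nat) \<longrightarrow> s = leg (P 2) (P 1) * (- 1) ^ h 1" by (rule bspec)
    then have "s = l2 * (- 1) ^ h 1" unfolding l2_def by (rule mp) simp
    then show ?thesis using s(1) by blast
  qed
  have sg: "l1 * (- 1) ^ h 2 \<in> {1, -1}" "l2 * (- 1) ^ h 1 \<in> {1, -1}" using l by (auto simp: minus_one_power_iff)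
  have "{1..t} = {1, 2}" using t by auto
  then have "[G f S = 1] (mod f) \<longleftrightarrow> l1 * (- 1) ^ h 2 = 1 \<and> l2 * (- 1) ^ h 1 = 1"
    unfolding cong_f_iff using sign_cong_power_iff[OF i(1) sg(1) s1] sign_cong_power_iff[OF i(2) sg(2) s2] by simp
  also have "\<dots> \<longleftrightarrow> even (h 1) \<and> even (h 2) \<and> l2 = 1"
    using l rec by (auto simp: minus_one_power_iff split: if_splits)
  also have "l2 = 1 \<longleftrightarrow> poly_QuadRes (P 2) (P 1)"
    using P2.not_dvd_monic[OF P1.irr P1.monic ne] by (simp add: l2_def leg_def)
  finally show ?thesis using ord_sign[OF G_square[OF t2]] by simp
qed

lemma one_prime:
  assumes t: "t = 1"
  shows "G f S = \<Prod>(signed_below S (e 1 * degree (P 1)) {P 1})"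
    and "[x = y] (mod f) \<longleftrightarrow> [x = y] (mod P 1 ^ e 1)"
  using t by (simp_all add: G_eq degree_f cong_f_iff)

lemma ord_one_prime_4:
  assumes t: "t = 1" and c: "[CARD('a) = 1] (mod 4) \<or> even (degree (P 1))"
  shows "ord f (G f S) = 4"
proof -
  have i: "1 \<in> {1..t}" using t by simp
  interpret P1: irreducible_poly "P 1" using i by (rule irreducible_poly_P)
  have "e 1 > 0" using e[OF i] by simp
  moreover have "even P1.half_order" unfolding P1.half_order_def using even_half_iff[OF odd_card] c by blast
  ultimately have "[G f S ^ 2 = - 1] (mod f)"
    unfolding one_prime[OF t] using P1.prod_signed_residues_square[OF _ S, of "e 1"] by simp
  then show ?thesis using not_f_dvd_2 by (rule ord_square_minus_1)
qed

lemma ord_one_prime: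
  assumes t: "t = 1" and q3: "[CARD('a) = 3] (mod 4)" and d: "odd (degree (P 1))"
  defines "h \<equiv> class_number (- P 1)"
  obtains s :: int where "s \<in> {1, -1}" "delta S = of_int s"
    "ord f (G f S) = (if s * (- 1) ^ (e 1 - 1 + (h - 1) div 2) = 1 then 1 else 2)" "odd h"
proof -
  have i: "1 \<in> {1..t}" using t by simp
  interpret P1: irreducible_poly "P 1" using i by (rule irreducible_poly_P)
  have ei: "e 1 > 0" using e[OF i] by simp
  have R: "ramified_prime (P 1) S" by unfold_locales (use S q3 d in auto)
  have h: "int h = (\<Sum>g\<in>monic_below (degree (P 1)). leg (P 1) g)" unfolding h_def by (rule artin_class_number[OF R])
  note L = P1.sum_leg_parity[OF S q3 d h]
  obtain \<delta> :: int where \<delta>: "\<delta> \<in> {1, -1}" "delta S = of_int \<delta>"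
    "[\<Prod>(signed_below S (degree (P 1)) {P 1}) = of_int (\<delta> * (- 1) ^ ((h - 1) div 2))] (mod P 1)"
    using L(3) by blast
  define M where "M = P 1 ^ e 1"
  have PM: "P 1 dvd M" unfolding M_def using ei by (simp add: dvd_power)
  have sq: "[G f S ^ 2 = 1] (mod M)"
    unfolding one_prime(1)[OF t] M_def using P1.prod_signed_residues_square[OF ei S] L(2) by simp
  then have sqf: "[G f S ^ 2 = 1] (mod f)" unfolding one_prime(2)[OF t] M_def .
  define s where "s = \<delta> * (- 1) ^ (e 1 - 1 + (h - 1) div 2)"
  have s: "s \<in> {1, -1}" using \<delta> by (auto simp: s_def minus_one_power_iff)
  let ?l = "degree (P 1) * (e 1 - 1)"
  have q1: "\<not> [CARD('a) = 1] (mod 4)" using q3 by (simp add: cong_def)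
  have par: "even ((CARD('a) ^ ?l - 1) div 2) \<longleftrightarrow> even (e 1 - 1)"
    using even_half_iff[OF odd_card, of ?l] q1 d by simp
  have deq: "e 1 * degree (P 1) = 1 * degree (P 1) + ?l" using ei by (cases "e 1") simp_all
  have "[G f S = (- 1) ^ ((CARD('a) ^ ?l - 1) div 2) * \<Prod>(signed_below S (degree (P 1)) {P 1})] (mod P 1)"
    unfolding one_prime(1)[OF t] using P1.prod_signed_below_base(1)[OF _ S deq] by simp
  also have "(- 1) ^ ((CARD('a) ^ ?l - 1) div 2) = ((- 1) ^ (e 1 - 1) :: 'a poly)"
    using par by (simp only: minus_one_power_iff)
  also have "[(- 1) ^ (e 1 - 1) * \<Prod>(signed_below S (degree (P 1)) {P 1}) =
     (- 1) ^ (e 1 - 1) * of_int (\<delta> * (- 1) ^ ((h - 1) div 2))] (mod P 1)"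
    using \<delta>(3) by (rule cong_scalar_left)
  also have "(- 1) ^ (e 1 - 1) * of_int (\<delta> * (- 1) ^ ((h - 1) div 2)) = (of_int s :: 'a poly)"
    by (simp add: s_def power_add)
  finally have GP: "[G f S = of_int s] (mod P 1)" .
  have "M dvd (G f S - 1) * (G f S + 1)" using sq by (simp add: cong_iff_dvd_diff power2_eq_square algebra_simps)
  moreover have "\<not> (P 1 dvd G f S - 1 \<and> P 1 dvd G f S + 1)"
  proof
    assume dv: "P 1 dvd G f S - 1 \<and> P 1 dvd G f S + 1"
    have "P 1 dvd (G f S + 1) - (G f S - 1)" using dvd_diff[OF conjunct2[OF dv] conjunct1[OF dv]] .
    moreover have "(G f S + 1) - (G f S - 1) = 2" by simp
    ultimately have "P 1 dvd 2" by (simp only:)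
    then show False using P1.P_not_dvd_unit[OF P1.is_unit_two] by simp
  qed
  ultimately have "M dvd G f S - 1 \<or> M dvd G f S + 1"
    using P1.coprime_P_pow[OF ei] coprime_dvd_mult_poly[of "G f S - 1" M "G f S + 1"]
      coprime_dvd_mult_poly[of "G f S + 1" M "G f S - 1"] unfolding M_def by (auto simp: mult.commute)
  then obtain s' :: int where s': "s' \<in> {1, -1}" "[G f S = of_int s'] (mod M)"
    by (auto simp: cong_iff_dvd_diff intro: that[of 1] that[of "-1"])
  have "[of_int s' = of_int s] (mod P 1)"
    using cong_trans[OF cong_sym[OF cong_dvd_modulus_poly[OF s'(2) PM]] GP] .
  then have "s' = s" using s s'(1) by (intro P1.sign_cong_iff)
  then have "[G f S = 1] (mod f) \<longleftrightarrow> s = 1"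
    unfolding one_prime(2)[OF t] using sign_cong_power_iff[OF i s] s'(2) by (simp add: M_def)
  then have "ord f (G f S) = (if s = 1 then 1 else 2)" using ord_sign[OF sqf] by simp
  then show thesis using that[OF \<delta>(1,2)] L(1) unfolding s_def by blast
qed

end

theorem theorem4p1:
  fixes f :: "'a :: {finite, field} poly"
    and a :: 'a and t :: nat and P :: "nat \<Rightarrow> 'a poly" and e :: "nat \<Rightarrow> nat"
    and S :: "'a set"
  assumes "odd CARD('a)"
    and "Polynomial.degree f \<ge> 1"
    and "f = Polynomial.smult a (\<Prod>j\<in>{1..t}. P j ^ e j)"
    and "a \<noteq> 0"
    and "inj_on P {1..t}"
    and "\<And>j. j \<in> {1..t} \<Longrightarrow> Polynomial.lead_coeff (P j) = 1"
    and "\<And>j. j \<in> {1..t} \<Longrightarrow> Factorial_Ring.irreducible (P j)"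
    and "\<And>j. j \<in> {1..t} \<Longrightarrow> e j \<ge> 1"
    and "S \<subseteq> UNIV - {0}"
    and "card S = (CARD('a) - 1) div 2"
    and "\<And>\<alpha>. \<alpha> \<in> S \<Longrightarrow> - \<alpha> \<notin> S"
  shows "let
      d = (\<lambda>j. Polynomial.degree (P j));
      C1 = (t = 1 \<and> ([CARD('a) = 1] (mod 4) \<or> even (d 1)));
      C2a = (t = 1 \<and> [CARD('a) = 3] (mod 4) \<and> odd (d 1) \<and> delta S = 1 \<and>
             [int (e 1) + (int (class_number (- P 1)) - 3) div 2 = 1] (mod 2));
      C2b = (t = 1 \<and> [CARD('a) = 3] (mod 4) \<and> odd (d 1) \<and> delta S = - 1 \<and>
             [int (e 1) + (int (class_number (- P 1)) - 3) div 2 = 0] (mod 2));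
      C2c = (t = 2 \<and> [CARD('a) = 1] (mod 4) \<and> \<not> poly_QuadRes (P 2) (P 1));
      C2d = (t = 2 \<and> [CARD('a) = 3] (mod 4) \<and> even (d 1) \<and> even (d 2) \<and>
             \<not> poly_QuadRes (P 2) (P 1));
      C2e = (t = 2 \<and> [CARD('a) = 3] (mod 4) \<and> (odd (d 1) \<or> odd (d 2)));
      C2 = (C2a \<or> C2b \<or> C2c \<or> C2d \<or> C2e)
    in (C1 \<longrightarrow> ord f (G f S) = 4) \<and>
       (C2 \<longrightarrow> ord f (G f S) = 2) \<and>
       (\<not> C1 \<and> \<not> C2 \<longrightarrow> ord f (G f S) = 1)"
proof -
  have S: "half_system S" by (rule half_systemI[OF assms(1,9,10,11)])
  interpret F: factored_modulus f a t P e S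
    by (rule factored_modulus.intro) (use assms S in blast)+
  let ?q = "CARD('a)"
  have "?q mod 4 = 1 \<or> ?q mod 4 = 3" using assms(1) by presburger
  then have q: "[?q = 3] (mod 4) \<longleftrightarrow> \<not> [?q = 1] (mod 4)" by (auto simp: cong_def)
  have m1: "(1 :: 'a) \<noteq> - 1" using odd_card_two_neq_0[OF assms(1)] by (simp add: eq_neg_iff_add_eq_0)
  consider "t = 1" "[?q = 1] (mod 4) \<or> even (degree (P 1))" | "t = 1" "[?q = 3] (mod 4)" "odd (degree (P 1))"
    | "t = 2" | "t \<ge> 3"
    using F.t_pos q by linarith
  then show ?thesis
  proof cases
    case 1
    have "ord f (G f S) = 4" using 1 by (rule F.ord_one_prime_4)
    then show ?thesis unfolding Let_def using 1 q by auto
  next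
    case 2
    let ?h = "class_number (- P 1)"
    obtain s :: int where s: "s \<in> {1, -1}" "delta S = of_int s"
      "ord f (G f S) = (if s * (- 1) ^ (e 1 - 1 + (?h - 1) div 2) = 1 then 1 else 2)" "odd ?h"
      using 2 by (rule F.ord_one_prime)
    have e1: "e 1 \<ge> 1" using assms(8)[of 1] 2(1) by simp
    obtain m where m: "?h = 2 * m + 1" using s(4) by (rule oddE)
    define n where "n = e 1 - 1 + m"
    have x: "int (e 1) + (int ?h - 3) div 2 = int n"
    proof -
      have "int ?h = 2 * int m + 1" using m by simp
      then have "(int ?h - 3) div 2 = int m - 1" by presburger
      then show ?thesis using e1 by (simp only: n_def)
    qed
    have o: "ord f (G f S) = (if s * (- 1) ^ n = 1 then 1 else 2)"
    proof -
      have "(?h - 1) div 2 = m" unfolding m by simp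
      then show ?thesis using s(3) unfolding n_def by (simp only:)
    qed
    have c1: "[int n = 1] (mod 2) \<longleftrightarrow> odd n" and c0: "[int n = 0] (mod 2) \<longleftrightarrow> even n"
      by (simp_all add: cong_def, presburger+)
    have "delta S = 1 \<longleftrightarrow> s = 1" "delta S = - 1 \<longleftrightarrow> s = - 1" using s(1,2) m1 by auto
    then show ?thesis unfolding Let_def x c1 c0 o using 2 q s(1) by (auto simp: minus_one_power_iff)
  next
    case 3
    show ?thesis unfolding Let_def F.ord_two_primes[OF 3] even_half_iff[OF assms(1)] using 3 q by auto
  next
    case 4
    then show ?thesis unfolding Let_def using F.ord_three_primes by simp
  qed
qed

end
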